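(* Let $\Lambda=\Lambda_0\oplus\Lambda_1$ be a finite-dimensional real commutative superalgebra satisfying conditions $(A_0)$ and $(A_1)$, and let $D$ be a domain of $\Lambda_0^n\times\Lambda_1^m$. If $f:D\to\Lambda$ is qS-differentiable on $D$, then $f$ is harmonic on $D$ (with respect to the real coordinates $y_i^k,\theta_i^l$), hence $\mathbb R$-analytic on $D$.
   Context: A real commutative superalgebra (CSA) is an associative unital real algebra with a grading $\Lambda=\Lambda_0\oplus\Lambda_1$, $\Lambda_i\Lambda_j\subset\Lambda_{i+j \bmod 2}$, such that $ab=(-1)^{\sigma(a)\sigma(b)}ba$ for homogeneous $a,b$, where $\sigma(a)=i$ for $a\in\Lambda_i$. Condition $(A_0)$: there is a basis $(e_0=1,e_1,\dots,e_p)$ of $\Lambda_0$ with $\sum_{k=0}^p e_k^2=0$. Condition $(A_1)$: there are a basis $(\varepsilon_1,\dots,\varepsilon_q)$ of $\Lambda_1$, integers $1=s_1<s_2<\dots<s_r<s_{r+1}=q+1$ and elements $a_1,\dots,a_q\in\Lambda_0$ such that $\varepsilon_j=a_j\varepsilon_{s_k}$ whenever $s_k\le j<s_{k+1}$, $a_{s_1}=\dots=a_{s_r}=e_0$, and $\sum_{j=s_k}^{s_{k+1}-1}a_j^2=0$ for every $k=1,\dots,r$. Such bases and elements are fixed. A point of $\Lambda_0^n\times\Lambda_1^m$ is written $(y_1,\dots,y_n,\theta_1,\dots,\theta_m)$ with $y_i=\sum_{k=0}^p y_i^k e_k$, $\theta_i=\sum_{l=1}^q\theta_i^l\varepsilon_l$,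 where $y_i^k,\theta_i^l$ are real coordinates. For a Fréchet-differentiable (over $\mathbb R$) function $f$ with values in $\Lambda$ put $$d''f=\sum_{i=1}^n\sum_{j=1}^p \Big(\frac{\partial f}{\partial y_i^j}-e_j\frac{\partial f}{\partial y_i^0}\Big)dy_i^j+\sum_{i=1}^m\sum_{k=1}^r\sum_{t=s_k+1}^{s_{k+1}-1}\Big(\frac{\partial f}{\partial\theta_i^t}-a_t\frac{\partial f}{\partial\theta_i^{s_k}}\Big)d\theta_i^t .$$ A function is qS-differentiable on an open set if it is Fréchet-differentiable there and $d''f\equiv0$. A domain is a connected open set. *)

theory Defs
  imports "HOL-Analysis.Analysis"
begin

section \<open>Real commutative superalgebras\<close>

text \<open>
  The algebra \<open>\<Lambda>\<close> is the whole type, and \<open>\<Lambda> 0\<close>, \<open>\<Lambda> 1\<close> are its even and odd parts.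
  The norm of the type is an arbitrary vector space norm; no compatibility with the
  multiplication is required. In finite dimension all norms are equivalent, so it serves only
  to express topology and Frechet differentiability.
\<close>

definition indexed_basis :: "'k set \<Rightarrow> ('k \<Rightarrow> 'v::real_vector) \<Rightarrow> 'v set \<Rightarrow> bool" where
  "indexed_basis I b V \<longleftrightarrow> inj_on b I \<and> independent (b ` I) \<and> span (b ` I) = V"

definition comm_superalgebra :: "(nat \<Rightarrow> 'a::real_algebra_1 set) \<Rightarrow> bool" where
  "comm_superalgebra \<Lambda> \<longleftrightarrow>
     subspace (\<Lambda> 0) \<and> subspace (\<Lambda> 1) \<and>
     \<Lambda> 0 \<inter> \<Lambda> 1 = {0} \<and> (\<forall>x. \<exists>a\<in>\<Lambda> 0. \<exists>b\<in>\<Lambda> 1. x = a + b) \<and>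
     (\<forall>i\<in>{0,1}. \<forall>j\<in>{0,1}. \<forall>a\<in>\<Lambda> i. \<forall>b\<in>\<Lambda> j.
        a * b \<in> \<Lambda> ((i + j) mod 2) \<and> a * b = (-1) ^ (i * j) * (b * a))"

definition condition_A0 :: "(nat \<Rightarrow> 'a::real_algebra_1 set) \<Rightarrow> nat \<Rightarrow> (nat \<Rightarrow> 'a) \<Rightarrow> bool" where
  "condition_A0 \<Lambda> p e \<longleftrightarrow>
     indexed_basis {0..p} e (\<Lambda> 0) \<and> e 0 = 1 \<and> (\<Sum>k=0..p. (e k)\<^sup>2) = 0"

text \<open>The case \<open>q = r = 0\<close>, i.e. a vanishing odd part, is included.\<close>

definition condition_A1 ::
  "(nat \<Rightarrow> 'a::real_algebra_1 set) \<Rightarrow> nat \<Rightarrow> (nat \<Rightarrow> 'a) \<Rightarrow> nat \<Rightarrow> (nat \<Rightarrow> nat) \<Rightarrow> (nat \<Rightarrow> 'a) \<Rightarrow> bool" where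
  "condition_A1 \<Lambda> q \<epsilon> r s a \<longleftrightarrow>
     indexed_basis {1..q} \<epsilon> (\<Lambda> 1) \<and>
     s 1 = 1 \<and> s (r + 1) = q + 1 \<and> (\<forall>k\<in>{1..r}. s k < s (k + 1)) \<and>
     (\<forall>j\<in>{1..q}. a j \<in> \<Lambda> 0) \<and>
     (\<forall>k\<in>{1..r}. \<forall>j\<in>{s k..<s (k + 1)}. \<epsilon> j = a j * \<epsilon> (s k)) \<and>
     (\<forall>k\<in>{1..r}. a (s k) = 1) \<and>
     (\<forall>k\<in>{1..r}. (\<Sum>j\<in>{s k..<s (k + 1)}. (a j)\<^sup>2) = 0)"

section \<open>The superspace and its real coordinates\<close>

text \<open>
  A point \<open>(y\<^sub>1,\<dots>,y\<^sub>n,\<theta>\<^sub>1,\<dots>,\<theta>\<^sub>m)\<close> is one vector \<open>z\<close> over a finite index type: \<open>E\<close> is the set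
  of the \<open>n\<close> indices of the even variables \<open>y\<close>, and \<open>- E\<close> that of the \<open>m\<close> indices of the odd
  variables \<open>\<theta>\<close>. Unlike a product of two vector types, this allows \<open>n = 0\<close> or \<open>m = 0\<close>.
\<close>

definition superspace :: "(nat \<Rightarrow> 'a set) \<Rightarrow> 'i set \<Rightarrow> ('a ^ 'i::finite) set" where
  "superspace \<Lambda> E = {z. (\<forall>i\<in>E. z $ i \<in> \<Lambda> 0) \<and> (\<forall>i\<in>- E. z $ i \<in> \<Lambda> 1)}"

text \<open>
  The real coordinates are indexed by pairs: \<open>(i, k)\<close> stands for \<open>y\<^sub>i\<^sup>k\<close> if \<open>i \<in> E\<close> and for
  \<open>\<theta>\<^sub>i\<^sup>k\<close> otherwise; \<open>coord_dir\<close> is the corresponding unit coordinate direction.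
\<close>

definition coord_index :: "'i set \<Rightarrow> nat \<Rightarrow> nat \<Rightarrow> ('i \<times> nat) set" where
  "coord_index E p q = E \<times> {0..p} \<union> (- E) \<times> {1..q}"

definition coord_dir ::
  "'i set \<Rightarrow> (nat \<Rightarrow> 'a) \<Rightarrow> (nat \<Rightarrow> 'a) \<Rightarrow> 'i \<times> nat \<Rightarrow> 'a::zero ^ 'i::finite" where
  "coord_dir E e \<epsilon> = (\<lambda>(i, k). axis i (if i \<in> E then e k else \<epsilon> k))"

definition partial_deriv ::
  "('v::real_normed_vector \<Rightarrow> 'w::real_normed_vector) \<Rightarrow> 'v \<Rightarrow> 'v \<Rightarrow> 'w" where
  "partial_deriv f v z = vector_derivative (\<lambda>t. f (z + t *\<^sub>R v)) (at 0)"

definition has_partial_deriv ::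
  "('v::real_normed_vector \<Rightarrow> 'w::real_normed_vector) \<Rightarrow> 'v \<Rightarrow> 'v \<Rightarrow> bool" where
  "has_partial_deriv f v z \<longleftrightarrow> (\<lambda>t. f (z + t *\<^sub>R v)) differentiable (at 0)"

section \<open>qS-differentiability\<close>

text \<open>
  \<open>d''_form \<dots> f z h\<close> is the value at the tangent vector \<open>h\<close> of the 1-form \<open>d''f\<close> at \<open>z\<close>. The factors
  \<open>representation\<close> are the coordinate forms \<open>dy\<^sub>i\<^sup>j(h)\<close> and \<open>d\<theta>\<^sub>i\<^sup>t(h)\<close>.
\<close>

definition d''_form ::
  "'i set \<Rightarrow> nat \<Rightarrow> (nat \<Rightarrow> 'a) \<Rightarrow> nat \<Rightarrow> (nat \<Rightarrow> 'a) \<Rightarrow> nat \<Rightarrow> (nat \<Rightarrow> nat) \<Rightarrow> (nat \<Rightarrow> 'a) \<Rightarrow>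
   ('a ^ 'i::finite \<Rightarrow> 'a) \<Rightarrow> 'a ^ 'i \<Rightarrow> 'a ^ 'i \<Rightarrow> 'a::{real_normed_vector,real_algebra_1}" where
  "d''_form E p e q \<epsilon> r s a f z h =
     (\<Sum>i\<in>E. \<Sum>j=1..p. representation (e ` {0..p}) (h $ i) (e j) *\<^sub>R
        (partial_deriv f (coord_dir E e \<epsilon> (i, j)) z
          - e j * partial_deriv f (coord_dir E e \<epsilon> (i, 0)) z)) +
     (\<Sum>i\<in>- E. \<Sum>k=1..r. \<Sum>t\<in>{s k + 1..<s (k + 1)}.
        representation (\<epsilon> ` {1..q}) (h $ i) (\<epsilon> t) *\<^sub>R
        (partial_deriv f (coord_dir E e \<epsilon> (i, t)) z
          - a t * partial_deriv f (coord_dir E e \<epsilon> (i, s k)) z))"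

text \<open>
  \<open>D\<close> is meant to be open in the superspace, so that differentiability within \<open>D\<close> is Frechet
  differentiability of \<open>f\<close> as a function on the superspace.
\<close>

definition qS_differentiable_on ::
  "(nat \<Rightarrow> 'a set) \<Rightarrow> 'i set \<Rightarrow> nat \<Rightarrow> (nat \<Rightarrow> 'a) \<Rightarrow> nat \<Rightarrow> (nat \<Rightarrow> 'a) \<Rightarrow> nat \<Rightarrow> (nat \<Rightarrow> nat) \<Rightarrow> (nat \<Rightarrow> 'a) \<Rightarrow>
   ('a ^ 'i::finite \<Rightarrow> 'a::{real_normed_vector,real_algebra_1}) \<Rightarrow> ('a ^ 'i) set \<Rightarrow> bool" where
  "qS_differentiable_on \<Lambda> E p e q \<epsilon> r s a f D \<longleftrightarrow>
     f differentiable_on D \<and>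
     (\<forall>z\<in>D. \<forall>h\<in>superspace \<Lambda> E. d''_form E p e q \<epsilon> r s a f z h = 0)"

section \<open>Harmonic and real analytic functions in given linear coordinates\<close>

text \<open>
  In both definitions \<open>b \<kappa>\<close>, for \<open>\<kappa>\<close> in the finite set \<open>K\<close>, are the coordinate directions of the
  subspace in which \<open>D\<close> is open.
\<close>

definition C2_on ::
  "'k set \<Rightarrow> ('k \<Rightarrow> 'v) \<Rightarrow> ('v::real_normed_vector \<Rightarrow> 'w::real_normed_vector) \<Rightarrow> 'v set \<Rightarrow> bool" where
  "C2_on K b f D \<longleftrightarrow>
     continuous_on D f \<and>
     (\<forall>\<kappa>\<in>K. (\<forall>z\<in>D. has_partial_deriv f (b \<kappa>) z) \<and> continuous_on D (partial_deriv f (b \<kappa>))) \<and>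
     (\<forall>\<kappa>\<in>K. \<forall>\<mu>\<in>K.
        (\<forall>z\<in>D. has_partial_deriv (partial_deriv f (b \<kappa>)) (b \<mu>) z) \<and>
        continuous_on D (partial_deriv (partial_deriv f (b \<kappa>)) (b \<mu>)))"

definition harmonic_on ::
  "'k set \<Rightarrow> ('k \<Rightarrow> 'v) \<Rightarrow> ('v::real_normed_vector \<Rightarrow> 'w::real_normed_vector) \<Rightarrow> 'v set \<Rightarrow> bool" where
  "harmonic_on K b f D \<longleftrightarrow>
     C2_on K b f D \<and>
     (\<forall>z\<in>D. (\<Sum>\<kappa>\<in>K. partial_deriv (partial_deriv f (b \<kappa>)) (b \<kappa>) z) = 0)"

text \<open>
  Local expansion into a power series in the coordinates \<open>x \<kappa>\<close>, indexed by the multi-indices \<open>\<alpha>\<close>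
  supported in \<open>K\<close>.
\<close>

definition real_analytic_on ::
  "'k set \<Rightarrow> ('k \<Rightarrow> 'v) \<Rightarrow> ('v::real_normed_vector \<Rightarrow> 'w::real_normed_vector) \<Rightarrow> 'v set \<Rightarrow> bool" where
  "real_analytic_on K b f D \<longleftrightarrow>
     (\<forall>z\<in>D. \<exists>c :: ('k \<Rightarrow> nat) \<Rightarrow> 'w. \<exists>\<rho>>0. \<forall>x :: 'k \<Rightarrow> real. (\<forall>\<kappa>\<in>K. \<bar>x \<kappa>\<bar> < \<rho>) \<longrightarrow>
        z + (\<Sum>\<kappa>\<in>K. x \<kappa> *\<^sub>R b \<kappa>) \<in> D \<and>
        ((\<lambda>\<alpha>. (\<Prod>\<kappa>\<in>K. x \<kappa> ^ \<alpha> \<kappa>) *\<^sub>R c \<alpha>) has_sum f (z + (\<Sum>\<kappa>\<in>K. x \<kappa> *\<^sub>R b \<kappa>)))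
          {\<alpha>. \<forall>\<kappa>. \<kappa> \<notin> K \<longrightarrow> \<alpha> \<kappa> = 0})"

end

theory Submission
  imports Defs
begin

text \<open>
  For a real linear functional \<open>l\<close> on \<open>\<Lambda>\<close> the system \<open>d''f = 0\<close> says that the differentiable real functions
  \<open>u\<^sub>c = l (c f)\<close>, \<open>c \<in> \<Lambda>\<close>, satisfy \<open>\<partial>\<^sub>j u\<^sub>c = \<partial>\<^bsub>\<beta> j\<^esub> u\<^bsub>c a j\<^esub>\<close>, where \<open>\<beta> j\<close> is the first coordinate of the
  block of \<open>j\<close>. No continuity of the derivatives is available, but a bisection argument in the manner of
  Goursat still yields the weak form of these equations. Applying it twice to a test function \<open>\<psi>\<close> and
  summing over a block, where \<open>\<Sum> a\<^sub>j\<^sup>2 = 0\<close>, gives \<open>\<integral> u\<^sub>c \<Delta>\<psi> = 0\<close>. With radial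
  \<open>\<psi> = (max 0 (\<rho>\<^sup>2 - |z - x|\<^sup>2))\<^sup>4\<close> this becomes Euler's differential equation in \<open>\<rho>\<close> for the integral of \<open>u\<close>
  against a bump, hence a mean value property (Weyl's lemma). Differentiating the bump instead of \<open>u\<close>
  gives interior derivative estimates; iterated, they bound the derivatives of order \<open>m\<close> by \<open>M A\<^sup>m m!\<close>,
  so that the Taylor series converges.

  The dimension is not fixed by a type, so points are functions \<open>'k \<Rightarrow> real\<close> and integrals over
  the cube are iterated one-dimensional integrals along a list of coordinates.
\<close>

section \<open>Iterated integrals over a cube\<close>

text \<open>A solution is only differentiable, so for a pair with \<partial>_i U = \<partial>_j V
  these derivatives need not be integrable one by one. They cancel pointwise in \<partial>_i (U
  \<phi>) - \<partial>_j (V \<phi>), and what remains, U \<partial>_i \<phi> - V \<partial>_j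
  \<phi>, is continuous. Goursat's bisection needs no more than that, and it only has to be carried
  out in coordinate planes. The test function is a fourth power, so its gradient carries a third and
  its Hessian a second power: everything integrated is continuous and everything differentiated is
  C^1. The Laplacian combines the second and third powers, and the radial derivative of the third
  power is a multiple of the second; this closes Euler's equation. Polar coordinates and changes of
  variables are avoided by comparing with the solution 1. The cube has sides [-2,2] because centres
  in (-1,1) and radii below 1 then keep every support inside; other boxes are reached by affine
  rescaling.\<close>

definition slice_int :: "'k \<Rightarrow> (('k \<Rightarrow> real) \<Rightarrow> real) \<Rightarrow> ('k \<Rightarrow> real) \<Rightarrow> real" where
  "slice_int j F z = integral {-2..2} (\<lambda>t. F (z(j := t)))"

lemma continuous_on_fun_upd:
  fixes f :: "'b::topological_space \<Rightarrow> 'k \<Rightarrow> 'c::topological_space"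
  assumes "continuous_on S f" "continuous_on S g"
  shows "continuous_on S (\<lambda>x. (f x)(j := g x))"
proof (rule continuous_on_coordinatewise_then_product)
  fix i show "continuous_on S (\<lambda>x. ((f x)(j := g x)) i)"
    using assms continuous_on_product_then_coordinatewise[OF assms(1), of i] by (cases "i = j") auto
qed

section \<open>Integration over the cube: Fubini, linearity, positivity, Leibniz rule\<close>

locale coord_cube =
  fixes ks :: "'k list"
  assumes distinct_ks: "distinct ks"
begin

definition cube :: "('k \<Rightarrow> real) set" where
  "cube = {z. \<forall>j\<in>set ks. z j \<in> {-2..2}}"

text \<open>The evaluation point 0 only fixes the coordinates outside \<open>ks\<close>; those in
  \<open>ks\<close> are overwritten by the slices.\<close>

definition cube_int :: "(('k \<Rightarrow> real) \<Rightarrow> real) \<Rightarrow> real" where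
  "cube_int F = foldr slice_int ks F (\<lambda>_. 0)"

lemma zero_in_cube: "(\<lambda>_. 0) \<in> cube"
  by (simp add: cube_def)

lemma cube_upd: "z \<in> cube \<Longrightarrow> t \<in> {-2..2} \<Longrightarrow> z(j := t) \<in> cube"
  by (auto simp: cube_def)

lemma slice_int_cong:
  assumes "\<And>z. z \<in> cube \<Longrightarrow> F z = G z" "z \<in> cube"
  shows "slice_int j F z = slice_int j G z"
  unfolding slice_int_def by (intro integral_cong) (use assms cube_upd in auto)

lemma foldr_slice_int_cong:
  assumes "\<And>z. z \<in> cube \<Longrightarrow> F z = G z" "z \<in> cube"
  shows "foldr slice_int l F z = foldr slice_int l G z"
  using assms(2)
proof (induction l arbitrary: z)
  case (Cons j l)
  show ?case using slice_int_cong[OF Cons.IH Cons.prems] by simp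
qed (use assms in simp)

lemma cube_int_cong:
  assumes "\<And>z. z \<in> cube \<Longrightarrow> F z = G z"
  shows "cube_int F = cube_int G"
  unfolding cube_int_def using foldr_slice_int_cong[OF assms] zero_in_cube by auto

text \<open>The parameter \<open>h\<close> is carried along for two later uses: differentiation
  under the integral requires joint continuity at every level of the iteration, and kernel formulas
  are to depend continuously on their base point.\<close>

lemma continuous_on_param_slice_int:
  assumes "continuous_on (S \<times> cube) (\<lambda>(h, z). G h z)"
  shows "continuous_on (S \<times> cube) (\<lambda>(h, z). slice_int j (G h) z)"
proof -
  have "continuous_on ((S \<times> cube) \<times> cbox (-2) 2) (\<lambda>(p, t). G (fst p) ((snd p)(j := t)))"
    unfolding case_prod_beta
    by (rule continuous_on_compose2[OF assms[unfolded case_prod_beta],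
          where f = "\<lambda>x. (fst (fst x), (snd (fst x))(j := snd x))", simplified])
       (auto intro!: continuous_on_Pair continuous_on_fun_upd continuous_on_fst continuous_on_snd continuous_on_id continuous_on_const simp: cube_upd)
  from integral_continuous_on_param[OF this] show ?thesis
    by (simp add: slice_int_def case_prod_beta)
qed

lemma continuous_on_param_foldr:
  assumes "continuous_on (S \<times> cube) (\<lambda>(h, z). G h z)"
  shows "continuous_on (S \<times> cube) (\<lambda>(h, z). foldr slice_int l (G h) z)"
proof (induction l)
  case (Cons j l)
  from continuous_on_param_slice_int[OF this] show ?case by simp
qed (use assms in simp)

lemma continuous_on_param_cube_int:
  assumes "continuous_on (S \<times> cube) (\<lambda>(h, z). G h z)"
  shows "continuous_on S (\<lambda>h. cube_int (G h))"
  unfolding cube_int_def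
  by (rule continuous_on_compose2[OF continuous_on_param_foldr[OF assms, unfolded case_prod_beta],
        where f = "\<lambda>h. (h, \<lambda>_. 0)", simplified])
     (auto intro!: continuous_on_Pair continuous_on_id continuous_on_const simp: zero_in_cube)

lemma continuous_on_foldr:
  assumes "continuous_on cube F"
  shows "continuous_on cube (foldr slice_int l F)"
proof -
  \<comment> \<open>A one-point parameter set turns the parametric statement into plain
    continuity.\<close>
  have "continuous_on ({0::real} \<times> cube) (\<lambda>(h, z). F z)"
    unfolding case_prod_beta by (rule continuous_on_compose2[OF assms]) (auto intro!: continuous_on_snd continuous_on_id)
  from continuous_on_param_foldr[OF this, of l]
  have "continuous_on ({0::real} \<times> cube) (\<lambda>p. foldr slice_int l F (snd p))"
    by (simp add: case_prod_beta)
  then have "continuous_on cube (\<lambda>z. foldr slice_int l F (snd (0::real, z)))"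
    by (rule continuous_on_compose2) (auto intro!: continuous_on_Pair continuous_on_id continuous_on_const)
  then show ?thesis by simp
qed

lemma continuous_on_slice:
  assumes "continuous_on cube F" "z \<in> cube"
  shows "continuous_on {-2..2} (\<lambda>t. F (z(j := t)))"
  by (rule continuous_on_compose2[OF assms(1)])
     (use assms(2) in \<open>auto intro!: continuous_on_fun_upd continuous_on_fst continuous_on_snd continuous_on_id continuous_on_const simp: cube_upd\<close>)

lemma integrable_slice:
  fixes F :: "('k \<Rightarrow> real) \<Rightarrow> real"
  assumes "continuous_on cube F" "z \<in> cube"
  shows "(\<lambda>t. F (z(j := t))) integrable_on {-2..2}"
  by (rule integrable_continuous_real, rule continuous_on_slice[OF assms])

lemma slice_int_swap:
  assumes "continuous_on cube F" "z \<in> cube"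
  shows "slice_int j (slice_int i F) z = slice_int i (slice_int j F) z"
proof (cases "j = i")
  case False
  have "continuous_on (cbox (-2,-2) (2,2)) (\<lambda>(s::real, t::real). F (z(j := s, i := t)))"
    unfolding case_prod_beta
    by (rule continuous_on_compose2[OF assms(1)])
       (use assms(2) in \<open>auto intro!: continuous_on_fun_upd continuous_on_fst continuous_on_snd continuous_on_id continuous_on_const simp: cube_upd\<close>)
  note swap = integral_swap_continuous[OF this]
  have "slice_int j (slice_int i F) z
      = integral {-2..2} (\<lambda>s. integral {-2..2} (\<lambda>t. F (z(j := s, i := t))))"
    unfolding slice_int_def[of j] slice_int_def[of i] ..
  also have "\<dots> = integral {-2..2} (\<lambda>t. integral {-2..2} (\<lambda>s. F (z(j := s, i := t))))"
    using swap unfolding cbox_interval .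
  also have "\<dots> = integral {-2..2} (\<lambda>t. integral {-2..2} (\<lambda>s. F (z(i := t, j := s))))"
    by (subst fun_upd_twist[OF False]) (rule refl)
  also have "\<dots> = slice_int i (slice_int j F) z"
    unfolding slice_int_def[of j] slice_int_def[of i] ..
  finally show ?thesis .
qed simp

lemma foldr_slice_int_pull:
  assumes "continuous_on cube F" "z \<in> cube"
  shows "foldr slice_int l (slice_int j F) z = slice_int j (foldr slice_int l F) z"
  using assms(2)
proof (induction l arbitrary: z)
  case (Cons i l)
  have "foldr slice_int (i # l) (slice_int j F) z
      = slice_int i (slice_int j (foldr slice_int l F)) z"
    using slice_int_cong[OF Cons.IH Cons.prems] by simp
  also have "\<dots> = slice_int j (slice_int i (foldr slice_int l F)) z"
    by (rule slice_int_swap[OF continuous_on_foldr[OF assms(1)] Cons.prems])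
  finally show ?case by simp
qed auto

text \<open>Fubini for continuous integrands: any chosen coordinate can be integrated first, so a
  cancellation along it can be used before the other coordinates are touched.\<close>

lemma foldr_slice_int_remove1:
  assumes "continuous_on cube F" "z \<in> cube" "j \<in> set l"
  shows "foldr slice_int l F z = foldr slice_int (remove1 j l) (slice_int j F) z"
  using assms(2,3)
proof (induction l arbitrary: z)
  case (Cons i l)
  show ?case
  proof (cases "i = j")
    case True
    then show ?thesis using foldr_slice_int_pull[OF assms(1) Cons.prems(1), of l j] by simp
  next
    case False
    then have "foldr slice_int l F z' = foldr slice_int (remove1 j l) (slice_int j F) z'"
      if "z' \<in> cube" for z'
      using Cons.IH[OF that] Cons.prems by auto
    from slice_int_cong[OF this Cons.prems(1), where j = i] show ?thesis using False by simp
  qed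
qed auto

lemma foldr_slice_int_zero: "foldr slice_int l (\<lambda>z. 0) = (\<lambda>z. 0)"
proof (induction l)
  case (Cons j l)
  have "slice_int j (\<lambda>z. 0) = (\<lambda>z. 0)"
    by (rule ext) (simp add: slice_int_def)
  with Cons show ?case by simp
qed auto

lemma cube_int_eq_0:
  assumes "continuous_on cube F" "j \<in> set ks" "\<And>z. z \<in> cube \<Longrightarrow> slice_int j F z = 0"
  shows "cube_int F = 0"
proof -
  have "cube_int F = foldr slice_int (remove1 j ks) (slice_int j F) (\<lambda>_. 0)"
    unfolding cube_int_def by (rule foldr_slice_int_remove1[OF assms(1) zero_in_cube assms(2)])
  also have "\<dots> = foldr slice_int (remove1 j ks) (\<lambda>z. 0) (\<lambda>_. 0)"
    by (rule foldr_slice_int_cong[OF _ zero_in_cube]) (use assms in auto)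
  finally show ?thesis by (simp add: foldr_slice_int_zero)
qed

text \<open>With two coordinates brought innermost, a planar identity such as Green's formula can be
  applied slice by slice.\<close>

lemma cube_int_eq_0_double:
  assumes "continuous_on cube F" "j \<in> set ks" "i \<in> set ks" "j \<noteq> i"
    and "\<And>z. z \<in> cube \<Longrightarrow> slice_int j (slice_int i F) z = 0"
  shows "cube_int F = 0"
proof -
  have c: "continuous_on cube (slice_int i F)"
    using continuous_on_foldr[OF assms(1), of "[i]"] by simp
  have j: "j \<in> set (remove1 i ks)" using assms by auto
  have "cube_int F = foldr slice_int (remove1 i ks) (slice_int i F) (\<lambda>_. 0)"
    unfolding cube_int_def by (rule foldr_slice_int_remove1[OF assms(1) zero_in_cube assms(3)])
  also have "\<dots> = foldr slice_int (remove1 j (remove1 i ks)) (slice_int j (slice_int i F)) (\<lambda>_. 0)"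
    by (rule foldr_slice_int_remove1[OF c zero_in_cube j])
  also have "\<dots> = foldr slice_int (remove1 j (remove1 i ks)) (\<lambda>z. 0) (\<lambda>_. 0)"
    by (rule foldr_slice_int_cong[OF _ zero_in_cube]) (use assms in auto)
  finally show ?thesis by (simp add: foldr_slice_int_zero)
qed

lemma cube_int_cmult: "cube_int (\<lambda>z. c * F z) = c * cube_int F"
proof -
  have "foldr slice_int l (\<lambda>z. c * F z) = (\<lambda>z. c * foldr slice_int l F z)" for l
  proof (induction l)
    case (Cons i l)
    have "slice_int i (\<lambda>z. c * H z) = (\<lambda>z. c * slice_int i H z)" for H
      by (rule ext) (simp add: slice_int_def)
    with Cons show ?case by simp
  qed simp
  then show ?thesis by (simp add: cube_int_def)
qed

lemma cube_int_add:
  assumes "continuous_on cube F" "continuous_on cube G"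
  shows "cube_int (\<lambda>z. F z + G z) = cube_int F + cube_int G"
proof -
  have "foldr slice_int l (\<lambda>z. F z + G z) z = foldr slice_int l F z + foldr slice_int l G z"
    if "z \<in> cube" for l z
    using that
  proof (induction l arbitrary: z)
    case (Cons i l)
    have "foldr slice_int (i # l) (\<lambda>z. F z + G z) z
       = slice_int i (\<lambda>z. foldr slice_int l F z + foldr slice_int l G z) z"
      using slice_int_cong[OF Cons.IH Cons.prems] by simp
    also have "\<dots> = foldr slice_int (i # l) F z + foldr slice_int (i # l) G z"
      using integral_add[OF integrable_slice[OF continuous_on_foldr[OF assms(1)] Cons.prems]
              integrable_slice[OF continuous_on_foldr[OF assms(2)] Cons.prems]]
      by (simp add: slice_int_def[of i])
    finally show ?case .
  qed auto
  then show ?thesis by (simp add: cube_int_def zero_in_cube)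
qed

lemma cube_int_diff:
  assumes "continuous_on cube F" "continuous_on cube G"
  shows "cube_int (\<lambda>z. F z - G z) = cube_int F - cube_int G"
  using cube_int_add[OF assms(1) continuous_on_minus[OF assms(2)]] cube_int_cmult[of "-1" G]
  by simp

lemma cube_int_sum:
  assumes "finite A" "\<And>i. i \<in> A \<Longrightarrow> continuous_on cube (F i)"
  shows "cube_int (\<lambda>z. \<Sum>i\<in>A. F i z) = (\<Sum>i\<in>A. cube_int (F i))"
  using assms
proof (induction A rule: finite_induct)
  case empty
  show ?case by (simp add: cube_int_def foldr_slice_int_zero)
next
  case (insert i A)
  then show ?case by (simp add: cube_int_add continuous_on_sum)
qed

lemma cube_int_nonneg:
  assumes "continuous_on cube F" "\<And>z. z \<in> cube \<Longrightarrow> F z \<ge> 0"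
  shows "cube_int F \<ge> 0"
proof -
  have "foldr slice_int l F z \<ge> 0" if "z \<in> cube" for l z
    using that
  proof (induction l arbitrary: z)
    case (Cons i l)
    show ?case unfolding foldr_Cons o_apply slice_int_def[of i]
      by (rule integral_nonneg[OF integrable_slice[OF continuous_on_foldr[OF assms(1)] Cons.prems]])
         (use Cons cube_upd in auto)
  qed (use assms in auto)
  then show ?thesis by (simp add: cube_int_def zero_in_cube)
qed

lemma cube_int_mono:
  assumes "continuous_on cube F" "continuous_on cube G" "\<And>z. z \<in> cube \<Longrightarrow> F z \<le> G z"
  shows "cube_int F \<le> cube_int G"
  using cube_int_nonneg[of "\<lambda>z. G z - F z"] assms
  by (simp add: continuous_on_diff cube_int_diff)

text \<open>A continuous nonnegative function with zero integral vanishes on the whole interval. The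
  origin lies on every slice through it, so strict positivity there is inherited from one
  integration to the next.\<close>

lemma cube_int_pos:
  assumes "continuous_on cube F" "\<And>z. z \<in> cube \<Longrightarrow> F z \<ge> 0" "F (\<lambda>_. 0) > 0"
  shows "cube_int F > 0"
proof -
  have "(\<forall>z\<in>cube. foldr slice_int l F z \<ge> 0) \<and> foldr slice_int l F (\<lambda>_. 0) > 0" for l
  proof (induction l)
    case (Cons i l)
    define G where "G = foldr slice_int l F"
    have cG: "continuous_on cube G" unfolding G_def by (rule continuous_on_foldr[OF assms(1)])
    have G0: "G (\<lambda>_. 0) > 0" and Gn: "\<And>z. z \<in> cube \<Longrightarrow> G z \<ge> 0" using Cons unfolding G_def by auto
    have nn: "slice_int i G z \<ge> 0" if "z \<in> cube" for z
      unfolding slice_int_def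
      by (rule integral_nonneg[OF integrable_slice[OF cG that]]) (use that Gn cube_upd in auto)
    have "slice_int i G (\<lambda>_. 0) \<noteq> 0"
    proof
      assume "slice_int i G (\<lambda>_. 0) = 0"
      then have "\<forall>t\<in>{-2..2}. G ((\<lambda>_. 0)(i := t)) = 0"
        unfolding slice_int_def
        by (subst (asm) integral_eq_0_iff[OF continuous_on_slice[OF cG zero_in_cube]])
           (use Gn cube_upd zero_in_cube in auto)
      then have "G ((\<lambda>_. 0)(i := 0)) = 0" by force
      moreover have "(\<lambda>_. 0)(i := 0) = (\<lambda>_. 0::real)" by auto
      ultimately show False using G0 by simp
    qed
    then show ?case using nn[OF zero_in_cube] nn unfolding G_def by auto
  qed (use assms in auto)
  then show ?thesis by (simp add: cube_int_def)
qed

lemma cube_int_abs_le: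
  assumes "continuous_on cube F" "\<And>z. z \<in> cube \<Longrightarrow> \<bar>F z\<bar> \<le> B"
  shows "\<bar>cube_int F\<bar> \<le> B * 4 ^ length ks"
proof -
  have "\<bar>foldr slice_int l F z\<bar> \<le> B * 4 ^ length l" if "z \<in> cube" for l z
    using that
  proof (induction l arbitrary: z)
    case (Cons i l)
    have "norm (integral (cbox (-2) 2) (\<lambda>t. foldr slice_int l F (z(i := t)))) \<le> (B * 4 ^ length l) * measure lborel (cbox (-2) (2::real))"
    proof (rule integrable_bound)
      show "0 \<le> B * 4 ^ length l" using assms(2)[OF zero_in_cube] by auto
      show "(\<lambda>t. foldr slice_int l F (z(i := t))) integrable_on cbox (-2) 2"
        using integrable_slice[OF continuous_on_foldr[OF assms(1)] Cons.prems] by simp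
    qed (use Cons cube_upd in auto)
    then show ?case by (simp add: slice_int_def[of i])
  qed (use assms in auto)
  then show ?thesis by (simp add: cube_int_def zero_in_cube)
qed

text \<open>Leibniz's rule is applied to one slice at a time; joint continuity of \<open>G'\<close>
  survives each integration and is therefore available again for the next.\<close>

lemma has_real_derivative_cube_int:
  assumes "convex S"
    and cG: "\<And>h. h \<in> S \<Longrightarrow> continuous_on cube (G h)"
    and cG': "continuous_on (S \<times> cube) (\<lambda>(h, z). G' h z)"
    and der: "\<And>h z. h \<in> S \<Longrightarrow> z \<in> cube \<Longrightarrow> ((\<lambda>h. G h z) has_real_derivative G' h z) (at h within S)"
    and "h \<in> S"
  shows "((\<lambda>h. cube_int (G h)) has_real_derivative cube_int (G' h)) (at h within S)"
proof -
  have "((\<lambda>h. foldr slice_int l (G h) z) has_real_derivative foldr slice_int l (G' h) z) (at h within S)"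
    if "h \<in> S" "z \<in> cube" for l h z
    using that
  proof (induction l arbitrary: h z)
    case (Cons i l)
    have "((\<lambda>h. integral (cbox (-2) 2) (\<lambda>t. foldr slice_int l (G h) (z(i := t)))) has_real_derivative
       integral (cbox (-2) 2) (\<lambda>t. foldr slice_int l (G' h) (z(i := t)))) (at h within S)"
    proof (rule leibniz_rule_field_derivative)
      show "continuous_on (S \<times> cbox (-2) 2) (\<lambda>(h, t). foldr slice_int l (G' h) (z(i := t)))"
        unfolding case_prod_beta
        by (rule continuous_on_compose2[OF continuous_on_param_foldr[OF cG', unfolded case_prod_beta],
              where f = "\<lambda>x. (fst x, z(i := snd x))", simplified])
           (use Cons in \<open>auto intro!: continuous_on_Pair continuous_on_fun_upd continuous_on_const
              continuous_on_fst continuous_on_snd continuous_on_id simp: cube_upd\<close>)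
      show "(\<lambda>t. foldr slice_int l (G h) (z(i := t))) integrable_on cbox (-2) 2" if "h \<in> S" for h
        using integrable_slice[OF continuous_on_foldr[OF cG[OF that]] Cons.prems(2)] by simp
      show "((\<lambda>h. foldr slice_int l (G h) (z(i := t))) has_real_derivative
          foldr slice_int l (G' h) (z(i := t))) (at h within S)"
        if "h \<in> S" "t \<in> cbox (-2) 2" for h t
        by (rule Cons.IH[OF that(1) cube_upd[OF Cons.prems(2) that(2)[unfolded cbox_interval]]])
    qed (use Cons.prems assms(1) in auto)
    then show ?case by (simp add: slice_int_def[of i])
  qed (use der in auto)
  then show ?thesis using zero_in_cube \<open>h \<in> S\<close> by (simp add: cube_int_def)
qed

text \<open>The fundamental theorem of calculus along \<open>j\<close> leaves only values on two
  opposite faces. For a product with a test function this is integration by parts.\<close>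

lemma cube_int_derivative_eq_0:
  assumes "j \<in> set ks" "continuous_on cube F'"
    and "\<And>z t. z \<in> cube \<Longrightarrow> t \<in> {-2..2} \<Longrightarrow>
           ((\<lambda>t. F (z(j := t))) has_real_derivative F' (z(j := t))) (at t within {-2..2})"
    and "\<And>z. z \<in> cube \<Longrightarrow> \<bar>z j\<bar> = 2 \<Longrightarrow> F z = 0"
  shows "cube_int F' = 0"
proof (rule cube_int_eq_0[OF assms(2,1)])
  fix z assume z: "z \<in> cube"
  have "((\<lambda>t. F' (z(j := t))) has_integral (F (z(j := 2)) - F (z(j := -2)))) {-2..2}"
  proof (rule fundamental_theorem_of_calculus)
    show "((\<lambda>t. F (z(j := t))) has_vector_derivative F' (z(j := t))) (at t within {-2..2})"
      if "t \<in> {-2..2}" for t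
      using assms(3)[OF z that] unfolding has_real_derivative_iff_has_vector_derivative .
  qed simp
  then show "slice_int j F' z = 0"
    using assms(4) cube_upd[OF z] by (simp add: slice_int_def integral_unique)
qed

end

section \<open>Green's formula without continuity of the derivatives\<close>

lemma integral_near_const:
  fixes h :: "real \<Rightarrow> real"
  assumes "continuous_on {a..a + l} h" "0 \<le> l" "\<And>s. s \<in> {a..a + l} \<Longrightarrow> \<bar>h s - c\<bar> \<le> B"
  shows "\<bar>integral {a..a + l} h - l * c\<bar> \<le> B * l"
proof -
  have ih: "h integrable_on {a..a + l}" by (rule integrable_continuous_real[OF assms(1)])
  have "integral {a..a + l} h - l * c = integral {a..a + l} (\<lambda>s. h s - c)"
    using assms(2) by (subst integral_diff[OF ih integrable_const_ivl]) simp
  also have "norm \<dots> \<le> B * (a + l - a)"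
    by (rule integral_bound) (use assms in \<open>auto intro!: continuous_intros\<close>)
  finally show ?thesis by simp
qed

lemma integral_halves:
  fixes h :: "real \<Rightarrow> real"
  assumes "continuous_on {a..a + 2 * l} h" "0 \<le> l"
  shows "integral {a..a + 2 * l} h = integral {a..a + l} h + integral {a + l..a + l + l} h"
proof -
  have e: "a + 2 * l = a + l + l" by simp
  have "h integrable_on {a..a + l + l}"
    using integrable_continuous_real[OF assms(1)] unfolding e .
  then show ?thesis
    unfolding e by (intro Henstock_Kurzweil_Integration.integral_combine[symmetric]) (use assms(2) in auto)
qed

text \<open>Goursat's bisection stripped of integrals: \<open>P a b l\<close> speaks of the square
  with lower left corner \<open>(a, b)\<close> and side \<open>l\<close>, and a property inherited
  by some quarter follows a nested sequence of closed squares down to a common point.\<close>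

lemma nested_squares:
  fixes P :: "real \<Rightarrow> real \<Rightarrow> real \<Rightarrow> bool"
  assumes "P a0 b0 l0" "l0 \<ge> 0"
    and "\<And>a b l. P a b (2 * l) \<Longrightarrow> P a b l \<or> P (a + l) b l \<or> P a (b + l) l \<or> P (a + l) (b + l) l"
  obtains x y A B where "\<And>n::nat. P (A n) (B n) (l0 / 2 ^ n)"
    "\<And>n. x \<in> {A n..A n + l0 / 2 ^ n}" "\<And>n. y \<in> {B n..B n + l0 / 2 ^ n}"
proof -
  \<comment> \<open>Each coordinate of the corner either stays or moves by the new side length, so
    the two coordinates can be treated separately.\<close>
  define half where "half n y x \<longleftrightarrow> y \<in> {x, x + l0 / 2 ^ Suc n}" for n and x y :: real
  have "\<exists>c. \<forall>n. P (fst (c n)) (snd (c n)) (l0 / 2 ^ n) \<and>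
      half n (fst (c (Suc n))) (fst (c n)) \<and> half n (snd (c (Suc n))) (snd (c n))"
  proof (rule dependent_nat_choice)
    show "\<exists>x. P (fst x) (snd x) (l0 / 2 ^ 0)" using assms(1) by auto
    fix x :: "real \<times> real" and n :: nat
    assume "P (fst x) (snd x) (l0 / 2 ^ n)"
    then have "P (fst x) (snd x) (2 * (l0 / 2 ^ Suc n))" by simp
    from assms(3)[OF this]
    obtain u v where "P u v (l0 / 2 ^ Suc n)" "half n u (fst x)" "half n v (snd x)"
      unfolding half_def by blast
    then show "\<exists>y. P (fst y) (snd y) (l0 / 2 ^ Suc n) \<and> half n (fst y) (fst x) \<and> half n (snd y) (snd x)"
      by (intro exI[of _ "(u, v)"]) simp
  qed
  then obtain c where c: "\<And>n. P (fst (c n)) (snd (c n)) (l0 / 2 ^ n)"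
    and step: "\<And>n. half n (fst (c (Suc n))) (fst (c n))" "\<And>n. half n (snd (c (Suc n))) (snd (c n))"
    by blast
  have limit: "\<exists>x. \<forall>n. x \<in> {A n..A n + l0 / 2 ^ n}"
    if A: "\<And>n. half n (A (Suc n)) (A n)" for A :: "nat \<Rightarrow> real"
  proof -
    have l: "l0 / 2 ^ Suc n + l0 / 2 ^ Suc n = l0 / 2 ^ n" "0 \<le> l0 / 2 ^ Suc n" for n
      using assms(2) by simp_all
    have up: "A n \<le> A (Suc n)" and dn: "A (Suc n) + l0 / 2 ^ Suc n \<le> A n + l0 / 2 ^ n" for n
      using A[of n] l[of n] by (auto simp: half_def simp del: power_Suc)
    have inc: "A m \<le> A n" if "m \<le> n" for m n
      using that by (rule lift_Suc_mono_le[of A, OF up])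
    have dec: "A n + l0 / 2 ^ n \<le> A m + l0 / 2 ^ m" if "m \<le> n" for m n
      using that by (rule lift_Suc_antimono_le[of "\<lambda>n. A n + l0 / 2 ^ n", OF dn])
    have le: "A m \<le> A n + l0 / 2 ^ n" for m n
    proof (cases "m \<le> n")
      case True
      have "0 \<le> l0 / 2 ^ n" using assms(2) by simp
      with inc[OF True] show ?thesis by linarith
    next
      case False
      have "0 \<le> l0 / 2 ^ m" using assms(2) by simp
      with dec[of n m] False show ?thesis by linarith
    qed
    have bdd: "bdd_above (range A)" using le[of _ 0] by (auto intro!: bdd_aboveI2)
    \<comment> \<open>Every lower end lies below every upper end, so the supremum of the lower ends
      belongs to all intervals.\<close>
    have "(SUP m. A m) \<in> {A n..A n + l0 / 2 ^ n}" for n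
      using cSUP_upper[OF UNIV_I bdd, of n] cSUP_least[of UNIV A "A n + l0 / 2 ^ n"] le by auto
    then show ?thesis by blast
  qed
  obtain x where x: "\<And>n. x \<in> {fst (c n)..fst (c n) + l0 / 2 ^ n}"
    using limit[of "\<lambda>n. fst (c n)", OF step(1)] by blast
  obtain y where y: "\<And>n. y \<in> {snd (c n)..snd (c n) + l0 / 2 ^ n}"
    using limit[of "\<lambda>n. snd (c n)", OF step(2)] by blast
  show ?thesis
    by (rule that[of "\<lambda>n. fst (c n)" "\<lambda>n. snd (c n)" x y]) (use c x y in blast)+
qed

text \<open>Only the combination \<open>g\<close> is continuous; \<open>P'\<close> and
  \<open>R'\<close> may be arbitrarily irregular. The defect of the formula is additive under
  subdivision, while differentiability at a point makes it small compared with the area of squares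
  shrinking to that point. A nonzero defect would be passed on by bisection at a fixed proportion of
  the area, which is a contradiction.\<close>

lemma green_square:
  fixes P R g :: "real \<times> real \<Rightarrow> real"
  defines "S \<equiv> {-2..2} \<times> {-2..2}"
  assumes dP: "\<And>z. z \<in> S \<Longrightarrow> (P has_derivative P' z) (at z within S)"
    and dR: "\<And>z. z \<in> S \<Longrightarrow> (R has_derivative R' z) (at z within S)"
    and cg: "continuous_on S g"
    and eq: "\<And>z. z \<in> S \<Longrightarrow> P' z (0, 1) - R' z (1, 0) = g z"
  shows "integral {-2..2} (\<lambda>s. P (s, 2)) - integral {-2..2} (\<lambda>s. P (s, -2))
       - (integral {-2..2} (\<lambda>t. R (2, t)) - integral {-2..2} (\<lambda>t. R (-2, t)))
       = integral {-2..2} (\<lambda>s. integral {-2..2} (\<lambda>t. g (s, t)))"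
proof -
  define IP where "IP b a l = integral {a..a + l} (\<lambda>s. P (s, b))" for a b l
  define IR where "IR a b l = integral {b..b + l} (\<lambda>t. R (a, t))" for a b l
  define IG where "IG a b l = integral {a..a + l} (\<lambda>s. integral {b..b + l} (\<lambda>t. g (s, t)))" for a b l
  define F where "F a b l = (IP (b + l) a l - IP b a l) - (IR (a + l) b l - IR a b l) - IG a b l" for a b l
  define ok where "ok a b l \<longleftrightarrow> 0 \<le> l \<and> -2 \<le> a \<and> a + l \<le> 2 \<and> -2 \<le> b \<and> b + l \<le> (2::real)" for a b l
  have cP: "continuous_on S P" and cR: "continuous_on S R"
    using dP dR has_derivative_continuous_on by blast+
  have cPs: "continuous_on {a..c} (\<lambda>s. P (s, b))" if "b \<in> {-2..2}" "-2 \<le> a" "c \<le> 2" for a b c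
    by (rule continuous_on_compose2[OF cP]) (use that in \<open>auto simp: S_def intro!: continuous_intros\<close>)
  have cRs: "continuous_on {b..c} (\<lambda>t. R (a, t))" if "a \<in> {-2..2}" "-2 \<le> b" "c \<le> 2" for a b c
    by (rule continuous_on_compose2[OF cR]) (use that in \<open>auto simp: S_def intro!: continuous_intros\<close>)
  have cgs: "continuous_on {b..c} (\<lambda>t. g (a, t))" if "a \<in> {-2..2}" "-2 \<le> b" "c \<le> 2" for a b c
    by (rule continuous_on_compose2[OF cg]) (use that in \<open>auto simp: S_def intro!: continuous_intros\<close>)
  have cgi: "continuous_on {a..a'} (\<lambda>s. integral {b..c} (\<lambda>t. g (s, t)))"
    if "-2 \<le> b" "c \<le> 2" "-2 \<le> a" "a' \<le> 2" for a a' b c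
  proof -
    have "continuous_on ({a..a'} \<times> cbox b c) (\<lambda>(s, t). g (s, t))"
      by (rule continuous_on_subset[of S]) (use cg that in \<open>auto simp: S_def\<close>)
    from integral_continuous_on_param[OF this] show ?thesis by simp
  qed
  \<comment> \<open>Edges inside the large square occur twice with opposite signs.\<close>
  have add: "F a b (2 * l) = F a b l + F (a + l) b l + F a (b + l) l + F (a + l) (b + l) l"
    if "ok a b (2 * l)" for a b l
  proof -
    have o: "0 \<le> l" "-2 \<le> a" "a + 2 * l \<le> 2" "-2 \<le> b" "b + 2 * l \<le> 2" using that by (auto simp: ok_def)
    have P2: "IP c a (2 * l) = IP c a l + IP c (a + l) l" if "c \<in> {-2..2}" for c
      unfolding IP_def by (rule integral_halves[OF cPs[OF that]]) (use o in auto)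
    have R2: "IR c b (2 * l) = IR c b l + IR c (b + l) l" if "c \<in> {-2..2}" for c
      unfolding IR_def by (rule integral_halves[OF cRs[OF that]]) (use o in auto)
    have inner: "integral {b..b + 2 * l} (\<lambda>t. g (s, t))
        = integral {b..b + l} (\<lambda>t. g (s, t)) + integral {b + l..b + l + l} (\<lambda>t. g (s, t))" if "s \<in> {-2..2}" for s
      by (rule integral_halves[OF cgs[OF that]]) (use o in auto)
    have outer: "integral {a..a + 2 * l} (\<lambda>s. integral {c..c'} (\<lambda>t. g (s, t)))
       = integral {a..a + l} (\<lambda>s. integral {c..c'} (\<lambda>t. g (s, t)))
       + integral {a + l..a + l + l} (\<lambda>s. integral {c..c'} (\<lambda>t. g (s, t)))" if "-2 \<le> c" "c' \<le> 2" for c c'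
      by (rule integral_halves[OF cgi[OF that]]) (use o in auto)
    have "integral {a..a + 2 * l} (\<lambda>s. integral {b..b + 2 * l} (\<lambda>t. g (s, t)))
      = integral {a..a + 2 * l} (\<lambda>s. integral {b..b + l} (\<lambda>t. g (s, t)) + integral {b + l..b + l + l} (\<lambda>t. g (s, t)))"
      by (rule integral_cong, rule inner) (use o in auto)
    also have "\<dots> = integral {a..a + 2 * l} (\<lambda>s. integral {b..b + l} (\<lambda>t. g (s, t)))
        + integral {a..a + 2 * l} (\<lambda>s. integral {b + l..b + l + l} (\<lambda>t. g (s, t)))"
      by (rule integral_add; rule integrable_continuous_real; rule cgi) (use o in auto)
    also have "integral {a..a + 2 * l} (\<lambda>s. integral {b..b + l} (\<lambda>t. g (s, t)))
       = integral {a..a + l} (\<lambda>s. integral {b..b + l} (\<lambda>t. g (s, t)))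
       + integral {a + l..a + l + l} (\<lambda>s. integral {b..b + l} (\<lambda>t. g (s, t)))"
      by (rule outer) (use o in auto)
    also have "integral {a..a + 2 * l} (\<lambda>s. integral {b + l..b + l + l} (\<lambda>t. g (s, t)))
       = integral {a..a + l} (\<lambda>s. integral {b + l..b + l + l} (\<lambda>t. g (s, t)))
       + integral {a + l..a + l + l} (\<lambda>s. integral {b + l..b + l + l} (\<lambda>t. g (s, t)))"
      by (rule outer) (use o in auto)
    finally have G2: "IG a b (2 * l) = (IG a b l + IG (a + l) b l) + (IG a (b + l) l + IG (a + l) (b + l) l)"
      unfolding IG_def by simp
    have e: "a + 2 * l = a + l + l" "b + 2 * l = b + l + l" by simp_all
    have m: "b + 2 * l \<in> {-2..2}" "b \<in> {-2..2}" "a + 2 * l \<in> {-2..2}" "a \<in> {-2..2}" using o by auto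
    show ?thesis
      using G2 P2[OF m(1)] P2[OF m(2)] R2[OF m(3)] R2[OF m(4)] unfolding e F_def by linarith
  qed
  \<comment> \<open>The constant is 4 + 4 + 1: each difference of opposite edges involves two
    linearisation errors of size \<open>2 * e * l\<close>, integrated over a length
    \<open>l\<close>, and replacing \<open>g\<close> by its value at \<open>z\<close> costs
    \<open>e * l\<^sup>2\<close>.\<close>
  have small: "\<bar>F a b l\<bar> \<le> 9 * e * l\<^sup>2"
    if ok: "ok a b l" and z: "z \<in> {a..a + l} \<times> {b..b + l}" and "0 \<le> e"
      and P: "\<And>w. w \<in> {a..a + l} \<times> {b..b + l} \<Longrightarrow> \<bar>P w - P z - P' z (w - z)\<bar> \<le> e * norm (w - z)"
      and R: "\<And>w. w \<in> {a..a + l} \<times> {b..b + l} \<Longrightarrow> \<bar>R w - R z - R' z (w - z)\<bar> \<le> e * norm (w - z)"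
      and G: "\<And>w. w \<in> {a..a + l} \<times> {b..b + l} \<Longrightarrow> \<bar>g w - g z\<bar> \<le> e"
    for a b l e z
  proof -
    have o: "0 \<le> l" "-2 \<le> a" "a + l \<le> 2" "-2 \<le> b" "b + l \<le> 2" using ok by (auto simp: ok_def)
    have zS: "z \<in> S" using z o by (auto simp: S_def)
    have linP: "linear (P' z)" and linR: "linear (R' z)"
      using dP[OF zS] dR[OF zS] has_derivative_linear by blast+
    have nrm: "norm (w - z) \<le> 2 * l" if "w \<in> {a..a + l} \<times> {b..b + l}" for w
    proof -
      have "norm (w - z) \<le> norm (fst (w - z)) + norm (snd (w - z))"
        using norm_Pair_le[of "fst (w - z)" "snd (w - z)"] by (simp only: prod.collapse)
      also have "\<dots> \<le> l + l"
        using that z by (intro add_mono) (auto simp: abs_le_iff)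
      finally show ?thesis by simp
    qed
    have P1: "\<bar>P w - P z - P' z (w - z)\<bar> \<le> 2 * e * l" and R1: "\<bar>R w - R z - R' z (w - z)\<bar> \<le> 2 * e * l"
      if "w \<in> {a..a + l} \<times> {b..b + l}" for w
      using P[OF that] R[OF that] mult_left_mono[OF nrm[OF that] \<open>0 \<le> e\<close>] by (auto simp: algebra_simps)
    have "\<bar>(P (s, b + l) - P (s, b)) - l * P' z (0, 1)\<bar> \<le> 4 * e * l" if "s \<in> {a..a + l}" for s
    proof -
      have "P' z ((s, b + l) - z) - P' z ((s, b) - z) = P' z (l *\<^sub>R (0, 1))"
        by (simp add: linear_diff[OF linP, symmetric])
      also have "\<dots> = l * P' z (0, 1)" unfolding linear_scale[OF linP] by simp
      finally show ?thesis using P1[of "(s, b + l)"] P1[of "(s, b)"] that o by auto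
    qed
    then have "\<bar>integral {a..a + l} (\<lambda>s. P (s, b + l) - P (s, b)) - l * (l * P' z (0, 1))\<bar> \<le> 4 * e * l * l"
      by (intro integral_near_const continuous_on_diff cPs) (use o in auto)
    moreover have "integral {a..a + l} (\<lambda>s. P (s, b + l) - P (s, b)) = IP (b + l) a l - IP b a l"
      unfolding IP_def by (intro integral_diff integrable_continuous_real cPs) (use o in auto)
    ultimately have eP: "\<bar>(IP (b + l) a l - IP b a l) - l\<^sup>2 * P' z (0, 1)\<bar> \<le> 4 * e * l\<^sup>2"
      by (simp add: power2_eq_square mult.assoc)
    have "\<bar>(R (a + l, t) - R (a, t)) - l * R' z (1, 0)\<bar> \<le> 4 * e * l" if "t \<in> {b..b + l}" for t
    proof -
      have "R' z ((a + l, t) - z) - R' z ((a, t) - z) = R' z (l *\<^sub>R (1, 0))"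
        by (simp add: linear_diff[OF linR, symmetric])
      also have "\<dots> = l * R' z (1, 0)" unfolding linear_scale[OF linR] by simp
      finally show ?thesis using R1[of "(a + l, t)"] R1[of "(a, t)"] that o by auto
    qed
    then have "\<bar>integral {b..b + l} (\<lambda>t. R (a + l, t) - R (a, t)) - l * (l * R' z (1, 0))\<bar> \<le> 4 * e * l * l"
      by (intro integral_near_const continuous_on_diff cRs) (use o in auto)
    moreover have "integral {b..b + l} (\<lambda>t. R (a + l, t) - R (a, t)) = IR (a + l) b l - IR a b l"
      unfolding IR_def by (intro integral_diff integrable_continuous_real cRs) (use o in auto)
    ultimately have eR: "\<bar>(IR (a + l) b l - IR a b l) - l\<^sup>2 * R' z (1, 0)\<bar> \<le> 4 * e * l\<^sup>2"
      by (simp add: power2_eq_square mult.assoc)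
    have "\<bar>integral {b..b + l} (\<lambda>t. g (s, t)) - l * g z\<bar> \<le> e * l" if "s \<in> {a..a + l}" for s
      by (intro integral_near_const cgs) (use o that G in auto)
    note near = this
    have "\<bar>IG a b l - l * (l * g z)\<bar> \<le> e * l * l"
      unfolding IG_def by (rule integral_near_const[OF cgi o(1) near]) (use o in auto)
    then have eG: "\<bar>IG a b l - l\<^sup>2 * g z\<bar> \<le> e * l\<^sup>2"
      by (simp add: power2_eq_square mult.assoc)
    have "l\<^sup>2 * g z = l\<^sup>2 * P' z (0, 1) - l\<^sup>2 * R' z (1, 0)"
      using eq[OF zS] by (simp add: right_diff_distrib[symmetric])
    then show ?thesis using eP eR eG unfolding F_def by linarith
  qed
  have "F (-2) (-2) 4 = 0"
  proof (rule ccontr)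
    define M where "M = \<bar>F (-2) (-2) 4\<bar>"
    assume "F (-2) (-2) 4 \<noteq> 0"
    then have M: "M > 0" by (simp add: M_def)
    \<comment> \<open>The initial square has area 16, so the inequality starts as an equality;
      quartering divides the area by 4, and one quarter must keep the proportion.\<close>
    define big where "big a b l \<longleftrightarrow> ok a b l \<and> \<bar>F a b l\<bar> \<ge> M / 16 * l\<^sup>2" for a b l
    have b0: "big (-2) (-2) 4" by (simp add: big_def ok_def M_def)
    have split: "big a b l \<or> big (a + l) b l \<or> big a (b + l) l \<or> big (a + l) (b + l) l" if "big a b (2 * l)" for a b l
    proof -
      have ok: "ok a b (2 * l)" using that by (simp add: big_def)
      then have oks: "ok a b l" "ok (a + l) b l" "ok a (b + l) l" "ok (a + l) (b + l) l" by (auto simp: ok_def)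
      have "M / 16 * (2 * l)\<^sup>2 \<le> \<bar>F a b (2 * l)\<bar>" using that by (simp add: big_def)
      then have "4 * (M / 16 * l\<^sup>2) \<le> \<bar>F a b l + F (a + l) b l + F a (b + l) l + F (a + l) (b + l) l\<bar>"
        unfolding add[OF ok] by (simp add: power2_eq_square)
      then show ?thesis using oks unfolding big_def by linarith
    qed
    obtain x y A B where big: "\<And>n::nat. big (A n) (B n) (4 / 2 ^ n)"
      and xy: "\<And>n. x \<in> {A n..A n + 4 / 2 ^ n}" "\<And>n. y \<in> {B n..B n + 4 / 2 ^ n}"
      using nested_squares[of big "-2" "-2" 4, OF b0 _ split] by (metis zero_le_numeral)
    define z where "z = (x, y)"
    have zS: "z \<in> S" using xy[of 0] big[of 0] by (auto simp: z_def S_def big_def ok_def)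
    \<comment> \<open>Chosen so that \<open>9 * e\<close> is \<open>M / 32\<close>, half of the
      proportion preserved by the bisection.\<close>
    define e where "e = M / 288"
    have e: "e > 0" using M by (simp add: e_def)
    obtain d1 where d1: "d1 > 0" "\<And>w. w \<in> S \<Longrightarrow> norm (w - z) < d1 \<Longrightarrow> norm (P w - P z - P' z (w - z)) \<le> e * norm (w - z)"
      using dP[OF zS] e unfolding has_derivative_within_alt by blast
    obtain d2 where d2: "d2 > 0" "\<And>w. w \<in> S \<Longrightarrow> norm (w - z) < d2 \<Longrightarrow> norm (R w - R z - R' z (w - z)) \<le> e * norm (w - z)"
      using dR[OF zS] e unfolding has_derivative_within_alt by blast
    obtain d3 where d3: "d3 > 0" "\<And>w. w \<in> S \<Longrightarrow> dist w z < d3 \<Longrightarrow> dist (g w) (g z) < e"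
      using cg zS e unfolding continuous_on_iff by metis
    define d where "d = min d1 (min d2 d3)"
    have d: "d > 0" using d1 d2 d3 by (simp add: d_def)
    \<comment> \<open>Two points of a square are at distance at most twice its side, which is
      \<open>4 / 2 ^ n\<close> here.\<close>
    obtain n where n: "8 / 2 ^ n < d"
    proof -
      have "(\<lambda>n. 8 * (1 / 2) ^ n) \<longlonglongrightarrow> 8 * (0::real)"
        by (intro tendsto_intros LIMSEQ_realpow_zero) auto
      then have "\<forall>\<^sub>F n in sequentially. 8 * (1 / 2) ^ n < d"
        by (rule order_tendstoD(2)) (use d in simp)
      then show ?thesis using that by (auto simp: eventually_sequentially power_divide)
    qed
    define l where "l = (4::real) / 2 ^ n"
    have okn: "ok (A n) (B n) l" using big[of n] by (simp add: big_def l_def)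
    have zn: "z \<in> {A n..A n + l} \<times> {B n..B n + l}" using xy[of n] by (simp add: z_def l_def)
    have near: "w \<in> S \<and> norm (w - z) < d" if w: "w \<in> {A n..A n + l} \<times> {B n..B n + l}" for w
    proof -
      have "norm (w - z) \<le> norm (fst (w - z)) + norm (snd (w - z))"
        using norm_Pair_le[of "fst (w - z)" "snd (w - z)"] by (simp only: prod.collapse)
      also have "\<dots> \<le> l + l"
        using w zn by (intro add_mono) (auto simp: abs_le_iff)
      also have "\<dots> < d" using n by (simp add: l_def)
      finally show ?thesis using w okn by (auto simp: ok_def S_def)
    qed
    have "\<bar>F (A n) (B n) l\<bar> \<le> 9 * e * l\<^sup>2"
    proof (rule small[OF okn zn])
      fix w assume "w \<in> {A n..A n + l} \<times> {B n..B n + l}"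
      from near[OF this] have w: "w \<in> S" "norm (w - z) < d1" "norm (w - z) < d2" "norm (w - z) < d3"
        by (auto simp: d_def)
      show "\<bar>P w - P z - P' z (w - z)\<bar> \<le> e * norm (w - z)" using d1(2)[OF w(1,2)] by simp
      show "\<bar>R w - R z - R' z (w - z)\<bar> \<le> e * norm (w - z)" using d2(2)[OF w(1,3)] by simp
      show "\<bar>g w - g z\<bar> \<le> e" using d3(2)[OF w(1)] w(4) by (simp add: dist_norm)
    qed (use e in auto)
    moreover have "M / 16 * l\<^sup>2 \<le> \<bar>F (A n) (B n) l\<bar>" using big[of n] by (simp add: big_def l_def)
    ultimately have "M / 16 * l\<^sup>2 \<le> M / 32 * l\<^sup>2" by (simp add: e_def)
    moreover have "l > 0" by (simp add: l_def)
    ultimately show False using M by (simp add: field_simps)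
  qed
  then show ?thesis by (simp add: F_def IP_def IR_def IG_def)
qed

section \<open>Radial test functions\<close>

text \<open>With an exponent of at least 2 the corner at 0 disappears: the difference quotient there
  is bounded by \<open>\<bar>h\<bar> ^ (n + 1)\<close>.\<close>

lemma has_real_derivative_max_power:
  "((\<lambda>y::real. (max 0 y) ^ (n + 2)) has_real_derivative real (n + 2) * (max 0 y) ^ (n + 1)) (at y)"
proof -
  consider "y > 0" | "y < 0" | "y = 0" by linarith
  then show ?thesis
  proof cases
    case 1
    have "((\<lambda>y::real. y ^ (n + 2)) has_real_derivative real (n + 2) * y ^ (n + 1)) (at y)"
      using DERIV_pow[of "n + 2" y UNIV] by simp
    then have "((\<lambda>y::real. (max 0 y) ^ (n + 2)) has_real_derivative real (n + 2) * y ^ (n + 1)) (at y)"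
      by (rule has_field_derivative_transform_within_open[where S = "{0<..}"]) (use 1 in auto)
    with 1 show ?thesis by simp
  next
    case 2
    have "((\<lambda>y::real. 0) has_real_derivative 0) (at y)" by simp
    then have "((\<lambda>y::real. (max 0 y) ^ (n + 2)) has_real_derivative 0) (at y)"
      by (rule has_field_derivative_transform_within_open[where S = "{..<0}"]) (use 2 in auto)
    with 2 show ?thesis by simp
  next
    case 3
    have "((\<lambda>h::real. (max 0 (0 + h) ^ (n + 2) - max 0 0 ^ (n + 2)) / h) \<longlongrightarrow> 0) (at 0)"
    proof (rule Lim_null_comparison)
      show "\<forall>\<^sub>F h::real in at 0. norm ((max 0 (0 + h) ^ (n + 2) - max 0 0 ^ (n + 2)) / h) \<le> \<bar>h\<bar> ^ (n + 1)"
        by (rule always_eventually) (auto simp: max_def abs_mult power_abs mult_nonpos_nonneg)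
      show "((\<lambda>h::real. \<bar>h\<bar> ^ (n + 1)) \<longlongrightarrow> 0) (at 0)"
        by (rule tendsto_eq_intros refl | simp)+
    qed
    with 3 show ?thesis by (simp add: DERIV_def)
  qed
qed

lemma has_derivative_upd_apply:
  "((\<lambda>t. (z(j := t)) i) has_derivative (\<lambda>h. if i = j then h else 0)) (at t within A)"
  for z :: "'k \<Rightarrow> real"
  by (cases "i = j") auto

context coord_cube
begin

definition sq :: "real \<Rightarrow> ('k \<Rightarrow> real) \<Rightarrow> ('k \<Rightarrow> real) \<Rightarrow> real" where
  "sq R c z = R\<^sup>2 - (\<Sum>j\<in>set ks. (z j - c j)\<^sup>2)"

text \<open>A power of a truncated quadratic instead of a smooth cutoff: each derivative is a
  polynomial times a lower power of the same quadratic, so the family is closed under all operations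
  that follow. It is left unnormalised; only ratios of integrals matter.\<close>

definition bump :: "nat \<Rightarrow> real \<Rightarrow> ('k \<Rightarrow> real) \<Rightarrow> ('k \<Rightarrow> real) \<Rightarrow> real" where
  "bump n R c z = (max 0 (sq R c z)) ^ n"

lemma bump_nonneg: "bump n R c z \<ge> 0"
  by (simp add: bump_def)

lemma bump_neq_0D:
  assumes "bump n R c z \<noteq> 0" "n > 0" "j \<in> set ks" "R > 0"
  shows "\<bar>z j - c j\<bar> < R"
proof -
  have "sq R c z > 0" using assms by (auto simp: bump_def max_def split: if_splits)
  moreover have "(z j - c j)\<^sup>2 \<le> (\<Sum>j\<in>set ks. (z j - c j)\<^sup>2)"
    by (rule member_le_sum) (use assms in auto)
  ultimately have "(z j - c j)\<^sup>2 < R\<^sup>2" by (simp add: sq_def)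
  then show ?thesis using assms(4) by (metis abs_le_square_iff abs_of_pos not_le)
qed

lemma continuous_on_bump [continuous_intros]:
  assumes "continuous_on S R" "continuous_on S c" "continuous_on S z"
  shows "continuous_on S (\<lambda>x. bump n (R x) (c x) (z x))"
  unfolding bump_def sq_def
  by (intro continuous_intros continuous_on_product_then_coordinatewise[OF assms(2)]
        continuous_on_product_then_coordinatewise[OF assms(3)] assms(1))

lemma has_derivative_bump:
  assumes "\<And>j. j \<in> set ks \<Longrightarrow> ((\<lambda>x. z x j) has_derivative z' j) (at x within A)"
    and "\<And>j. j \<in> set ks \<Longrightarrow> ((\<lambda>x. c x j) has_derivative c' j) (at x within A)"
    and "(R has_derivative R') (at x within A)"
  shows "((\<lambda>x. bump (n + 2) (R x) (c x) (z x)) has_derivative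
     (\<lambda>h. (2 * R x * R' h - (\<Sum>j\<in>set ks. 2 * (z x j - c x j) * (z' j h - c' j h))) *
        (real (n + 2) * bump (n + 1) (R x) (c x) (z x)))) (at x within A)"
proof -
  have "((\<lambda>x. sq (R x) (c x) (z x)) has_derivative
     (\<lambda>h. 2 * R x * R' h - (\<Sum>j\<in>set ks. 2 * (z x j - c x j) * (z' j h - c' j h)))) (at x within A)"
    unfolding sq_def
    by (rule derivative_eq_intros assms refl | assumption)+ (simp add: fun_eq_iff power2_eq_square algebra_simps)
  from DERIV_compose_FDERIV[OF has_real_derivative_max_power this] show ?thesis
    unfolding bump_def .
qed

lemma has_real_derivative_bump_point:
  assumes "j \<in> set ks"
  shows "((\<lambda>t. bump (n + 2) R c (z(j := t))) has_real_derivative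
     - 2 * real (n + 2) * (t - c j) * bump (n + 1) R c (z(j := t))) (at t within A)"
proof -
  have "((\<lambda>t. bump (n + 2) R c (z(j := t))) has_derivative
     (\<lambda>h. (2 * R * 0 - (\<Sum>i\<in>set ks. 2 * ((z(j := t)) i - c i) * ((if i = j then h else 0) - 0))) *
        (real (n + 2) * bump (n + 1) R c (z(j := t))))) (at t within A)"
    by (rule has_derivative_bump[where z = "\<lambda>t. z(j := t)"] has_derivative_upd_apply has_derivative_const)+
  also have "(\<lambda>h. (2 * R * 0 - (\<Sum>i\<in>set ks. 2 * ((z(j := t)) i - c i) * ((if i = j then h else 0) - 0))) *
        (real (n + 2) * bump (n + 1) R c (z(j := t))))
     = (\<lambda>h. (- 2 * real (n + 2) * (t - c j) * bump (n + 1) R c (z(j := t))) * h)"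
    using assms by (simp add: fun_eq_iff if_distrib if_distribR sum.delta cong: if_cong) (simp add: algebra_simps)
  finally show ?thesis unfolding has_field_derivative_def .
qed

lemma has_real_derivative_bump_center:
  assumes "j \<in> set ks"
  shows "((\<lambda>h. bump (n + 2) R (c(j := h)) z) has_real_derivative
     2 * real (n + 2) * (z j - h) * bump (n + 1) R (c(j := h)) z) (at h within A)"
proof -
  have "((\<lambda>h. bump (n + 2) R (c(j := h)) z) has_derivative
     (\<lambda>d. (2 * R * 0 - (\<Sum>i\<in>set ks. 2 * (z i - (c(j := h)) i) * (0 - (if i = j then d else 0)))) *
        (real (n + 2) * bump (n + 1) R (c(j := h)) z))) (at h within A)"
    by (rule has_derivative_bump[where c = "\<lambda>h. c(j := h)"] has_derivative_upd_apply has_derivative_const)+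
  also have "(\<lambda>d. (2 * R * 0 - (\<Sum>i\<in>set ks. 2 * (z i - (c(j := h)) i) * (0 - (if i = j then d else 0)))) *
        (real (n + 2) * bump (n + 1) R (c(j := h)) z))
     = (\<lambda>d. (2 * real (n + 2) * (z j - h) * bump (n + 1) R (c(j := h)) z) * d)"
    using assms by (simp add: fun_eq_iff if_distrib if_distribR sum.delta cong: if_cong) (simp add: algebra_simps)
  finally show ?thesis unfolding has_field_derivative_def .
qed

lemma has_real_derivative_bump_radius:
  "((\<lambda>R. bump (n + 2) R c z) has_real_derivative 2 * real (n + 2) * R * bump (n + 1) R c z) (at R within A)"
proof -
  have "((\<lambda>R. bump (n + 2) R c z) has_derivative
     (\<lambda>h. (2 * R * h - (\<Sum>i\<in>set ks. 2 * (z i - c i) * (0 - 0))) *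
        (real (n + 2) * bump (n + 1) R c z))) (at R within A)"
    by (rule has_derivative_bump) auto
  also have "(\<lambda>h. (2 * R * h - (\<Sum>i\<in>set ks. 2 * (z i - c i) * (0 - 0))) * (real (n + 2) * bump (n + 1) R c z))
     = (\<lambda>h. (2 * real (n + 2) * R * bump (n + 1) R c z) * h)"
    by (simp add: fun_eq_iff)
  finally show ?thesis by (simp only: has_field_derivative_def)
qed

text \<open>The Laplacian of \<open>bump 4 R c\<close> with respect to the point.\<close>

definition bump_lap :: "real \<Rightarrow> ('k \<Rightarrow> real) \<Rightarrow> ('k \<Rightarrow> real) \<Rightarrow> real" where
  "bump_lap R c z = (\<Sum>j\<in>set ks. 48 * (z j - c j)\<^sup>2 * bump 2 R c z - 8 * bump 3 R c z)"

text \<open>The squared distance to the centre is \<open>R\<^sup>2 - sq R c z\<close>, and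
  multiplying \<open>bump 2\<close> by \<open>sq\<close> gives \<open>bump 3\<close>, also outside
  the ball where both vanish. The result involves the point only through bumps with the same centre,
  so it can be compared with a derivative in \<open>R\<close>.\<close>

lemma bump_lap_eq:
  "bump_lap R c z = 48 * R\<^sup>2 * bump 2 R c z - 8 * (real (length ks) + 6) * bump 3 R c z"
proof -
  have "card (set ks) = length ks" using distinct_ks by (rule distinct_card)
  then have "bump_lap R c z = 48 * (R\<^sup>2 - sq R c z) * bump 2 R c z - 8 * real (length ks) * bump 3 R c z"
    by (simp add: bump_lap_def sum_subtractf sq_def sum_distrib_left sum_distrib_right mult.assoc)
  moreover have "sq R c z * bump 2 R c z = bump 3 R c z"
    by (simp add: bump_def max_def power2_eq_square power3_eq_cube)
  ultimately show ?thesis by (simp add: algebra_simps)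
qed

lemma continuous_on_bump_lap [continuous_intros]:
  assumes "continuous_on S R" "continuous_on S c" "continuous_on S z"
  shows "continuous_on S (\<lambda>x. bump_lap (R x) (c x) (z x))"
  unfolding bump_lap_eq by (intro continuous_intros assms)

lemma bump_boundary:
  assumes "0 < R" "R < 1" "\<bar>c j\<bar> < 1" "j \<in> set ks" "\<bar>z j\<bar> = 2" "n > 0"
  shows "bump n R c z = 0"
  using bump_neq_0D[of n R c z j] assms by fastforce

section \<open>Weakly harmonic functions\<close>

text \<open>Only radial test functions are demanded, with centres and radii for which the support
  stays away from the faces of the cube.\<close>

definition weakly_harmonic :: "(('k \<Rightarrow> real) \<Rightarrow> real) \<Rightarrow> bool" where
  "weakly_harmonic U \<longleftrightarrow> continuous_on cube U \<and>
     (\<forall>R c. 0 < R \<longrightarrow> R < 1 \<longrightarrow> (\<forall>j\<in>set ks. \<bar>c j\<bar> < 1) \<longrightarrow> cube_int (\<lambda>z. U z * bump_lap R c z) = 0)"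

text \<open>Joint differentiability in the two coordinates \<open>j\<close> and \<open>i\<close>,
  with partial derivatives \<open>U1\<close> and \<open>U2\<close>. Separate partial derivatives
  would not give the linear approximation on which \<open>green_square\<close> rests.\<close>

definition plane_deriv where
  "plane_deriv j i U U1 U2 \<longleftrightarrow> (\<forall>z\<in>cube. ((\<lambda>p::real \<times> real. U (z(j := fst p, i := snd p))) has_derivative
     (\<lambda>h. fst h * U1 z + snd h * (U2 z :: real))) (at (z j, z i) within {-2..2} \<times> {-2..2}))"

lemma plane_derivD:
  assumes "plane_deriv j i U U1 U2" "j \<noteq> i" "z \<in> cube" "p \<in> {-2..2} \<times> {-2..2}"
  shows "((\<lambda>p. U (z(j := fst p, i := snd p))) has_derivative
     (\<lambda>h. fst h * U1 (z(j := fst p, i := snd p)) + snd h * U2 (z(j := fst p, i := snd p)))) (at p within {-2..2} \<times> {-2..2})"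
proof -
  define w where "w = z(j := fst p, i := snd p)"
  have w: "w \<in> cube" unfolding w_def using assms(3,4) by (auto intro!: cube_upd)
  have p: "(w j, w i) = p" using assms(2) by (simp add: w_def)
  have "w(j := s, i := t) = z(j := s, i := t)" for s t
    using assms(2) by (auto simp: w_def fun_eq_iff)
  with assms(1) w p show ?thesis unfolding plane_deriv_def w_def[symmetric] by fastforce
qed

lemma plane_deriv_mult:
  assumes "plane_deriv j i U U1 U2" "plane_deriv j i V V1 V2" "j \<noteq> i"
  shows "plane_deriv j i (\<lambda>z. U z * V z) (\<lambda>z. U z * V1 z + U1 z * V z) (\<lambda>z. U z * V2 z + U2 z * V z)"
  unfolding plane_deriv_def
proof
  fix z assume z: "z \<in> cube"
  have e: "z(j := z j, i := z i) = z" by simp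
  from assms z have "((\<lambda>p. U (z(j := fst p, i := snd p)) * V (z(j := fst p, i := snd p))) has_derivative
     (\<lambda>h. U (z(j := fst (z j, z i), i := snd (z j, z i))) * (fst h * V1 z + snd h * V2 z) +
          (fst h * U1 z + snd h * U2 z) * V (z(j := fst (z j, z i), i := snd (z j, z i)))))
      (at (z j, z i) within {-2..2} \<times> {-2..2})"
    unfolding plane_deriv_def by (intro has_derivative_mult) auto
  then show "((\<lambda>p. U (z(j := fst p, i := snd p)) * V (z(j := fst p, i := snd p))) has_derivative
     (\<lambda>h. fst h * (U z * V1 z + U1 z * V z) + snd h * (U z * V2 z + U2 z * V z))) (at (z j, z i) within {-2..2} \<times> {-2..2})"
    unfolding fst_conv snd_conv e by (simp add: algebra_simps)
qed

text \<open>Green's formula for \<open>U \<phi>\<close> and \<open>V \<phi>\<close>: by the product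
  rule the difference of their cross derivatives is
  \<open>U \<phi>2 - V \<phi>1 + (U2 - V1) \<phi>\<close>, whose last, possibly discontinuous term
  is zero. The boundary terms vanish with \<phi>.\<close>

lemma weak_exchange:
  assumes ji: "j \<in> set ks" "i \<in> set ks" "j \<noteq> i"
    and cont: "continuous_on cube U" "continuous_on cube V" "continuous_on cube \<phi>1" "continuous_on cube \<phi>2"
    and U: "plane_deriv j i U U1 U2" and V: "plane_deriv j i V V1 V2"
    and \<phi>: "plane_deriv j i \<phi> \<phi>1 \<phi>2"
    and eq: "\<And>z. z \<in> cube \<Longrightarrow> U2 z = V1 z"
    and bd: "\<And>z. z \<in> cube \<Longrightarrow> \<bar>z j\<bar> = 2 \<or> \<bar>z i\<bar> = 2 \<Longrightarrow> \<phi> z = 0"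
  shows "cube_int (\<lambda>z. U z * \<phi>2 z) = cube_int (\<lambda>z. V z * \<phi>1 z)"
proof -
  define F where "F z = U z * \<phi>2 z - V z * \<phi>1 z" for z
  have cF: "continuous_on cube F" unfolding F_def by (intro continuous_intros cont)
  have "cube_int F = 0"
  proof (rule cube_int_eq_0_double[OF cF ji])
    fix z assume z: "z \<in> cube"
    define at2 where "at2 p = z(j := fst p, i := snd p)" for p
    have at2: "at2 p \<in> cube" if "p \<in> {-2..2} \<times> {-2..2}" for p
      using that z unfolding at2_def by (auto intro!: cube_upd)
    have P: "((\<lambda>p. U (at2 p) * \<phi> (at2 p)) has_derivative (\<lambda>h. fst h * (U (at2 p) * \<phi>1 (at2 p) + U1 (at2 p) * \<phi> (at2 p))
        + snd h * (U (at2 p) * \<phi>2 (at2 p) + U2 (at2 p) * \<phi> (at2 p)))) (at p within {-2..2} \<times> {-2..2})"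
      if "p \<in> {-2..2} \<times> {-2..2}" for p
      using plane_derivD[OF plane_deriv_mult[OF U \<phi> ji(3)] ji(3) z that] unfolding at2_def .
    have R: "((\<lambda>p. V (at2 p) * \<phi> (at2 p)) has_derivative (\<lambda>h. fst h * (V (at2 p) * \<phi>1 (at2 p) + V1 (at2 p) * \<phi> (at2 p))
        + snd h * (V (at2 p) * \<phi>2 (at2 p) + V2 (at2 p) * \<phi> (at2 p)))) (at p within {-2..2} \<times> {-2..2})"
      if "p \<in> {-2..2} \<times> {-2..2}" for p
      using plane_derivD[OF plane_deriv_mult[OF V \<phi> ji(3)] ji(3) z that] unfolding at2_def .
    have cg: "continuous_on ({-2..2} \<times> {-2..2}) (\<lambda>p. F (at2 p))"
      by (rule continuous_on_compose2[OF cF]) (use at2 in \<open>auto simp: at2_def intro!: continuous_on_fun_upd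
            continuous_on_fst continuous_on_snd continuous_on_id continuous_on_const\<close>)
    have zero: "\<phi> (at2 (s, 2)) = 0" "\<phi> (at2 (s, -2)) = 0" "\<phi> (at2 (2, s)) = 0" "\<phi> (at2 (-2, s)) = 0"
      if "s \<in> {-2..2}" for s
      using that bd[OF at2] ji(3) by (auto simp: at2_def)
    have "integral {-2..2} (\<lambda>s. integral {-2..2} (\<lambda>t. F (at2 (s, t)))) =
       integral {-2..2} (\<lambda>s. U (at2 (s, 2)) * \<phi> (at2 (s, 2))) - integral {-2..2} (\<lambda>s. U (at2 (s, -2)) * \<phi> (at2 (s, -2)))
       - (integral {-2..2} (\<lambda>t. V (at2 (2, t)) * \<phi> (at2 (2, t))) - integral {-2..2} (\<lambda>t. V (at2 (-2, t)) * \<phi> (at2 (-2, t))))"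
      by (rule green_square[OF P R cg, symmetric]) (use eq[OF at2] in \<open>auto simp: F_def algebra_simps\<close>)
    also have "\<dots> = integral {-2..2} (\<lambda>s::real. 0) - integral {-2..2} (\<lambda>s::real. 0)
        - (integral {-2..2} (\<lambda>s::real. 0) - integral {-2..2} (\<lambda>s::real. 0::real))"
      by (intro arg_cong2[where f = minus] integral_cong) (use zero in auto)
    finally have "integral {-2..2} (\<lambda>s. integral {-2..2} (\<lambda>t. F (at2 (s, t)))) = 0" by simp
    then show "slice_int j (slice_int i F) z = 0"
      unfolding slice_int_def[of j] slice_int_def[of i] at2_def by simp
  qed
  moreover have "cube_int F = cube_int (\<lambda>z. U z * \<phi>2 z) - cube_int (\<lambda>z. V z * \<phi>1 z)"
    unfolding F_def by (intro cube_int_diff continuous_intros cont)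
  ultimately show ?thesis by simp
qed

end

section \<open>From the first-order system to the weak Laplace equation\<close>

context coord_cube
begin

text \<open>A first derivative of \<open>bump 4 R c\<close>; the second derivatives follow as
  \<open>bump_hess\<close>.\<close>

definition bump_grad :: "'k \<Rightarrow> real \<Rightarrow> ('k \<Rightarrow> real) \<Rightarrow> ('k \<Rightarrow> real) \<Rightarrow> real" where
  "bump_grad k R c z = - 8 * (z k - c k) * bump 3 R c z"

definition bump_hess :: "'k \<Rightarrow> 'k \<Rightarrow> real \<Rightarrow> ('k \<Rightarrow> real) \<Rightarrow> ('k \<Rightarrow> real) \<Rightarrow> real" where
  "bump_hess k j R c z = 48 * (z k - c k) * (z j - c j) * bump 2 R c z - (if k = j then 8 * bump 3 R c z else 0)"

lemma bump_hess_commute: "bump_hess k j = bump_hess j k"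
  by (cases "k = j") (simp_all add: bump_hess_def fun_eq_iff algebra_simps)

lemma bump_lap_hess: "bump_lap R c z = (\<Sum>j\<in>set ks. bump_hess j j R c z)"
  by (simp add: bump_lap_def bump_hess_def power2_eq_square algebra_simps)

lemma continuous_on_coord: "continuous_on S (\<lambda>z::'k \<Rightarrow> real. z j)"
  by (rule continuous_on_product_then_coordinatewise[OF continuous_on_id])

lemma continuous_on_bump_fun: "continuous_on S (bump n R c)"
  using continuous_on_bump[OF continuous_on_const continuous_on_const continuous_on_id, of S n R c] by simp

lemma continuous_on_bump_grad: "continuous_on S (bump_grad k R c)"
  unfolding bump_grad_def by (intro continuous_intros continuous_on_coord)

lemma continuous_on_bump_hess: "continuous_on S (bump_hess k j R c)"
  unfolding bump_hess_def
  by (cases "k = j") (auto intro!: continuous_on_diff continuous_on_mult continuous_on_const continuous_on_coord continuous_on_bump_fun)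

lemma continuous_on_bump_lap_fun: "continuous_on S (bump_lap R c)"
  using continuous_on_bump_lap[OF continuous_on_const continuous_on_const continuous_on_id, of S R c] by simp

lemma bump_grad_boundary:
  assumes "0 < R" "R < 1" "\<bar>c j\<bar> < 1" "j \<in> set ks" "\<bar>z j\<bar> = 2"
  shows "bump_grad k R c z = 0"
proof -
  have "bump 3 R c z = 0" by (rule bump_boundary[where j = j]) (use assms in auto)
  then show ?thesis by (simp add: bump_grad_def)
qed

lemma has_real_derivative_bump_grad:
  assumes "j \<in> set ks"
  shows "((\<lambda>t. bump_grad j R c (z(j := t))) has_real_derivative bump_hess j j R c (z(j := t))) (at t within A)"
proof -
  have b: "((\<lambda>t. bump 3 R c (z(j := t))) has_real_derivative - 6 * (t - c j) * bump 2 R c (z(j := t))) (at t within A)"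
    using has_real_derivative_bump_point[OF assms, of 1 R c z t A] by (simp add: numeral_eq_Suc)
  have "((\<lambda>t. - 8 * (t - c j) * bump 3 R c (z(j := t))) has_real_derivative
      - 8 * (t - c j) * (- 6 * (t - c j) * bump 2 R c (z(j := t))) + - 8 * bump 3 R c (z(j := t))) (at t within A)"
    by (rule derivative_eq_intros b refl)+ simp
  then show ?thesis by (simp add: bump_grad_def bump_hess_def algebra_simps)
qed

lemma plane_deriv_bump:
  assumes "j \<in> set ks" "i \<in> set ks" "j \<noteq> i"
  shows "plane_deriv j i (bump (n + 2) R c) (\<lambda>z. - 2 * real (n + 2) * (z j - c j) * bump (n + 1) R c z)
     (\<lambda>z. - 2 * real (n + 2) * (z i - c i) * bump (n + 1) R c z)"
  unfolding plane_deriv_def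
proof
  fix z :: "'k \<Rightarrow> real"
  let ?A = "at (z j, z i) within {-2..2} \<times> {-2..2}"
  let ?w = "\<lambda>p::real \<times> real. z(j := fst p, i := snd p)"
  let ?d = "\<lambda>k h::real \<times> real. if k = i then snd h else if k = j then fst h else 0"
  have w: "((\<lambda>p. ?w p k) has_derivative ?d k) ?A" for k
    by (cases "k = i"; cases "k = j") (auto intro!: derivative_eq_intros)
  have wz: "?w (z j, z i) = z" by simp
  have s: "(\<Sum>k\<in>set ks. 2 * (z k - c k) * ?d k h) = 2 * (z j - c j) * fst h + 2 * (z i - c i) * snd h" for h
  proof -
    have "(\<Sum>k\<in>set ks. 2 * (z k - c k) * ?d k h)
      = (\<Sum>k\<in>set ks. (if k = i then 2 * (z k - c k) * snd h else 0) + (if k = j then 2 * (z k - c k) * fst h else 0))"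
      by (rule sum.cong) (use assms in auto)
    also have "\<dots> = 2 * (z i - c i) * snd h + 2 * (z j - c j) * fst h"
      using assms by (simp add: sum.distrib sum.delta)
    finally show ?thesis by simp
  qed
  have "((\<lambda>p. bump (n + 2) R c (?w p)) has_derivative
     (\<lambda>h. (2 * R * 0 - (\<Sum>k\<in>set ks. 2 * (?w (z j, z i) k - c k) * (?d k h - 0))) *
        (real (n + 2) * bump (n + 1) R c (?w (z j, z i))))) ?A"
    by (rule has_derivative_bump[where z = ?w] w has_derivative_const)+
  moreover have "(\<lambda>h. (2 * R * 0 - (\<Sum>k\<in>set ks. 2 * (?w (z j, z i) k - c k) * (?d k h - 0))) *
        (real (n + 2) * bump (n + 1) R c (?w (z j, z i))))
     = (\<lambda>h. fst h * (- 2 * real (n + 2) * (z j - c j) * bump (n + 1) R c z) +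
            snd h * (- 2 * real (n + 2) * (z i - c i) * bump (n + 1) R c z))"
    unfolding wz diff_0_right s by (simp add: fun_eq_iff algebra_simps)
  ultimately show "((\<lambda>p. bump (n + 2) R c (?w p)) has_derivative
     (\<lambda>h. fst h * (- 2 * real (n + 2) * (z j - c j) * bump (n + 1) R c z) +
            snd h * (- 2 * real (n + 2) * (z i - c i) * bump (n + 1) R c z))) ?A"
    by (simp only:)
qed

lemma plane_deriv_bump_grad:
  assumes "j \<in> set ks" "i \<in> set ks" "j \<noteq> i"
  shows "plane_deriv j i (bump_grad k R c) (bump_hess k j R c) (bump_hess k i R c)"
proof -
  have lin: "plane_deriv j i (\<lambda>z. - 8 * (z k - c k)) (\<lambda>z. if k = j then -8 else 0) (\<lambda>z. if k = i then -8 else 0)"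
    unfolding plane_deriv_def using assms(3)
    by (cases "k = i"; cases "k = j") (auto intro!: derivative_eq_intros)
  have b: "plane_deriv j i (bump 3 R c) (\<lambda>z. - 6 * (z j - c j) * bump 2 R c z) (\<lambda>z. - 6 * (z i - c i) * bump 2 R c z)"
    using plane_deriv_bump[OF assms, of 1 R c] by (simp add: numeral_eq_Suc)
  have e: "(\<lambda>z. (- 8 * (z k - c k)) * (- 6 * (z j' - c j') * bump 2 R c z) + (if k = j' then -8 else 0) * bump 3 R c z)
     = bump_hess k j' R c" for j'
    by (auto simp: fun_eq_iff bump_hess_def algebra_simps)
  have e0: "(\<lambda>z. - 8 * (z k - c k) * bump 3 R c z) = bump_grad k R c"
    by (auto simp: fun_eq_iff bump_grad_def)
  show ?thesis using plane_deriv_mult[OF lin b assms(3)] unfolding e e0 .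
qed

text \<open>The first-order system \<open>\<partial>\<^sub>j u\<^sub>l = \<partial>\<^bsub>\<beta> j\<^esub> u\<^bsub>A j l\<^esub>\<close> is used twice to turn a second derivative of the test
  function in direction \<open>j\<close> into one in direction \<open>\<beta> j\<close>.\<close>

lemma weakly_harmonic_system:
  fixes U :: "'l \<Rightarrow> ('k \<Rightarrow> real) \<Rightarrow> real"
  assumes \<beta>: "\<And>j. j \<in> set ks \<Longrightarrow> \<beta> j \<in> set ks"
    and cont: "\<And>l. continuous_on cube (U l)"
    and pl: "\<And>l j i. j \<in> set ks \<Longrightarrow> i \<in> set ks \<Longrightarrow> j \<noteq> i \<Longrightarrow> plane_deriv j i (U l) (d l j) (d l i)"
    and sys: "\<And>l j z. j \<in> set ks \<Longrightarrow> z \<in> cube \<Longrightarrow> d l j z = d (A j l) (\<beta> j) z"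
    and base: "\<And>l j. j \<in> set ks \<Longrightarrow> \<beta> j = j \<Longrightarrow> A j l = l"
    and sum0: "\<And>l j0 z. z \<in> cube \<Longrightarrow> j0 \<in> \<beta> ` set ks \<Longrightarrow> (\<Sum>j\<in>{j\<in>set ks. \<beta> j = j0}. U (A j (A j l)) z) = 0"
  shows "weakly_harmonic (U l)"
  unfolding weakly_harmonic_def
proof (intro conjI allI impI)
  show "continuous_on cube (U l)" by (rule cont)
  fix R :: real and c :: "'k \<Rightarrow> real"
  assume R: "0 < R" "R < 1" and c: "\<forall>j\<in>set ks. \<bar>c j\<bar> < 1"
  have exch: "cube_int (\<lambda>z. U l' z * bump_hess k j R c z) = cube_int (\<lambda>z. U (A j l') z * bump_hess k (\<beta> j) R c z)"
    if j: "j \<in> set ks" "\<beta> j \<noteq> j" for j k l'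
  proof (rule weak_exchange[OF \<beta>[OF j(1)] j cont cont continuous_on_bump_hess continuous_on_bump_hess])
    show "plane_deriv (\<beta> j) j (U l') (d l' (\<beta> j)) (d l' j)" by (rule pl[OF \<beta>[OF j(1)] j])
    show "plane_deriv (\<beta> j) j (U (A j l')) (d (A j l') (\<beta> j)) (d (A j l') j)" by (rule pl[OF \<beta>[OF j(1)] j])
    show "plane_deriv (\<beta> j) j (bump_grad k R c) (bump_hess k (\<beta> j) R c) (bump_hess k j R c)"
      by (rule plane_deriv_bump_grad[OF \<beta>[OF j(1)] j])
    show "d l' j z = d (A j l') (\<beta> j) z" if "z \<in> cube" for z by (rule sys[OF j(1) that])
    show "bump_grad k R c z = 0" if "\<bar>z (\<beta> j)\<bar> = 2 \<or> \<bar>z j\<bar> = 2" for z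
      using that
    proof
      assume "\<bar>z (\<beta> j)\<bar> = 2"
      then show ?thesis by (intro bump_grad_boundary[where j = "\<beta> j"] R) (use c \<beta>[OF j(1)] in auto)
    next
      assume "\<bar>z j\<bar> = 2"
      then show ?thesis by (intro bump_grad_boundary[where j = j] R) (use c j in auto)
    qed
  qed
  define I where "I l' k i = cube_int (\<lambda>z. U l' z * bump_hess k i R c z)" for l' k i
  have move: "I l j j = I (A j (A j l)) (\<beta> j) (\<beta> j)" if "j \<in> set ks" for j
  proof (cases "\<beta> j = j")
    case True
    then show ?thesis using base[OF that True] by simp
  next
    case False
    \<comment> \<open>The exchange acts on the second index of the Hessian only. Symmetry of the
      Hessian brings the remaining \<open>j\<close> into that position, so that a second exchange
      can move it too.\<close>
    have "I l j j = I (A j l) (\<beta> j) j"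
      unfolding I_def bump_hess_commute[of "\<beta> j" j] by (rule exch[OF that False])
    also have "\<dots> = I (A j (A j l)) (\<beta> j) (\<beta> j)"
      unfolding I_def by (rule exch[OF that False])
    finally show ?thesis .
  qed
  have "cube_int (\<lambda>z. U l z * bump_lap R c z) = (\<Sum>j\<in>set ks. I l j j)"
    unfolding bump_lap_hess sum_distrib_left I_def
    by (intro cube_int_sum continuous_on_mult cont continuous_on_bump_hess) auto
  also have "\<dots> = (\<Sum>j\<in>set ks. I (A j (A j l)) (\<beta> j) (\<beta> j))"
    by (rule sum.cong[OF refl move])
  \<comment> \<open>Within one fibre of \<beta> all terms now share the same Hessian entry, which
    can be factored out of the sum.\<close>
  also have "\<dots> = (\<Sum>j0\<in>\<beta> ` set ks. \<Sum>j\<in>{j\<in>set ks. \<beta> j = j0}. I (A j (A j l)) (\<beta> j) (\<beta> j))"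
    by (rule sum.image_gen) simp
  also have "\<dots> = (\<Sum>j0\<in>\<beta> ` set ks. 0)"
  proof (rule sum.cong[OF refl])
    fix j0 assume j0: "j0 \<in> \<beta> ` set ks"
    have "(\<Sum>j\<in>{j\<in>set ks. \<beta> j = j0}. I (A j (A j l)) (\<beta> j) (\<beta> j)) = (\<Sum>j\<in>{j\<in>set ks. \<beta> j = j0}. I (A j (A j l)) j0 j0)"
      by (rule sum.cong) auto
    also have "\<dots> = cube_int (\<lambda>z. \<Sum>j\<in>{j\<in>set ks. \<beta> j = j0}. U (A j (A j l)) z * bump_hess j0 j0 R c z)"
      unfolding I_def by (intro cube_int_sum[symmetric] continuous_on_mult cont continuous_on_bump_hess) auto
    also have "\<dots> = cube_int (\<lambda>z. 0 * 0)"
      by (rule cube_int_cong) (simp only: sum_distrib_right[symmetric] sum0[OF _ j0] mult_zero_left)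
    also have "\<dots> = 0" using cube_int_cmult[of 0 "\<lambda>z. 0"] by simp
    finally show "(\<Sum>j\<in>{j\<in>set ks. \<beta> j = j0}. I (A j (A j l)) (\<beta> j) (\<beta> j)) = 0" .
  qed
  finally show "cube_int (\<lambda>z. U l z * bump_lap R c z) = 0" by simp
qed

text \<open>The comparison solution: it subjects the mass of the bump to the same power law in
  \<open>R\<close> as the integral against any other solution.\<close>

lemma weakly_harmonic_const: "weakly_harmonic (\<lambda>_. 1)"
  unfolding weakly_harmonic_def
proof (intro conjI allI impI)
  fix R :: real and c :: "'k \<Rightarrow> real"
  assume R: "0 < R" "R < 1" and c: "\<forall>j\<in>set ks. \<bar>c j\<bar> < 1"
  have "cube_int (bump_hess j j R c) = 0" if "j \<in> set ks" for j
  proof (rule cube_int_derivative_eq_0[OF that continuous_on_bump_hess has_real_derivative_bump_grad[OF that]])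
    show "bump_grad j R c z = 0" if "\<bar>z j\<bar> = 2" for z
      by (rule bump_grad_boundary[where j = j]) (use R c that \<open>j \<in> set ks\<close> in auto)
  qed
  then have "cube_int (\<lambda>z. \<Sum>j\<in>set ks. bump_hess j j R c z) = 0"
    by (subst cube_int_sum) (auto intro: continuous_on_bump_hess)
  then show "cube_int (\<lambda>z. 1 * bump_lap R c z) = 0" by (simp add: bump_lap_hess)
qed simp

section \<open>The mean value property\<close>

text \<open>The cube does not restrict the coordinates outside \<open>ks\<close>, but the iterated
  integral only sees points that vanish there. Truncation makes closeness in the coordinates of
  \<open>ks\<close> sufficient for closeness in the product topology.\<close>

definition trunc :: "('k \<Rightarrow> real) \<Rightarrow> 'k \<Rightarrow> real" where
  "trunc z = (\<lambda>j. if j \<in> set ks then z j else 0)"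

lemma trunc_in_cube: "z \<in> cube \<Longrightarrow> trunc z \<in> cube"
  by (auto simp: trunc_def cube_def)

lemma trunc_zero [simp]: "trunc (\<lambda>_. 0) = (\<lambda>_. 0)"
  by (simp add: trunc_def)

lemma continuous_on_trunc: "continuous_on S trunc"
proof (rule continuous_on_coordinatewise_then_product)
  show "continuous_on S (\<lambda>z. trunc z i)" for i
    by (cases "i \<in> set ks") (simp_all add: trunc_def continuous_on_coord)
qed

lemma bump_trunc: "bump n R c (trunc z) = bump n R c z"
  by (simp add: bump_def sq_def trunc_def)

lemma cube_int_trunc: "cube_int (\<lambda>z. F (trunc z)) = cube_int F"
proof -
  have "foldr slice_int l (\<lambda>z. F (trunc z)) z = foldr slice_int l F (trunc z)" if "set l \<subseteq> set ks" for l z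
    using that
  proof (induction l arbitrary: z)
    case (Cons i l)
    have e: "trunc (z(i := t)) = (trunc z)(i := t)" for z t
      using Cons.prems by (auto simp: trunc_def fun_eq_iff)
    have "foldr slice_int l (\<lambda>z. F (trunc z)) = (\<lambda>z. foldr slice_int l F (trunc z))"
      using Cons by auto
    then have "foldr slice_int (i # l) (\<lambda>z. F (trunc z)) z
        = slice_int i (\<lambda>z. foldr slice_int l F (trunc z)) z" by simp
    also have "\<dots> = slice_int i (foldr slice_int l F) (trunc z)"
      unfolding slice_int_def[of i] e ..
    finally show ?case by simp
  qed simp
  then show ?thesis by (simp add: cube_int_def)
qed

text \<open>A basic product neighbourhood of \<open>c\<close> supplies a radius for each coordinate.
  The finitely many radii for \<open>ks\<close> have a positive minimum, and outside
  \<open>ks\<close> the points \<open>trunc z\<close> and \<open>c\<close> coincide.\<close>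

lemma continuous_on_cube_near:
  fixes U :: "('k \<Rightarrow> real) \<Rightarrow> real"
  assumes cU: "continuous_on cube U" and c: "c \<in> cube" "trunc c = c" and "e > 0"
  obtains \<delta> where "\<delta> > 0" "\<And>z. z \<in> cube \<Longrightarrow> (\<forall>j\<in>set ks. \<bar>z j - c j\<bar> < \<delta>) \<Longrightarrow> \<bar>U (trunc z) - U c\<bar> < e"
proof -
  have "openin (top_of_set cube) (cube \<inter> U -` ball (U c) e)"
    by (rule continuous_openin_preimage_gen[OF cU]) simp
  then obtain T where T: "open T" "cube \<inter> U -` ball (U c) e = cube \<inter> T" unfolding openin_open by blast
  have "c \<in> T" using T(2) c \<open>e > 0\<close> by auto
  moreover have "openin (product_topology (\<lambda>i. euclidean) UNIV) T"
    using T(1) unfolding euclidean_product_topology by simp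
  ultimately obtain X where X: "c \<in> PiE UNIV X" "\<And>i. openin euclidean (X i)" "PiE UNIV X \<subseteq> T"
    using product_topology_open_contains_basis by (metis (no_types, lifting))
  have "\<exists>\<delta>>0. ball (c j) \<delta> \<subseteq> X j" for j
    using X(1,2) open_contains_ball by (metis PiE_UNIV_domain Pi_mem UNIV_I open_openin)
  then obtain \<delta> where \<delta>: "\<And>j. \<delta> j > 0" "\<And>j. ball (c j) (\<delta> j) \<subseteq> X j" by metis
  define d where "d = Min (insert 1 (\<delta> ` set ks))"
  have d: "d > 0" "\<And>j. j \<in> set ks \<Longrightarrow> d \<le> \<delta> j" unfolding d_def using \<delta>(1) by auto
  show thesis
  proof (rule that[OF d(1)])
    fix z assume z: "z \<in> cube" "\<forall>j\<in>set ks. \<bar>z j - c j\<bar> < d"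
    have "trunc z j \<in> X j" for j
    proof (cases "j \<in> set ks")
      case True
      then have "dist (c j) (z j) < \<delta> j" using z(2) d(2)[OF True] by (auto simp: dist_real_def abs_minus_commute)
      then show ?thesis using \<delta>(2)[of j] True by (auto simp: trunc_def)
    next
      case False
      then have "trunc z j = c j" using c(2) by (auto simp: trunc_def fun_eq_iff split: if_splits)
      then show ?thesis using X(1) by auto
    qed
    then have "trunc z \<in> T" using X(3) by auto
    then have "U (trunc z) \<in> ball (U c) e" using T(2) trunc_in_cube[OF z(1)] by blast
    then show "\<bar>U (trunc z) - U c\<bar> < e" by (simp add: dist_real_def abs_minus_commute)
  qed
qed

text \<open>The normalised bumps are an approximate identity. Stating the error relative to the mass
  avoids any knowledge of how the mass behaves as \<open>R\<close> tends to 0.\<close>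

lemma bump_concentration:
  assumes cU: "continuous_on cube U" and c: "\<forall>j\<in>set ks. \<bar>c j\<bar> < 1" "trunc c = c" and "e > 0" "n > 0"
  obtains \<delta> where "\<delta> > 0" "\<And>R. 0 < R \<Longrightarrow> R < \<delta> \<Longrightarrow>
     \<bar>cube_int (\<lambda>z. U z * bump n R c z) - U c * cube_int (bump n R c)\<bar> \<le> e * cube_int (bump n R c)"
proof -
  have "c \<in> cube" using c(1) by (force simp: cube_def)
  then obtain \<delta> where \<delta>: "\<delta> > 0" "\<And>z. z \<in> cube \<Longrightarrow> (\<forall>j\<in>set ks. \<bar>z j - c j\<bar> < \<delta>) \<Longrightarrow> \<bar>U (trunc z) - U c\<bar> < e"
    using continuous_on_cube_near[OF cU _ c(2) \<open>e > 0\<close>] by blast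
  have cUt: "continuous_on cube (\<lambda>z. U (trunc z))"
    by (rule continuous_on_compose2[OF cU continuous_on_trunc]) (use trunc_in_cube in auto)
  show thesis
  proof (rule that[OF \<delta>(1)])
    fix R assume R: "0 < R" "R < \<delta>"
    have "cube_int (\<lambda>z. U z * bump n R c z) = cube_int (\<lambda>z. U (trunc z) * bump n R c z)"
      using cube_int_trunc[of "\<lambda>z. U z * bump n R c z"] by (simp add: bump_trunc)
    moreover have *: "\<bar>U (trunc z) * bump n R c z - U c * bump n R c z\<bar> \<le> e * bump n R c z" if "z \<in> cube" for z
    proof (cases "bump n R c z = 0")
      case False
      have "\<bar>z j - c j\<bar> < \<delta>" if "j \<in> set ks" for j
        using bump_neq_0D[OF False \<open>n > 0\<close> that R(1)] R(2) by linarith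
      then have "\<bar>U (trunc z) - U c\<bar> \<le> e" using \<delta>(2)[OF that] by force
      then show ?thesis
        using mult_right_mono[OF _ bump_nonneg[of n R c z]]
        by (metis abs_mult abs_of_nonneg bump_nonneg left_diff_distrib)
    qed simp
    have "cube_int (\<lambda>z. U (trunc z) * bump n R c z) \<le> cube_int (\<lambda>z. (U c + e) * bump n R c z)"
      by (intro cube_int_mono continuous_on_mult cUt continuous_on_const continuous_on_bump_fun)
         (use * in \<open>force simp: algebra_simps abs_le_iff\<close>)
    moreover have "cube_int (\<lambda>z. (U c - e) * bump n R c z) \<le> cube_int (\<lambda>z. U (trunc z) * bump n R c z)"
      by (intro cube_int_mono continuous_on_mult cUt continuous_on_const continuous_on_bump_fun)
         (use * in \<open>force simp: algebra_simps abs_le_iff\<close>)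
    ultimately show "\<bar>cube_int (\<lambda>z. U z * bump n R c z) - U c * cube_int (bump n R c)\<bar> \<le> e * cube_int (bump n R c)"
      unfolding cube_int_cmult by (simp add: abs_le_iff algebra_simps)
  qed
qed

text \<open>By the explicit form of the Laplacian, the integral against the bump satisfies Euler's differential equation in \<open>R\<close>.\<close>

lemma weakly_harmonic_scaling:
  assumes U: "weakly_harmonic U" and c: "\<forall>j\<in>set ks. \<bar>c j\<bar> < 1"
  obtains C where "\<And>R. 0 < R \<Longrightarrow> R < 1 \<Longrightarrow> cube_int (\<lambda>z. U z * bump 3 R c z) = C * R ^ (length ks + 6)"
proof -
  define m where "m R = cube_int (\<lambda>z. U z * bump 3 R c z)" for R
  define m2 where "m2 R = cube_int (\<lambda>z. U z * bump 2 R c z)" for R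
  have cU: "continuous_on cube U" using U by (simp add: weakly_harmonic_def)
  have der: "(m has_real_derivative 6 * R * m2 R) (at R within {0<..<1})" if "R \<in> {0<..<1}" for R
  proof -
    have "(m has_real_derivative cube_int (\<lambda>z. U z * (6 * R * bump 2 R c z))) (at R within {0<..<1})"
      unfolding m_def
    proof (rule has_real_derivative_cube_int)
      show "continuous_on cube (\<lambda>z. U z * bump 3 R c z)" for R
        by (intro continuous_on_mult cU continuous_on_bump_fun)
      have "continuous_on ({0<..<1} \<times> cube) (\<lambda>p. U (snd p))"
        by (rule continuous_on_compose2[OF cU]) (auto intro: continuous_on_snd continuous_on_id)
      then show "continuous_on ({0<..<1} \<times> cube) (\<lambda>(R, z). U z * (6 * R * bump 2 R c z))"
        unfolding case_prod_beta by (intro continuous_intros)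
      show "((\<lambda>R. U z * bump 3 R c z) has_real_derivative U z * (6 * R * bump 2 R c z)) (at R within {0<..<1})" for R z
        using DERIV_cmult[OF has_real_derivative_bump_radius[of 1 c z R "{0<..<1}"], of "U z"]
        by (simp add: numeral_eq_Suc)
    qed (use that in auto)
    also have "cube_int (\<lambda>z. U z * (6 * R * bump 2 R c z)) = 6 * R * m2 R"
      unfolding m2_def cube_int_cmult[symmetric] by (simp add: mult_ac)
    finally show ?thesis .
  qed
  have euler: "6 * R * m2 R * R = (real (length ks) + 6) * m R" if R: "0 < R" "R < 1" for R
  proof -
    have "0 = cube_int (\<lambda>z. U z * bump_lap R c z)"
      using U c R by (simp add: weakly_harmonic_def)
    also have "\<dots> = cube_int (\<lambda>z. 48 * R\<^sup>2 * (U z * bump 2 R c z) - 8 * (real (length ks) + 6) * (U z * bump 3 R c z))"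
      by (simp add: bump_lap_eq algebra_simps)
    also have "\<dots> = 48 * R\<^sup>2 * m2 R - 8 * (real (length ks) + 6) * m R"
      unfolding m_def m2_def cube_int_cmult[symmetric]
      by (intro cube_int_diff continuous_on_mult cU continuous_on_const continuous_on_bump_fun)
    finally show ?thesis by (simp add: power2_eq_square algebra_simps)
  qed
  \<comment> \<open>The exponent is the degree of homogeneity of the integral of
    \<open>bump 3\<close>: \<open>length ks\<close> from the volume and 6 from the cube of a
    quadratic.\<close>
  have "\<exists>C. \<forall>R\<in>{0<..<1}. m R / R ^ (length ks + 6) = C"
  proof (rule has_field_derivative_zero_constant)
    fix R :: real assume R: "R \<in> {0<..<1}"
    have "((\<lambda>R. m R / R ^ (length ks + 6)) has_real_derivative
       ((6 * R * m2 R) * R ^ (length ks + 6) - m R * (real (length ks + 6) * R ^ (length ks + 5))) /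
        (R ^ (length ks + 6) * R ^ (length ks + 6))) (at R within {0<..<1})"
      by (rule DERIV_divide[OF der[OF R]]) (use R DERIV_pow[of "length ks + 6" R "{0<..<1}"] in \<open>auto simp: numeral_eq_Suc\<close>)
    moreover have "(6 * R * m2 R) * R ^ (length ks + 6) = m R * (real (length ks + 6) * R ^ (length ks + 5))"
    proof -
      have p: "R ^ (length ks + 6) = R * R ^ (length ks + 5)" by (simp add: numeral_eq_Suc)
      have "(6 * R * m2 R) * R ^ (length ks + 6) = (6 * R * m2 R * R) * R ^ (length ks + 5)"
        unfolding p by (simp only: mult_ac)
      also have "\<dots> = (real (length ks) + 6) * m R * R ^ (length ks + 5)"
        using euler[of R] R by simp
      finally show ?thesis by (simp add: mult_ac)
    qed
    ultimately show "((\<lambda>R. m R / R ^ (length ks + 6)) has_real_derivative 0) (at R within {0<..<1})" by simp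
  qed simp
  then obtain C where C: "\<And>R. R \<in> {0<..<1} \<Longrightarrow> m R / R ^ (length ks + 6) = C" by blast
  show thesis
  proof (rule that[of C])
    fix R :: real assume "0 < R" "R < 1"
    then show "cube_int (\<lambda>z. U z * bump 3 R c z) = C * R ^ (length ks + 6)"
      using C[of R] by (simp add: m_def field_simps)
  qed
qed

text \<open>Both sides are multiples of the same power of \<open>R\<close>, the mass by comparison
  with the constant solution. So it suffices to compare the two coefficients, and concentration for
  small radii does that.\<close>

lemma mean_value_property:
  assumes U: "weakly_harmonic U" and c: "\<forall>j\<in>set ks. \<bar>c j\<bar> < 1" "trunc c = c" and R: "0 < R" "R < 1"
  shows "cube_int (\<lambda>z. U z * bump 3 R c z) = U c * cube_int (bump 3 R c)"
proof -
  obtain C where C: "\<And>R. 0 < R \<Longrightarrow> R < 1 \<Longrightarrow> cube_int (\<lambda>z. U z * bump 3 R c z) = C * R ^ (length ks + 6)"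
    using weakly_harmonic_scaling[OF U c(1)] by blast
  obtain C1 where C1: "\<And>R. 0 < R \<Longrightarrow> R < 1 \<Longrightarrow> cube_int (bump 3 R c) = C1 * R ^ (length ks + 6)"
    using weakly_harmonic_scaling[OF weakly_harmonic_const c(1)] by auto
  have cU: "continuous_on cube U" using U by (simp add: weakly_harmonic_def)
  have le: "\<bar>C - U c * C1\<bar> \<le> e * C1" if e: "e > 0" for e
  proof -
    obtain \<delta> where \<delta>: "\<delta> > 0" "\<And>R. 0 < R \<Longrightarrow> R < \<delta> \<Longrightarrow>
     \<bar>cube_int (\<lambda>z. U z * bump 3 R c z) - U c * cube_int (bump 3 R c)\<bar> \<le> e * cube_int (bump 3 R c)"
      using bump_concentration[OF cU c e, of 3] by auto
    define R where "R = min (\<delta> / 2) (1 / 2)"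
    have R: "0 < R" "R < \<delta>" "R < 1" using \<delta>(1) by (auto simp: R_def)
    define P where "P = R ^ (length ks + 6)"
    have P: "P > 0" using R by (simp add: P_def)
    have "\<bar>(C - U c * C1) * P\<bar> \<le> e * C1 * P"
      using \<delta>(2)[OF R(1,2)] unfolding C[OF R(1,3)] C1[OF R(1,3)] P_def[symmetric] by (simp add: algebra_simps)
    then show ?thesis using P by (simp add: abs_mult)
  qed
  have "C = U c * C1"
  proof (rule ccontr)
    assume "C \<noteq> U c * C1"
    then have a: "\<bar>C - U c * C1\<bar> > 0" by simp
    have C1: "C1 \<ge> 0" using le[of 1] by linarith
    \<comment> \<open>Then the left side of \<open>le\<close> equals \<open>e * (C1 + 1)\<close>,
      which exceeds \<open>e * C1\<close> even if \<open>C1\<close> is 0.\<close>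
    define e where "e = \<bar>C - U c * C1\<bar> / (C1 + 1)"
    have "e > 0" using a C1 by (simp add: e_def)
    from le[OF this] have "e * (C1 + 1) \<le> e * C1" using C1 by (simp add: e_def)
    then show False using \<open>e > 0\<close> by simp
  qed
  then show ?thesis using C[OF R] C1[OF R] by simp
qed

section \<open>Interior derivative estimates\<close>

definition bump_mass :: real where "bump_mass = cube_int (bump 3 (1/2) (\<lambda>_. 0))"

lemma bump_mass_pos: "bump_mass > 0"
  unfolding bump_mass_def by (rule cube_int_pos[OF continuous_on_bump_fun bump_nonneg]) (simp add: bump_def sq_def)

text \<open>Translation invariance without substitution: the derivative of the bump in its centre is
  minus its derivative in the point, and the integral of the latter vanishes.\<close>

lemma bump_mass_shift:
  assumes "j \<in> set ks" "\<bar>h\<bar> < 1"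
  shows "cube_int (bump 3 (1/2) ((\<lambda>_. 0)(j := h))) = bump_mass"
proof -
  let ?c = "\<lambda>h. (\<lambda>_. 0::real)(j := h)"
  have "\<exists>C. \<forall>h\<in>{-1<..<1}. cube_int (bump 3 (1/2) (?c h)) = C"
  proof (rule has_field_derivative_zero_constant)
    fix h :: real assume h: "h \<in> {-1<..<1}"
    have c: "\<forall>i\<in>set ks. \<bar>?c h i\<bar> < 1" using h by auto
    have "((\<lambda>h. cube_int (bump 3 (1/2) (?c h))) has_real_derivative
        cube_int (\<lambda>z. 6 * (z j - h) * bump 2 (1/2) (?c h) z)) (at h within {-1<..<1})"
    proof (rule has_real_derivative_cube_int)
      show "continuous_on ({-1<..<1} \<times> cube) (\<lambda>(h, z). 6 * (z j - h) * bump 2 (1/2) (?c h) z)"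
        unfolding case_prod_beta
        by (intro continuous_on_mult continuous_on_diff continuous_on_bump continuous_on_fun_upd continuous_on_const
            continuous_on_fst continuous_on_snd continuous_on_id continuous_on_product_then_coordinatewise[where f = snd])
      show "((\<lambda>h. bump 3 (1/2) (?c h) z) has_real_derivative 6 * (z j - h) * bump 2 (1/2) (?c h) z) (at h within {-1<..<1})" for h z
        using has_real_derivative_bump_center[OF assms(1), of 1 "1/2" "\<lambda>_. 0" z h "{-1<..<1}"] by (simp add: numeral_eq_Suc)
    qed (use h in \<open>auto intro: continuous_on_bump_fun\<close>)
    moreover have "cube_int (\<lambda>z. - 6 * (z j - h) * bump 2 (1/2) (?c h) z) = 0"
    proof (rule cube_int_derivative_eq_0[OF assms(1)])
      show "continuous_on cube (\<lambda>z. - 6 * (z j - h) * bump 2 (1/2) (?c h) z)"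
        by (intro continuous_intros continuous_on_coord)
      show "((\<lambda>t. bump 3 (1/2) (?c h) (z(j := t))) has_real_derivative
          - 6 * ((z(j := t)) j - h) * bump 2 (1/2) (?c h) (z(j := t))) (at t within {-2..2})" for z t
        using has_real_derivative_bump_point[OF assms(1), of 1 "1/2" "?c h" z t "{-2..2}"] by (simp add: numeral_eq_Suc)
      show "bump 3 (1/2) (?c h) z = 0" if "\<bar>z j\<bar> = 2" for z
        by (rule bump_boundary[where j = j]) (use h that assms(1) in auto)
    qed
    moreover have "cube_int (\<lambda>z. - 6 * (z j - h) * bump 2 (1/2) (?c h) z)
        = - cube_int (\<lambda>z. 6 * (z j - h) * bump 2 (1/2) (?c h) z)"
      using cube_int_cmult[of "-1" "\<lambda>z. 6 * (z j - h) * bump 2 (1/2) (?c h) z"]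
      by (simp only: mult_minus1 mult_minus_left mult_1)
    ultimately show "((\<lambda>h. cube_int (bump 3 (1/2) (?c h))) has_real_derivative 0) (at h within {-1<..<1})" by simp
  qed simp
  then obtain C where C: "\<And>h. h \<in> {-1<..<1} \<Longrightarrow> cube_int (bump 3 (1/2) (?c h)) = C" by blast
  have "?c 0 = (\<lambda>_. 0)" by auto
  then have "bump_mass = C" using C[of 0] unfolding bump_mass_def by simp
  then show ?thesis using C[of h] assms(2) by (simp add: abs_less_iff)
qed

text \<open>By the mean value property a value of \<open>U\<close> on the axis is an average against
  a bump centred there. The position enters this average only through the C^1 kernel, so no
  regularity of \<open>U\<close> beyond continuity is used.\<close>

lemma weakly_harmonic_has_derivative:
  assumes U: "weakly_harmonic U" and j: "j \<in> set ks"
  shows "((\<lambda>h. U ((\<lambda>_. 0)(j := h))) has_real_derivative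
     cube_int (\<lambda>z. U z * (6 * z j * bump 2 (1/2) (\<lambda>_. 0) z)) / bump_mass) (at 0)"
proof -
  let ?c = "\<lambda>h. (\<lambda>_. 0::real)(j := h)"
  have c0: "?c 0 = (\<lambda>_. 0)" by auto
  have cU: "continuous_on cube U" using U by (simp add: weakly_harmonic_def)
  have "((\<lambda>h. cube_int (\<lambda>z. U z * bump 3 (1/2) (?c h) z)) has_real_derivative
        cube_int (\<lambda>z. U z * (6 * (z j - 0) * bump 2 (1/2) (?c 0) z))) (at 0 within {-1<..<1})"
  proof (rule has_real_derivative_cube_int[where G' = "\<lambda>h z. U z * (6 * (z j - h) * bump 2 (1/2) (?c h) z)" and h = 0])
    show "continuous_on cube (\<lambda>z. U z * bump 3 (1/2) (?c h) z)" for h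
      by (intro continuous_on_mult cU continuous_on_bump_fun)
    have "continuous_on ({-1<..<1} \<times> cube) (\<lambda>p. U (snd p))"
      by (rule continuous_on_compose2[OF cU]) (auto intro: continuous_on_snd continuous_on_id)
    then show "continuous_on ({-1<..<1} \<times> cube) (\<lambda>(h, z). U z * (6 * (z j - h) * bump 2 (1/2) (?c h) z))"
      unfolding case_prod_beta
      by (intro continuous_on_mult continuous_on_diff continuous_on_bump continuous_on_fun_upd continuous_on_const
          continuous_on_fst continuous_on_snd continuous_on_id continuous_on_product_then_coordinatewise[where f = snd])
    show "((\<lambda>h. U z * bump 3 (1/2) (?c h) z) has_real_derivative U z * (6 * (z j - h) * bump 2 (1/2) (?c h) z)) (at h within {-1<..<1})" for h z
      using DERIV_cmult[OF has_real_derivative_bump_center[OF j, of 1 "1/2" "\<lambda>_. 0" z h "{-1<..<1}"], of "U z"]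
      by (simp add: numeral_eq_Suc)
  qed auto
  then have "((\<lambda>h. cube_int (\<lambda>z. U z * bump 3 (1/2) (?c h) z) / bump_mass) has_real_derivative
        cube_int (\<lambda>z. U z * (6 * (z j - 0) * bump 2 (1/2) (?c 0) z)) / bump_mass) (at 0)"
    by (intro DERIV_cdivide) (simp add: at_within_open[of 0 "{-1<..<1::real}"])
  then have "((\<lambda>h. U (?c h)) has_real_derivative
        cube_int (\<lambda>z. U z * (6 * (z j - 0) * bump 2 (1/2) (?c 0) z)) / bump_mass) (at 0)"
  proof (rule has_field_derivative_transform_within_open[where S = "{-1<..<1}"])
    fix h :: real assume h: "h \<in> {-1<..<1}"
    have "cube_int (\<lambda>z. U z * bump 3 (1/2) (?c h) z) = U (?c h) * cube_int (bump 3 (1/2) (?c h))"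
      by (rule mean_value_property[OF U]) (use h j in \<open>auto simp: trunc_def fun_eq_iff\<close>)
    also have "\<dots> = U (?c h) * bump_mass"
      using bump_mass_shift[OF j, of h] h by (simp add: abs_less_iff)
    finally show "cube_int (\<lambda>z. U z * bump 3 (1/2) (?c h) z) / bump_mass = U (?c h)"
      using bump_mass_pos by simp
  qed auto
  then show ?thesis unfolding c0 by simp
qed

lemma weakly_harmonic_derivative_bound:
  assumes U: "weakly_harmonic U" and j: "j \<in> set ks" and B: "\<And>z. z \<in> cube \<Longrightarrow> \<bar>U z\<bar> \<le> B"
  shows "\<bar>cube_int (\<lambda>z. U z * (6 * z j * bump 2 (1/2) (\<lambda>_. 0) z)) / bump_mass\<bar> \<le> 12 * 4 ^ length ks / bump_mass * B"
proof -
  have cU: "continuous_on cube U" using U by (simp add: weakly_harmonic_def)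
  have B0: "B \<ge> 0" using B[OF zero_in_cube] by linarith
  \<comment> \<open>On the cube the linear factor is at most 12 and \<open>bump 2\<close> at most 1;
    the power of 4 is the volume of the cube.\<close>
  have "\<bar>cube_int (\<lambda>z. U z * (6 * z j * bump 2 (1/2) (\<lambda>_. 0) z))\<bar> \<le> (B * 12) * 4 ^ length ks"
  proof (rule cube_int_abs_le)
    show "continuous_on cube (\<lambda>z. U z * (6 * z j * bump 2 (1/2) (\<lambda>_. 0) z))"
      by (intro continuous_on_mult cU continuous_on_const continuous_on_coord continuous_on_bump_fun)
    fix z assume z: "z \<in> cube"
    have "sq (1/2) (\<lambda>_. 0) z \<le> 1"
      using sum_nonneg[of "set ks" "\<lambda>j. (z j - 0)\<^sup>2"] by (simp add: sq_def power2_eq_square)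
    then have b: "bump 2 (1/2) (\<lambda>_. 0) z \<le> 1" unfolding bump_def by (intro power_le_one) auto
    have "\<bar>6 * z j\<bar> \<le> 12" using z j by (auto simp: cube_def)
    then have "\<bar>6 * z j\<bar> * \<bar>bump 2 (1/2) (\<lambda>_. 0) z\<bar> \<le> 12 * 1"
      by (intro mult_mono) (use b bump_nonneg[of 2 "1/2" "\<lambda>_. 0" z] in auto)
    then have "\<bar>U z\<bar> * \<bar>6 * z j * bump 2 (1/2) (\<lambda>_. 0) z\<bar> \<le> B * 12"
      by (intro mult_mono B[OF z]) (use B0 in \<open>auto simp: abs_mult\<close>)
    then show "\<bar>U z * (6 * z j * bump 2 (1/2) (\<lambda>_. 0) z)\<bar> \<le> B * 12" by (simp add: abs_mult)
  qed
  from divide_right_mono[OF this less_imp_le[OF bump_mass_pos]]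
  have "\<bar>cube_int (\<lambda>z. U z * (6 * z j * bump 2 (1/2) (\<lambda>_. 0) z)) / bump_mass\<bar> \<le> B * 12 * 4 ^ length ks / bump_mass"
    using bump_mass_pos by (simp only: abs_divide abs_of_pos)
  also have "\<dots> = 12 * 4 ^ length ks / bump_mass * B" by (simp only: times_divide_eq_left times_divide_eq_right mult_ac)
  finally show ?thesis .
qed

end

section \<open>Harmonic functions on a domain\<close>

context coord_cube
begin

definition shift :: "('k \<Rightarrow> real) \<Rightarrow> real \<Rightarrow> ('k \<Rightarrow> real) \<Rightarrow> 'k \<Rightarrow> real" where
  "shift x r z = (\<lambda>j. x j + r * z j)"

definition pd :: "'k \<Rightarrow> (('k \<Rightarrow> real) \<Rightarrow> real) \<Rightarrow> ('k \<Rightarrow> real) \<Rightarrow> real" where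
  "pd j u x = deriv (\<lambda>t. u (x(j := t))) (x j)"

lemma shift_zero: "shift x r (\<lambda>_. 0) = x"
  by (simp add: shift_def)

lemma shift_upd: "shift (x(j := t)) r z = (shift x r z)(j := t + r * z j)"
  by (auto simp: shift_def fun_eq_iff)

lemma shift_upd_point: "shift x r (z(j := t)) = (shift x r z)(j := x j + r * t)"
  by (auto simp: shift_def fun_eq_iff)

lemma continuous_on_shift:
  assumes "continuous_on S x" "continuous_on S z"
  shows "continuous_on S (\<lambda>p. shift (x p) r (z p))"
  unfolding shift_def
  by (intro continuous_on_coordinatewise_then_product continuous_intros
        continuous_on_product_then_coordinatewise[OF assms(1)] continuous_on_product_then_coordinatewise[OF assms(2)])

end

text \<open>Since the cube leaves the coordinates outside \<open>ks\<close> free,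
  \<open>room\<close> makes \<open>D\<close> a cylinder over an open set in the coordinates of
  \<open>ks\<close>.\<close>

locale coord_domain = coord_cube ks for ks :: "'k list" +
  fixes D :: "('k \<Rightarrow> real) set"
  assumes room: "x \<in> D \<Longrightarrow> \<exists>r>0. \<forall>z\<in>cube. shift x r z \<in> D"
begin

definition fits :: "('k \<Rightarrow> real) \<Rightarrow> real \<Rightarrow> bool" where
  "fits x r \<longleftrightarrow> (\<forall>z\<in>cube. shift x r z \<in> D)"

lemma fits_near:
  assumes "fits x r'" "r' > 0" "\<And>j. j \<in> set ks \<Longrightarrow> \<bar>y j - x j\<bar> + 2 * r \<le> 2 * r'" "r > 0"
  shows "fits y r"
  unfolding fits_def
proof
  fix z assume z: "z \<in> cube"
  define w where "w = (\<lambda>j. (y j - x j + r * z j) / r')"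
  have "w \<in> cube"
    unfolding cube_def
  proof (intro CollectI ballI)
    fix j assume j: "j \<in> set ks"
    have "\<bar>z j\<bar> \<le> 2" using z j by (auto simp: cube_def)
    then have "\<bar>r * z j\<bar> \<le> 2 * r" using \<open>r > 0\<close> by (simp add: abs_mult)
    then have "\<bar>y j - x j + r * z j\<bar> \<le> 2 * r'" using assms(3)[OF j] by linarith
    then have "\<bar>w j\<bar> \<le> 2" using \<open>r' > 0\<close> by (simp add: w_def abs_divide field_simps)
    then show "w j \<in> {-2..2}" by auto
  qed
  moreover have "shift x r' w = shift y r z" using \<open>r' > 0\<close> by (auto simp: shift_def w_def fun_eq_iff)
  ultimately show "shift y r z \<in> D" using assms(1) by (metis fits_def)
qed

lemma fits_mono: "fits x r' \<Longrightarrow> 0 < r \<Longrightarrow> r \<le> r' \<Longrightarrow> fits x r"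
  by (rule fits_near[of x r']) auto

lemma fits_center: "fits x r \<Longrightarrow> x \<in> D"
  using zero_in_cube shift_zero unfolding fits_def by metis

text \<open>The strict inequality between \<open>r\<close> and \<open>r'\<close> leaves space to
  translate the box, which is what allows differentiating the weak equation with respect to the base
  point.\<close>

definition harmonic_class :: "(('k \<Rightarrow> real) \<Rightarrow> real) \<Rightarrow> bool" where
  "harmonic_class u \<longleftrightarrow> continuous_on D u \<and>
     (\<forall>x r r'. 0 < r \<longrightarrow> r < r' \<longrightarrow> fits x r' \<longrightarrow> weakly_harmonic (\<lambda>z. u (shift x r z)))"

lemma harmonic_classD:
  "harmonic_class u \<Longrightarrow> 0 < r \<Longrightarrow> r < r' \<Longrightarrow> fits x r' \<Longrightarrow> weakly_harmonic (\<lambda>z. u (shift x r z))"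
  by (auto simp: harmonic_class_def)

lemma harmonic_class_continuous: "harmonic_class u \<Longrightarrow> continuous_on D u"
  by (simp add: harmonic_class_def)

lemma continuous_on_cube_shift:
  assumes "continuous_on D u" "fits x r"
  shows "continuous_on cube (\<lambda>z. u (shift x r z))"
  by (rule continuous_on_compose2[OF assms(1) continuous_on_shift])
     (use assms(2) in \<open>auto simp: fits_def intro: continuous_on_const continuous_on_id\<close>)

section \<open>Derivatives of functions in the class\<close>

lemma pd_kernel:
  assumes u: "harmonic_class u" and j: "j \<in> set ks" and r: "0 < r" "r < r'" "fits x r'"
  shows "((\<lambda>t. u (x(j := t))) has_real_derivative
      cube_int (\<lambda>z. u (shift x r z) * (6 * z j * bump 2 (1/2) (\<lambda>_. 0) z)) / bump_mass / r) (at (x j))"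
    (is "(_ has_real_derivative ?A / r) _")
proof -
  have "((\<lambda>h. u (shift x r ((\<lambda>_. 0)(j := h)))) has_real_derivative ?A) (at 0)"
    by (rule weakly_harmonic_has_derivative[OF harmonic_classD[OF u r] j])
  moreover have "shift x r ((\<lambda>_. 0)(j := h)) = x(j := x j + r * h)" for h
    unfolding shift_upd_point shift_zero ..
  ultimately have "((\<lambda>h. u (x(j := x j + r * h))) has_real_derivative ?A) (at ((x j - x j) / r))" by simp
  moreover have "((\<lambda>t. (t - x j) / r) has_real_derivative 1 / r) (at (x j))"
    using r by (auto intro!: derivative_eq_intros)
  ultimately have "((\<lambda>t. u (x(j := x j + r * ((t - x j) / r)))) has_real_derivative ?A * (1 / r)) (at (x j))"
    by (rule DERIV_chain2)
  moreover have "x j + r * ((t - x j) / r) = t" for t using r by simp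
  ultimately show ?thesis by simp
qed

lemma pd_eq:
  assumes "harmonic_class u" "j \<in> set ks" "0 < r" "r < r'" "fits x r'"
  shows "pd j u x = cube_int (\<lambda>z. u (shift x r z) * (6 * z j * bump 2 (1/2) (\<lambda>_. 0) z)) / bump_mass / r"
  unfolding pd_def by (rule DERIV_imp_deriv[OF pd_kernel[OF assms]])

lemma has_real_derivative_pd:
  assumes "harmonic_class u" "j \<in> set ks" "x(j := t) \<in> D"
  shows "((\<lambda>t. u (x(j := t))) has_real_derivative pd j u (x(j := t))) (at t)"
proof -
  obtain R where R: "R > 0" "fits (x(j := t)) R" using room[OF assms(3)] by (auto simp: fits_def)
  have "((\<lambda>s. u ((x(j := t))(j := s))) has_real_derivative pd j u (x(j := t))) (at ((x(j := t)) j))"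
    using pd_kernel[OF assms(1,2) _ _ R(2), of "R / 2"] pd_eq[OF assms(1,2) _ _ R(2), of "R / 2"] R(1) by simp
  then show ?thesis by simp
qed

text \<open>The interior gradient estimate: the constant is independent of \<open>u\<close>, of
  \<open>x\<close> and of the scale, so it can be iterated.\<close>

lemma pd_bound:
  assumes u: "harmonic_class u" and j: "j \<in> set ks" and r: "0 < r" "r < r'" "fits x r'"
    and B: "\<And>z. z \<in> cube \<Longrightarrow> \<bar>u (shift x r z)\<bar> \<le> B"
  shows "\<bar>pd j u x\<bar> \<le> 12 * 4 ^ length ks / bump_mass / r * B"
proof -
  have "\<bar>pd j u x\<bar> = \<bar>cube_int (\<lambda>z. u (shift x r z) * (6 * z j * bump 2 (1/2) (\<lambda>_. 0) z)) / bump_mass\<bar> / r"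
    unfolding pd_eq[OF u j r] abs_divide[of _ r] using r(1) by simp
  also have "\<dots> \<le> 12 * 4 ^ length ks / bump_mass * B / r"
    by (intro divide_right_mono weakly_harmonic_derivative_bound[OF harmonic_classD[OF u r] j B]) (use r(1) in auto)
  finally show ?thesis by simp
qed

text \<open>The kernel formula holds with one and the same scale for all points near
  \<open>x0\<close>, so the derivative is locally an integral depending continuously on a parameter.
  The neighbourhood restricts finitely many coordinates and is therefore open in the product
  topology.\<close>

lemma continuous_on_pd:
  assumes u: "harmonic_class u" and j: "j \<in> set ks"
  shows "continuous_on D (pd j u)"
proof -
  have "\<exists>N. open N \<and> x0 \<in> N \<and> continuous_on N (pd j u)" if "x0 \<in> D" for x0
  proof -
    from that obtain R where R: "R > 0" "fits x0 R" using room by (auto simp: fits_def)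
  define N where "N = (\<Inter>i\<in>set ks. {x. \<bar>x i - x0 i\<bar> < R})"
  have oN: "open N" unfolding N_def
    by (intro open_INT ballI open_Collect_less continuous_intros) auto
  have x0N: "x0 \<in> N" using R by (simp add: N_def)
  have fitN: "fits x (R / 2)" if "x \<in> N" for x
    by (rule fits_near[OF R(2,1)]) (use that R(1) in \<open>auto simp: N_def less_imp_le\<close>)
  have fitN4: "fits x (R / 4)" if "x \<in> N" for x
    by (rule fits_mono[OF fitN[OF that]]) (use R(1) in auto)
  have c: "continuous_on (N \<times> cube) (\<lambda>p. u (shift (fst p) (R / 4) (snd p)))"
    by (rule continuous_on_compose2[OF harmonic_class_continuous[OF u] continuous_on_shift])
       (use fitN4 in \<open>auto simp: fits_def intro: continuous_on_fst continuous_on_snd continuous_on_id\<close>)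
  have "continuous_on (N \<times> cube) (\<lambda>(x, z). u (shift x (R / 4) z) * (6 * z j * bump 2 (1/2) (\<lambda>_. 0) z))"
    unfolding case_prod_beta
    by (intro continuous_on_mult c continuous_on_const continuous_on_bump continuous_on_snd continuous_on_id
          continuous_on_product_then_coordinatewise[where f = snd])
  from continuous_on_param_cube_int[OF this]
  have "continuous_on N (\<lambda>x. cube_int (\<lambda>z. u (shift x (R / 4) z) * (6 * z j * bump 2 (1/2) (\<lambda>_. 0) z)) / bump_mass / (R / 4))"
    by (intro continuous_on_divide continuous_on_const) (use bump_mass_pos R in auto)
  moreover have "pd j u x = cube_int (\<lambda>z. u (shift x (R / 4) z) * (6 * z j * bump 2 (1/2) (\<lambda>_. 0) z)) / bump_mass / (R / 4)"
    if "x \<in> N" for x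
    by (rule pd_eq[OF u j _ _ fitN[OF that]]) (use R in auto)
  ultimately have "continuous_on N (pd j u)" by (simp cong: continuous_on_cong)
    with oN x0N show ?thesis by blast
  qed
  then obtain N where N: "\<And>x. x \<in> D \<Longrightarrow> open (N x) \<and> x \<in> N x \<and> continuous_on (N x) (pd j u)" by metis
  then have "continuous_on (\<Union>x\<in>D. N x) (pd j u)" by (intro continuous_on_open_UN) auto
  then show ?thesis by (rule continuous_on_subset) (use N in auto)
qed

text \<open>The weak equation holds for all small translates of the box along \<open>j\<close>;
  differentiating it in the translation puts \<open>pd j u\<close> in the place of
  \<open>u\<close>.\<close>

lemma harmonic_class_pd:
  assumes u: "harmonic_class u" and j: "j \<in> set ks"
  shows "harmonic_class (pd j u)"
  unfolding harmonic_class_def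
proof (intro conjI allI impI)
  show cpd: "continuous_on D (pd j u)" by (rule continuous_on_pd[OF u j])
  fix x r r' assume r: "0 < r" "r < r'" "fits x r'"
  define xh where "xh h = x(j := x j + h)" for h
  define S where "S = {- (r' - r)<..<r' - r}"
  have xh0: "xh 0 = x" by (simp add: xh_def)
  have fit: "fits (xh h) ((r + r') / 2)" if "h \<in> S" for h
    by (rule fits_near[OF r(3)]) (use that r in \<open>auto simp: xh_def S_def field_simps\<close>)
  have fitr: "fits (xh h) r" if "h \<in> S" for h
    by (rule fits_mono[OF fit[OF that]]) (use r in auto)
  have S0: "0 \<in> S" using r by (simp add: S_def)
  show "weakly_harmonic (\<lambda>z. pd j u (shift x r z))"
    unfolding weakly_harmonic_def
  proof (intro conjI allI impI)
    show "continuous_on cube (\<lambda>z. pd j u (shift x r z))"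
      by (rule continuous_on_cube_shift[OF cpd]) (use fitr[OF S0] xh0 in simp)
    fix \<rho> :: real and c :: "'k \<Rightarrow> real"
    assume \<rho>: "0 < \<rho>" "\<rho> < 1" and c: "\<forall>j\<in>set ks. \<bar>c j\<bar> < 1"
    have zero: "cube_int (\<lambda>z. u (shift (xh h) r z) * bump_lap \<rho> c z) = 0" if "h \<in> S" for h
      using harmonic_classD[OF u r(1) _ fit[OF that]] r \<rho> c by (auto simp: weakly_harmonic_def)
    have "((\<lambda>h. cube_int (\<lambda>z. u (shift (xh h) r z) * bump_lap \<rho> c z)) has_real_derivative
        cube_int (\<lambda>z. pd j u (shift (xh 0) r z) * bump_lap \<rho> c z)) (at 0 within S)"
    proof (rule has_real_derivative_cube_int[where G' = "\<lambda>h z. pd j u (shift (xh h) r z) * bump_lap \<rho> c z" and h = 0])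
      show "convex S" unfolding S_def by simp
      show "continuous_on cube (\<lambda>z. u (shift (xh h) r z) * bump_lap \<rho> c z)" if "h \<in> S" for h
        by (intro continuous_on_mult continuous_on_bump_lap_fun continuous_on_cube_shift[OF harmonic_class_continuous[OF u] fitr[OF that]])
      have "continuous_on (S \<times> cube) (\<lambda>p. pd j u (shift (xh (fst p)) r (snd p)))"
      proof (rule continuous_on_compose2[OF cpd continuous_on_shift])
        show "continuous_on (S \<times> cube) (\<lambda>p. xh (fst p))"
          unfolding xh_def by (intro continuous_on_fun_upd continuous_intros)
      qed (use fitr in \<open>auto simp: fits_def intro: continuous_on_snd continuous_on_id\<close>)
      then show "continuous_on (S \<times> cube) (\<lambda>(h, z). pd j u (shift (xh h) r z) * bump_lap \<rho> c z)"
        unfolding case_prod_beta by (intro continuous_on_mult continuous_on_bump_lap continuous_on_const continuous_on_snd continuous_on_id)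
      show "((\<lambda>h. u (shift (xh h) r z) * bump_lap \<rho> c z) has_real_derivative pd j u (shift (xh h) r z) * bump_lap \<rho> c z) (at h within S)"
        if h: "h \<in> S" and z: "z \<in> cube" for h z
      proof -
        define w where "w = shift x r z"
        have w: "shift (xh h) r z = w(j := w j + h)" for h
          unfolding xh_def w_def shift_upd by (simp add: shift_def algebra_simps)
        have "w(j := w j + h) \<in> D" using fitr[OF h] z w[of h] by (auto simp: fits_def)
        from has_real_derivative_pd[OF u j this]
        have "((\<lambda>t. u (w(j := t))) has_real_derivative pd j u (w(j := w j + h))) (at (w j + h))" .
        then have "((\<lambda>h. u (w(j := w j + h))) has_real_derivative pd j u (w(j := w j + h))) (at h)"
          using DERIV_shift[of "\<lambda>t. u (w(j := t))" "pd j u (w(j := w j + h))" h "w j"]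
          by (simp only: add.commute)
        then have "((\<lambda>h. u (shift (xh h) r z)) has_real_derivative pd j u (shift (xh h) r z)) (at h)"
          unfolding w .
        from DERIV_cmult_right[OF has_field_derivative_at_within[OF this]] show ?thesis .
      qed
    qed (rule S0)
    moreover have e: "at 0 within S = at 0" by (rule at_within_open[OF S0]) (simp add: S_def)
    ultimately have "((\<lambda>h. cube_int (\<lambda>z. u (shift (xh h) r z) * bump_lap \<rho> c z)) has_real_derivative
        cube_int (\<lambda>z. pd j u (shift x r z) * bump_lap \<rho> c z)) (at 0)"
      by (simp only: e xh0)
    moreover have "((\<lambda>h. cube_int (\<lambda>z. u (shift (xh h) r z) * bump_lap \<rho> c z)) has_real_derivative 0) (at 0)"
      by (rule has_field_derivative_transform_within_open[where S = S and f = "\<lambda>h. 0"])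
         (use S0 zero in \<open>auto simp: S_def\<close>)
    ultimately show "cube_int (\<lambda>z. pd j u (shift x r z) * bump_lap \<rho> c z) = 0"
      by (rule DERIV_unique)
  qed
qed

text \<open>The derivative of the product with \<phi> along \<open>j\<close> has integral zero; the
  factor \<open>r\<close> comes from the chain rule for \<open>shift\<close>.\<close>

lemma integral_by_parts_pd:
  assumes u: "harmonic_class u" and j: "j \<in> set ks" and fit: "fits x r"
    and c\<phi>: "continuous_on cube \<phi>" "continuous_on cube \<phi>'"
    and \<phi>: "\<And>z t. ((\<lambda>t. \<phi> (z(j := t))) has_real_derivative \<phi>' (z(j := t))) (at t within {-2..2})"
    and bd: "\<And>z. z \<in> cube \<Longrightarrow> \<bar>z j\<bar> = 2 \<Longrightarrow> \<phi> z = 0"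
  shows "r * cube_int (\<lambda>z. pd j u (shift x r z) * \<phi> z) = - cube_int (\<lambda>z. u (shift x r z) * \<phi>' z)"
proof -
  have cu: "continuous_on cube (\<lambda>z. u (shift x r z))" and cpd: "continuous_on cube (\<lambda>z. pd j u (shift x r z))"
    by (rule continuous_on_cube_shift[OF _ fit], rule harmonic_class_continuous[OF u] continuous_on_pd[OF u j])+
  have "cube_int (\<lambda>z. r * (pd j u (shift x r z) * \<phi> z) + u (shift x r z) * \<phi>' z) = 0"
  proof (rule cube_int_derivative_eq_0[OF j, where F = "\<lambda>z. u (shift x r z) * \<phi> z"])
    show "continuous_on cube (\<lambda>z. r * (pd j u (shift x r z) * \<phi> z) + u (shift x r z) * \<phi>' z)"
      by (intro continuous_on_add continuous_on_mult continuous_on_const cu cpd c\<phi>)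
    fix z t assume z: "z \<in> cube" and t: "t \<in> {-2..2::real}"
    define w where "w = shift x r z"
    have w: "shift x r (z(j := t)) = w(j := x j + r * t)" for t unfolding w_def by (rule shift_upd_point)
    have "w(j := x j + r * t) \<in> D" using fit cube_upd[OF z t, of j] w[of t] by (metis fits_def)
    from has_real_derivative_pd[OF u j this]
    have "((\<lambda>t. u (w(j := x j + r * t))) has_real_derivative pd j u (w(j := x j + r * t)) * r) (at t within {-2..2})"
      by (rule DERIV_chain2) (auto intro!: derivative_eq_intros)
    from DERIV_mult[OF this \<phi>[of z t]]
    show "((\<lambda>t. u (shift x r (z(j := t))) * \<phi> (z(j := t))) has_real_derivative
       r * (pd j u (shift x r (z(j := t))) * \<phi> (z(j := t))) + u (shift x r (z(j := t))) * \<phi>' (z(j := t))) (at t within {-2..2})"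
      unfolding w by (simp only: mult_ac add.commute)
  qed (use bd in auto)
  moreover have "cube_int (\<lambda>z. r * (pd j u (shift x r z) * \<phi> z) + u (shift x r z) * \<phi>' z)
     = r * cube_int (\<lambda>z. pd j u (shift x r z) * \<phi> z) + cube_int (\<lambda>z. u (shift x r z) * \<phi>' z)"
    unfolding cube_int_cmult[symmetric]
    by (intro cube_int_add continuous_on_mult continuous_on_const cu cpd c\<phi>)
  ultimately show ?thesis by simp
qed

text \<open>Once the second derivatives are known to be continuous, two integrations by parts lead
  back to the weak equation: the Laplacian is orthogonal to all small bumps around \<open>x\<close>,
  and concentration forces its value at \<open>x\<close> to vanish.\<close>

lemma laplace_eq_0:
  assumes u: "harmonic_class u" and x: "x \<in> D"
  shows "(\<Sum>j\<in>set ks. pd j (pd j u) x) = 0"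
proof -
  obtain R where R: "R > 0" "fits x R" using room[OF x] by (auto simp: fits_def)
  define r where "r = R / 2"
  have r: "0 < r" "r < R" "fits x r" using R fits_mono[OF R(2), of r] by (auto simp: r_def)
  define W where "W z = (\<Sum>j\<in>set ks. pd j (pd j u) (shift x r z))" for z
  let ?b = "\<lambda>n \<rho>. bump n \<rho> (\<lambda>_. 0)"
  have hc: "harmonic_class (pd j u)" if "j \<in> set ks" for j by (rule harmonic_class_pd[OF u that])
  have cW: "continuous_on cube (\<lambda>z. pd j (pd j u) (shift x r z))" if "j \<in> set ks" for j
    by (rule continuous_on_cube_shift[OF continuous_on_pd[OF hc[OF that] that] r(3)])
  have zero: "cube_int (\<lambda>z. W z * ?b 4 \<rho> z) = 0" if \<rho>: "0 < \<rho>" "\<rho> < 1" for \<rho>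
  proof -
    have two: "r\<^sup>2 * cube_int (\<lambda>z. pd j (pd j u) (shift x r z) * ?b 4 \<rho> z)
        = cube_int (\<lambda>z. u (shift x r z) * bump_hess j j \<rho> (\<lambda>_. 0) z)" if j: "j \<in> set ks" for j
    proof -
      have "r * cube_int (\<lambda>z. pd j (pd j u) (shift x r z) * ?b 4 \<rho> z)
          = - cube_int (\<lambda>z. pd j u (shift x r z) * bump_grad j \<rho> (\<lambda>_. 0) z)"
      proof (rule integral_by_parts_pd[OF hc[OF j] j r(3) continuous_on_bump_fun continuous_on_bump_grad])
        show "((\<lambda>t. ?b 4 \<rho> (z(j := t))) has_real_derivative bump_grad j \<rho> (\<lambda>_. 0) (z(j := t))) (at t within {-2..2})" for z t
          using has_real_derivative_bump_point[OF j, of 2 \<rho> "\<lambda>_. 0" z t "{-2..2}"] by (simp add: bump_grad_def numeral_eq_Suc)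
        show "?b 4 \<rho> z = 0" if "\<bar>z j\<bar> = 2" for z
          by (rule bump_boundary[where j = j]) (use \<rho> that j in auto)
      qed
      moreover have "r * cube_int (\<lambda>z. pd j u (shift x r z) * bump_grad j \<rho> (\<lambda>_. 0) z)
          = - cube_int (\<lambda>z. u (shift x r z) * bump_hess j j \<rho> (\<lambda>_. 0) z)"
      proof (rule integral_by_parts_pd[OF u j r(3) continuous_on_bump_grad continuous_on_bump_hess has_real_derivative_bump_grad[OF j]])
        show "bump_grad j \<rho> (\<lambda>_. 0) z = 0" if "\<bar>z j\<bar> = 2" for z
          by (rule bump_grad_boundary[where j = j]) (use \<rho> that j in auto)
      qed
      ultimately show ?thesis by (simp add: power2_eq_square mult.assoc)
    qed
    have cu: "continuous_on cube (\<lambda>z. u (shift x r z))"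
      by (rule continuous_on_cube_shift[OF harmonic_class_continuous[OF u] r(3)])
    have "r\<^sup>2 * cube_int (\<lambda>z. W z * ?b 4 \<rho> z)
        = r\<^sup>2 * cube_int (\<lambda>z. \<Sum>j\<in>set ks. pd j (pd j u) (shift x r z) * ?b 4 \<rho> z)"
      by (simp only: W_def sum_distrib_right)
    also have "\<dots> = (\<Sum>j\<in>set ks. r\<^sup>2 * cube_int (\<lambda>z. pd j (pd j u) (shift x r z) * ?b 4 \<rho> z))"
      by (subst cube_int_sum) (auto intro!: continuous_on_mult cW continuous_on_bump_fun simp: sum_distrib_left)
    also have "\<dots> = (\<Sum>j\<in>set ks. cube_int (\<lambda>z. u (shift x r z) * bump_hess j j \<rho> (\<lambda>_. 0) z))"
      by (rule sum.cong[OF refl two])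
    also have "\<dots> = cube_int (\<lambda>z. u (shift x r z) * bump_lap \<rho> (\<lambda>_. 0) z)"
      unfolding bump_lap_hess sum_distrib_left
      by (rule cube_int_sum[symmetric]) (auto intro!: continuous_on_mult cu continuous_on_bump_hess)
    also have "\<dots> = 0"
      using harmonic_classD[OF u r(1,2) R(2)] \<rho> by (simp add: weakly_harmonic_def)
    finally show ?thesis using r(1) by simp
  qed
  have cWs: "continuous_on cube W" unfolding W_def by (intro continuous_on_sum cW)
  have "\<bar>W (\<lambda>_. 0)\<bar> \<le> e" if e: "e > 0" for e
  proof -
    obtain \<delta> where \<delta>: "\<delta> > 0" "\<And>\<rho>. 0 < \<rho> \<Longrightarrow> \<rho> < \<delta> \<Longrightarrow>
       \<bar>cube_int (\<lambda>z. W z * ?b 4 \<rho> z) - W (\<lambda>_. 0) * cube_int (?b 4 \<rho>)\<bar> \<le> e * cube_int (?b 4 \<rho>)"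
      using bump_concentration[OF cWs _ trunc_zero e, of 4] by auto
    define \<rho> where "\<rho> = min (\<delta> / 2) (1 / 2)"
    have \<rho>: "0 < \<rho>" "\<rho> < \<delta>" "\<rho> < 1" using \<delta>(1) by (auto simp: \<rho>_def)
    have pos: "cube_int (?b 4 \<rho>) > 0"
      by (rule cube_int_pos[OF continuous_on_bump_fun bump_nonneg]) (use \<rho>(1) in \<open>simp add: bump_def sq_def\<close>)
    have "\<bar>W (\<lambda>_. 0)\<bar> * cube_int (?b 4 \<rho>) \<le> e * cube_int (?b 4 \<rho>)"
      using \<delta>(2)[OF \<rho>(1,2)] pos unfolding zero[OF \<rho>(1,3)] by (simp add: abs_mult)
    then show ?thesis using pos by simp
  qed
  then have "\<bar>W (\<lambda>_. 0)\<bar> \<le> 0" by (rule field_le_epsilon[of _ 0, simplified])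
  then show ?thesis by (simp add: W_def shift_zero)
qed

end

section \<open>Power series expansion\<close>

text \<open>The quotient of \<open>n ^ n\<close> by \<open>fact n\<close> is a single term of the
  exponential series at \<open>n\<close>.\<close>

lemma power_self_le_exp_fact: "real n ^ n \<le> exp 1 ^ n * fact n"
proof -
  have "sum (\<lambda>k. real n ^ k /\<^sub>R fact k) {n} \<le> (\<Sum>k. real n ^ k /\<^sub>R fact k)"
    by (rule sum_le_suminf[OF summable_exp_generic]) auto
  also have "\<dots> = exp (real n)" by (simp add: exp_def)
  also have "exp (real n) = exp 1 ^ n" using exp_of_nat_mult[of n "1::real"] by simp
  finally show ?thesis by (simp add: field_simps)
qed

lemma fact_add_le: "(fact (a + b) :: real) \<le> 2 ^ (a + b) * fact a * fact b"
proof -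
  have "(fact (a + b) :: real) = real ((a + b) choose a) * fact a * fact b"
    using binomial_fact[of a "a + b", where 'a = real] by simp
  also have "\<dots> \<le> 2 ^ (a + b) * fact a * fact b"
    using binomial_le_pow2[of "a + b" a] by (intro mult_right_mono) (simp_all flip: of_nat_power add: numeral_power_le_of_nat_cancel_iff)
  finally show ?thesis .
qed

text \<open>A crude bound for multinomial coefficients: splitting off one entry costs a binomial
  coefficient, hence a power of 2. The extra \<open>k\<close> collects the entries already split
  off.\<close>

lemma fact_multi_le:
  assumes "distinct l"
  shows "(fact (k + (\<Sum>j\<in>set l. m j)) :: real) \<le> fact k * (\<Prod>j\<in>set l. fact (m j)) * (2 ^ length l) ^ (k + (\<Sum>j\<in>set l. m j))"
  using assms
proof (induction l arbitrary: k)
  case (Cons i l)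
  define s where "s = (\<Sum>j\<in>set l. m j)"
  define P where "P = (\<Prod>j\<in>set l. fact (m j) :: real)"
  have P: "P > 0" unfolding P_def by (intro prod_pos) auto
  have "(fact (k + m i + s) :: real) \<le> fact (k + m i) * P * (2 ^ length l) ^ (k + m i + s)"
    using Cons.IH[of "k + m i"] Cons.prems unfolding s_def P_def by simp
  also have "\<dots> \<le> (2 ^ (k + m i + s) * fact k * fact (m i)) * P * (2 ^ length l) ^ (k + m i + s)"
  proof (intro mult_right_mono)
    have "(fact (k + m i) :: real) \<le> 2 ^ (k + m i) * fact k * fact (m i)" by (rule fact_add_le)
    also have "\<dots> \<le> 2 ^ (k + m i + s) * fact k * fact (m i)"
      by (intro mult_right_mono power_increasing) auto
    finally show "(fact (k + m i) :: real) \<le> 2 ^ (k + m i + s) * fact k * fact (m i)" .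
  qed (use P in auto)
  also have "\<dots> = fact k * (fact (m i) * P) * (2 ^ length (i # l)) ^ (k + m i + s)"
    by (simp add: power_mult_distrib mult_ac)
  finally show ?case using Cons.prems unfolding s_def P_def by (simp add: add.assoc)
qed simp

section \<open>Multi-indices and their geometric majorant\<close>

definition multi_indices :: "'k set \<Rightarrow> ('k \<Rightarrow> nat) set" where
  "multi_indices K = {m. \<forall>j. j \<notin> K \<longrightarrow> m j = 0}"

lemma multi_indices_empty: "multi_indices {} = {\<lambda>_. 0}"
  by (auto simp: multi_indices_def)

lemma bij_betw_multi_indices_insert:
  assumes "i \<notin> K"
  shows "bij_betw (\<lambda>(n, m). m(i := n)) (UNIV \<times> multi_indices K) (multi_indices (insert i K))"
proof (rule bij_betw_byWitness[where f' = "\<lambda>m. (m i, m(i := 0))"])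
  show "\<forall>a\<in>UNIV \<times> multi_indices K. (\<lambda>m. (m i, m(i := 0))) ((\<lambda>(n, m). m(i := n)) a) = a"
    using assms by (auto simp: multi_indices_def fun_eq_iff)
qed (auto simp: multi_indices_def)

text \<open>The sum factors into one geometric series per coordinate, so coordinates can be added
  one at a time.\<close>

lemma summable_on_multi_indices_geometric:
  assumes "finite K"
  shows "(\<lambda>m. \<Prod>j\<in>K. (1/2) ^ m j :: real) summable_on multi_indices K"
  using assms
proof (induction K rule: finite_induct)
  case empty
  show ?case by (simp add: multi_indices_empty)
next
  case (insert i K)
  obtain S where S: "((\<lambda>m. \<Prod>j\<in>K. (1/2) ^ m j :: real) has_sum S) (multi_indices K)"
    using insert.IH by (auto simp: summable_on_def)
  have "(\<lambda>(n, m). (1/2) ^ n * (\<Prod>j\<in>K. (1/2) ^ m j) :: real) summable_on (UNIV \<times> multi_indices K)"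
  proof (rule summable_on_SigmaI)
    show "((\<lambda>m. (\<lambda>(n, m). (1/2) ^ n * (\<Prod>j\<in>K. (1/2) ^ m j)) (n, m)) has_sum (1/2) ^ n * S) (multi_indices K)" for n :: nat
      using has_sum_cmult_right[OF S] by simp
    show "(\<lambda>n. (1/2) ^ n * S) summable_on (UNIV :: nat set)"
      by (intro summable_on_cmult_left norm_summable_imp_summable_on) (simp add: norm_power summable_geometric)
  qed (auto intro!: prod_nonneg mult_nonneg_nonneg)
  also have "(\<lambda>(n, m). (1/2) ^ n * (\<Prod>j\<in>K. (1/2) ^ m j) :: real)
     = (\<lambda>p. (\<lambda>m. \<Prod>j\<in>insert i K. (1/2) ^ m j) ((\<lambda>(n, m). m(i := n)) p))"
  proof (intro ext, clarify)
    fix n :: nat and m :: "'a \<Rightarrow> nat"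
    have "(\<Prod>j\<in>K. (1/2) ^ (m(i := n)) j :: real) = (\<Prod>j\<in>K. (1/2) ^ m j)"
      by (rule prod.cong) (use insert in auto)
    then show "(1/2) ^ n * (\<Prod>j\<in>K. (1/2) ^ m j) = (\<Prod>j\<in>insert i K. (1/2 :: real) ^ (m(i := n)) j)"
      using insert by simp
  qed
  finally show ?case
    using summable_on_reindex_bij_betw[OF bij_betw_multi_indices_insert[OF insert.hyps(2)]] by blast
qed

section \<open>Cauchy estimates and the Taylor series\<close>

context coord_domain
begin

lemma harmonic_class_word:
  assumes "harmonic_class u" "set w \<subseteq> set ks"
  shows "harmonic_class (foldr pd w u)"
  using assms(2) by (induction w) (auto intro: harmonic_class_pd assms(1))

text \<open>For a derivative of order \<open>m\<close> the available margin \<open>R\<close> is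
  divided into \<open>m\<close> equal layers, one for each application of the gradient estimate.
  This yields the \<open>m\<close>-th power of a multiple of \<open>m\<close>, which is at most
  geometric times factorial growth.\<close>

lemma cauchy_estimates:
  assumes u: "harmonic_class u" and R: "R > 0" "fits x0 R" and M: "\<And>z. z \<in> cube \<Longrightarrow> \<bar>u (shift x0 R z)\<bar> \<le> M"
  obtains A where "A > 0" "\<And>w x. set w \<subseteq> set ks \<Longrightarrow> (\<forall>j\<in>set ks. \<bar>x j - x0 j\<bar> \<le> R) \<Longrightarrow>
     \<bar>foldr pd w u x\<bar> \<le> M * A ^ length w * fact (length w)"
proof -
  define C where "C = 12 * 4 ^ length ks / bump_mass"
  have C: "C > 0" using bump_mass_pos by (simp add: C_def)
  have M0: "M \<ge> 0" using M[OF zero_in_cube] by linarith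
  have base: "\<bar>u x\<bar> \<le> M" if "\<forall>j\<in>set ks. \<bar>x j - x0 j\<bar> \<le> 2 * R" for x
  proof -
    define z where "z = (\<lambda>j. (x j - x0 j) / R)"
    have "\<bar>z j\<bar> \<le> 2" if "j \<in> set ks" for j
      using \<open>\<forall>j\<in>set ks. _\<close> that R(1) by (auto simp: z_def abs_divide field_simps)
    then have "z \<in> cube" by (force simp: cube_def abs_le_iff)
    moreover have "shift x0 R z = x" using R(1) by (auto simp: shift_def z_def fun_eq_iff)
    ultimately show ?thesis using M by metis
  qed
  \<comment> \<open>The number \<open>m\<close> of layers stays fixed in the induction, while each
    letter of \<open>w\<close> gives up one layer of width \<open>R / m\<close>.\<close>
  have est: "\<bar>foldr pd w u x\<bar> \<le> M * (4 * C * real m / R) ^ length w"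
    if "set w \<subseteq> set ks" "length w \<le> m" "m > 0" "\<forall>j\<in>set ks. \<bar>x j - x0 j\<bar> \<le> 2 * R - real (length w) * (R / real m)" for w m x
    using that
  proof (induction w arbitrary: x)
    case Nil
    then show ?case using base by simp
  next
    case (Cons i w)
    define d where "d = R / real m"
    have d: "d > 0" using R(1) Cons.prems by (simp add: d_def)
    have dw: "real (length w) * d \<ge> 0" using d by simp
    have near: "\<bar>x j - x0 j\<bar> + d \<le> 2 * R - real (length w) * d" if "j \<in> set ks" for j
      using Cons.prems(4) that by (auto simp: d_def algebra_simps)
    \<comment> \<open>A box of scale \<open>d / 2\<close> reaches to distance \<open>d\<close>,
      exactly one layer. The gradient estimate requires a strictly smaller scale; the choice
      \<open>d / 4\<close> produces the factor 4 in the bound.\<close>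
    have fit: "fits x (d / 2)"
    proof (rule fits_near[OF R(2,1)])
      show "\<bar>x j - x0 j\<bar> + 2 * (d / 2) \<le> 2 * R" if "j \<in> set ks" for j
        using near[OF that] dw by simp
    qed (use d in simp)
    have "\<bar>pd i (foldr pd w u) x\<bar> \<le> 12 * 4 ^ length ks / bump_mass / (d / 4) * (M * (4 * C * real m / R) ^ length w)"
    proof (rule pd_bound[OF harmonic_class_word[OF u] _ _ _ fit])
      fix z assume z: "z \<in> cube"
      show "\<bar>foldr pd w u (shift x (d / 4) z)\<bar> \<le> M * (4 * C * real m / R) ^ length w"
      proof (rule Cons.IH)
        show "\<forall>j\<in>set ks. \<bar>shift x (d / 4) z j - x0 j\<bar> \<le> 2 * R - real (length w) * (R / real m)"
        proof
          fix j assume j: "j \<in> set ks"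
          have "\<bar>z j\<bar> \<le> 2" using z j by (auto simp: cube_def)
          then have "\<bar>d / 4 * z j\<bar> \<le> d" using d by (simp add: abs_mult)
          then show "\<bar>shift x (d / 4) z j - x0 j\<bar> \<le> 2 * R - real (length w) * (R / real m)"
            using near[OF j] unfolding d_def[symmetric] shift_def by linarith
        qed
      qed (use Cons.prems in auto)
    qed (use Cons.prems d in auto)
    also have "\<dots> = M * (4 * C * real m / R) ^ length (i # w)"
      unfolding C_def[symmetric] d_def by simp
    finally show ?case by simp
  qed
  \<comment> \<open>The factor \<open>exp 1\<close> pays for replacing \<open>m ^ m\<close> by
    \<open>fact m\<close>.\<close>
  define A where "A = 4 * C * exp 1 / R"
  show thesis
  proof (rule that[of A])
    show "A > 0" using C R(1) by (simp add: A_def)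
    fix w x assume w: "set w \<subseteq> set ks" and x: "\<forall>j\<in>set ks. \<bar>x j - x0 j\<bar> \<le> R"
    show "\<bar>foldr pd w u x\<bar> \<le> M * A ^ length w * fact (length w)"
    proof (cases "w = []")
      case True
      have "\<forall>j\<in>set ks. \<bar>x j - x0 j\<bar> \<le> 2 * R" using x R(1) by force
      then show ?thesis using True base by simp
    next
      case False
      define m where "m = length w"
      have m: "m > 0" using False by (simp add: m_def)
      have "\<bar>foldr pd w u x\<bar> \<le> M * (4 * C * real m / R) ^ m"
        using est[OF w, of m x] m x by (simp add: m_def)
      also have "(4 * C * real m / R) ^ m = (4 * C / R) ^ m * real m ^ m"
        by (simp add: power_mult_distrib[symmetric])
      also have "M * ((4 * C / R) ^ m * real m ^ m) \<le> M * ((4 * C / R) ^ m * (exp 1 ^ m * fact m))"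
        by (intro mult_left_mono power_self_le_exp_fact) (use M0 C R(1) in auto)
      also have "\<dots> = M * A ^ m * fact m" by (simp add: A_def power_mult_distrib power_divide)
      finally show ?thesis by (simp add: m_def)
    qed
  qed
qed

text \<open>The word \<open>w\<close> records derivatives already taken in coordinates treated
  earlier. Keeping words in a fixed order means that partial derivatives never have to be
  interchanged.\<close>

fun taylor_coeff :: "(('k \<Rightarrow> real) \<Rightarrow> real) \<Rightarrow> ('k \<Rightarrow> real) \<Rightarrow> 'k list \<Rightarrow> ('k \<Rightarrow> nat) \<Rightarrow> 'k list \<Rightarrow> real" where
  "taylor_coeff u x0 [] m w = foldr pd w u x0"
| "taylor_coeff u x0 (i # l) m w = taylor_coeff u x0 l m (replicate (m i) i @ w) / fact (m i)"

lemma taylor_coeff_cong: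
  "(\<And>j. j \<in> set l \<Longrightarrow> m j = \<beta> j) \<Longrightarrow> taylor_coeff u x0 l m w = taylor_coeff u x0 l \<beta> w"
  by (induction l arbitrary: w) auto

text \<open>The Cauchy estimate provides the factorial of the total order, but only the factorials
  of the separate orders are divided out; the multinomial bound covers the difference at a geometric
  cost.\<close>

lemma taylor_coeff_bound:
  assumes A: "A > 0" "M \<ge> 0"
    and est: "\<And>w. set w \<subseteq> set ks \<Longrightarrow> \<bar>foldr pd w u x0\<bar> \<le> M * A ^ length w * fact (length w)"
    and l: "distinct l" "set l \<subseteq> set ks" and w: "set w \<subseteq> set ks"
  shows "\<bar>taylor_coeff u x0 l m w\<bar> \<le> M * fact (length w) * (2 ^ length l * A) ^ (length w + (\<Sum>j\<in>set l. m j))"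
proof -
  let ?s = "\<lambda>l. \<Sum>j\<in>set l. m j" and ?P = "\<lambda>l. \<Prod>j\<in>set l. fact (m j) :: real"
  have "\<bar>taylor_coeff u x0 l m w\<bar> \<le> M * A ^ (length w + ?s l) * fact (length w + ?s l) / ?P l"
    using l w
  proof (induction l arbitrary: w)
    case Nil
    then show ?case using est by simp
  next
    case (Cons i l)
    have "\<bar>taylor_coeff u x0 l m (replicate (m i) i @ w)\<bar> / fact (m i)
      \<le> (M * A ^ (length (replicate (m i) i @ w) + ?s l) * fact (length (replicate (m i) i @ w) + ?s l) / ?P l) / fact (m i)"
      by (intro divide_right_mono Cons.IH) (use Cons.prems in auto)
    moreover have "length (replicate (m i) i @ w) + ?s l = length w + ?s (i # l)"
      using Cons.prems by simp
    moreover have "?P (i # l) = fact (m i) * ?P l"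
      using Cons.prems by simp
    ultimately show ?case by (simp only: taylor_coeff.simps abs_divide abs_of_nonneg[OF fact_ge_zero] divide_divide_eq_left mult.commute)
  qed
  also have "\<dots> \<le> M * A ^ (length w + ?s l) * (fact (length w) * ?P l * (2 ^ length l) ^ (length w + ?s l)) / ?P l"
    by (intro divide_right_mono mult_left_mono fact_multi_le l) (use A in \<open>auto intro!: prod_nonneg\<close>)
  also have "\<dots> = M * fact (length w) * (2 ^ length l * A) ^ (length w + ?s l)"
  proof -
    have "?P l \<noteq> 0" by (simp add: prod_zero_iff)
    then show ?thesis by (simp add: power_mult_distrib)
  qed
  finally show ?thesis .
qed

text \<open>One coordinate at a time: expand along \<open>i\<close> with the coordinates of
  \<open>l\<close> already displaced, then expand every coefficient along \<open>l\<close> by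
  induction. The generalisation over \<open>w\<close> is needed because these coefficients are
  themselves derivatives of \<open>u\<close>.\<close>

lemma taylor_has_sum:
  assumes u: "harmonic_class u" and R: "R > 0" "\<And>x. (\<forall>j\<in>set ks. \<bar>x j - x0 j\<bar> \<le> R) \<Longrightarrow> x \<in> D" and A: "A > 0" "M \<ge> 0"
    and est: "\<And>w x. set w \<subseteq> set ks \<Longrightarrow> (\<forall>j\<in>set ks. \<bar>x j - x0 j\<bar> \<le> R) \<Longrightarrow>
       \<bar>foldr pd w u x\<bar> \<le> M * A ^ length w * fact (length w)"
    and l: "distinct l" "set l \<subseteq> set ks" and w: "set w \<subseteq> set ks"
    and x: "\<And>j. j \<in> set ks \<Longrightarrow> \<bar>x j\<bar> \<le> R" "\<And>j. j \<in> set ks \<Longrightarrow> \<bar>x j\<bar> * (2 ^ length ks * A) \<le> 1/2"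
  shows "((\<lambda>m. (\<Prod>j\<in>set l. x j ^ m j) * taylor_coeff u x0 l m w) has_sum
     foldr pd w u (\<lambda>j. if j \<in> set l then x0 j + x j else x0 j)) (multi_indices (set l))"
  using l w
proof (induction l arbitrary: w)
  case Nil
  show ?case unfolding list.set(1) multi_indices_empty by (rule has_sum_finiteI) simp_all
next
  case (Cons i l)
  have i: "i \<notin> set l" "i \<in> set ks" and dl: "distinct l" "set l \<subseteq> set ks" using Cons.prems by auto
  define y where "y = (\<lambda>j. if j \<in> set l then x0 j + x j else x0 j)"
  define rep where "rep n = replicate n i @ w" for n
  have rep: "set (rep n) \<subseteq> set ks" "length (rep n) = n + length w" for n
    using i Cons.prems by (auto simp: rep_def)
  have yi: "y i = x0 i" using i by (simp add: y_def)
  have y_upd: "y(i := x0 i + x i) = (\<lambda>j. if j \<in> set (i # l) then x0 j + x j else x0 j)"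
    by (auto simp: y_def fun_eq_iff)
  have near: "\<forall>j\<in>set ks. \<bar>(y(i := x0 i + t)) j - x0 j\<bar> \<le> R" if "\<bar>t\<bar> \<le> \<bar>x i\<bar>" for t
    using x(1) that R(1) i(2) by (fastforce simp: y_def)
  define h where "h n t = foldr pd (rep n) u (y(i := x0 i + t))" for n t
  have h0: "h n 0 = foldr pd (rep n) u y" for n
  proof -
    have "y(i := x0 i + 0) = y" using yi by auto
    then show ?thesis by (simp add: h_def)
  qed
  have hder: "(h n has_real_derivative h (Suc n) t) (at t)" if "\<bar>t\<bar> \<le> \<bar>x i\<bar>" for n t
  proof -
    have "((\<lambda>s. foldr pd (rep n) u (y(i := s))) has_real_derivative pd i (foldr pd (rep n) u) (y(i := x0 i + t))) (at (x0 i + t))"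
      by (rule has_real_derivative_pd[OF harmonic_class_word[OF u rep(1)] i(2) R(2)[OF near[OF that]]])
    moreover have "h n = (\<lambda>t. foldr pd (rep n) u (y(i := t + x0 i)))"
      "h (Suc n) t = pd i (foldr pd (rep n) u) (y(i := x0 i + t))"
      by (simp_all add: fun_eq_iff h_def rep_def add.commute)
    ultimately show ?thesis
      using DERIV_shift[of "\<lambda>s. foldr pd (rep n) u (y(i := s))" "h (Suc n) t" t "x0 i"]
      by (simp only: add.commute)
  qed
  have hbound: "\<bar>h n t\<bar> \<le> M * A ^ (n + length w) * fact (n + length w)" if "\<bar>t\<bar> \<le> \<bar>x i\<bar>" for n t
    unfolding h_def rep(2)[symmetric] by (rule est[OF rep(1) near[OF that]])
  \<comment> \<open>What is left of the Cauchy bound once \<open>fact (n + length w)\<close> is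
    split by \<open>fact_add_le\<close> and the \<open>n\<close>-dependent part is absorbed into
    powers of 1/2.\<close>
  define c where "c = M * fact (length w) * (2 * A) ^ length w"
  have small: "\<bar>h n t / fact n * x i ^ n\<bar> \<le> c * (1/2) ^ n" if t: "\<bar>t\<bar> \<le> \<bar>x i\<bar>" for n t
  proof -
    have "\<bar>h n t / fact n * x i ^ n\<bar> = \<bar>h n t\<bar> / fact n * \<bar>x i\<bar> ^ n"
      by (simp add: abs_mult power_abs)
    also have "\<dots> \<le> (M * A ^ (n + length w) * (2 ^ (n + length w) * fact n * fact (length w))) / fact n * \<bar>x i\<bar> ^ n"
    proof (intro mult_right_mono divide_right_mono)
      have "\<bar>h n t\<bar> \<le> M * A ^ (n + length w) * fact (n + length w)" by (rule hbound[OF t])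
      also have "\<dots> \<le> M * A ^ (n + length w) * (2 ^ (n + length w) * fact n * fact (length w))"
        by (intro mult_left_mono fact_add_le) (use A in auto)
      finally show "\<bar>h n t\<bar> \<le> M * A ^ (n + length w) * (2 ^ (n + length w) * fact n * fact (length w))" .
    qed auto
    also have "\<dots> = c * (\<bar>x i\<bar> * (2 * A)) ^ n"
      by (simp add: c_def power_add power_mult_distrib mult_ac)
    also have "\<dots> \<le> c * (1/2) ^ n"
    proof (intro mult_left_mono power_mono)
      have "length ks \<ge> 1" using i(2) by (cases ks) auto
      then have "(2::real) ^ 1 \<le> 2 ^ length ks" by (intro power_increasing) auto
      then have "\<bar>x i\<bar> * (2 * A) \<le> \<bar>x i\<bar> * (2 ^ length ks * A)"
        using A by (intro mult_left_mono mult_right_mono) auto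
      then show "\<bar>x i\<bar> * (2 * A) \<le> 1/2" using x(2)[OF i(2)] by linarith
    qed (use A in \<open>auto simp: c_def\<close>)
    finally show ?thesis .
  qed
  have half: "(\<lambda>n. c * (1/2) ^ n) \<longlonglongrightarrow> 0" for c :: real
    using tendsto_mult_right_zero[OF LIMSEQ_realpow_zero[of "1/2::real"]] by simp
  have sums: "(\<lambda>n. h n 0 / fact n * x i ^ n) sums h 0 (x i)"
    unfolding sums_def
  proof (rule LIMSEQ_I)
    fix e :: real assume "e > 0"
    obtain N where N: "\<And>n. n \<ge> N \<Longrightarrow> norm (c * (1/2) ^ n - 0) < e"
      using LIMSEQ_D[OF half \<open>e > 0\<close>] by blast
    show "\<exists>N. \<forall>n\<ge>N. norm ((\<Sum>n<n. h n 0 / fact n * x i ^ n) - h 0 (x i)) < e"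
    proof (intro exI[of _ N] allI impI)
      fix n assume n: "n \<ge> N"
      obtain t where t: "\<bar>t\<bar> \<le> \<bar>x i\<bar>" "h 0 (x i) = (\<Sum>m<n. h m 0 / fact m * x i ^ m) + h n t / fact n * x i ^ n"
        using Maclaurin_bi_le[of h "h 0" n "x i"] hder by blast
      have "norm ((\<Sum>n<n. h n 0 / fact n * x i ^ n) - h 0 (x i)) \<le> c * (1/2) ^ n"
        using small[OF t(1), of n] unfolding t(2) by simp
      also have "\<dots> < e" using N[OF n] by simp
      finally show "norm ((\<Sum>n<n. h n 0 / fact n * x i ^ n) - h 0 (x i)) < e" .
    qed
  qed
  have hs: "((\<lambda>n. x i ^ n / fact n * h n 0) has_sum h 0 (x i)) UNIV"
  proof (rule norm_summable_imp_has_sum)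
    show "summable (\<lambda>n. norm (x i ^ n / fact n * h n 0))"
    proof (rule summable_comparison_test')
      show "summable (\<lambda>n. c * (1/2) ^ n)"
        by (intro summable_mult summable_geometric) auto
      show "norm (norm (x i ^ n / fact n * h n 0)) \<le> c * (1/2) ^ n" if "n \<ge> 0" for n
        using small[of 0 n] by (simp add: mult_ac)
    qed
    show "(\<lambda>n. x i ^ n / fact n * h n 0) sums h 0 (x i)" using sums by (simp add: mult_ac)
  qed
  define F where "F = (\<lambda>(n, m). x i ^ n / fact n * ((\<Prod>j\<in>set l. x j ^ m j) * taylor_coeff u x0 l m (rep n)))"
  have "(F has_sum h 0 (x i)) (UNIV \<times> multi_indices (set l))"
  proof (rule has_sum_SigmaI[OF _ hs])
    show "((\<lambda>m. F (n, m)) has_sum x i ^ n / fact n * h n 0) (multi_indices (set l))" for n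
      unfolding F_def case_prod_conv h0 y_def
      by (intro has_sum_cmult_right Cons.IH dl rep)
    \<comment> \<open>The part of the majorant independent of \<open>n\<close> and \<open>m\<close>.
      The rest is a product of powers of 1/2, because \<open>2 ^ length ks * A\<close> times the
      size of any coordinate is at most 1/2. Absolute summability then permits merging the iterated
      sums.\<close>
    define K where "K = M * fact (length w) * 2 ^ length w * (2 ^ length l * A) ^ length w"
    define b where "b = (\<lambda>m. \<Prod>j\<in>set (i # l). (1/2) ^ m j :: real)"
    have "(\<lambda>p. K * b ((\<lambda>(n, m). m(i := n)) p)) summable_on (UNIV \<times> multi_indices (set l))"
      using summable_on_multi_indices_geometric[of "set (i # l)"]
        summable_on_reindex_bij_betw[OF bij_betw_multi_indices_insert[OF i(1)], of b]
      by (intro summable_on_cmult_right) (simp add: b_def)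
    then have "(\<lambda>p. norm (F p)) summable_on (UNIV \<times> multi_indices (set l))"
    proof (rule summable_on_comparison_test)
      fix p assume "p \<in> (UNIV :: nat set) \<times> multi_indices (set l)"
      obtain n m where p: "p = (n, m)" by (cases p)
      define s where "s = (\<Sum>j\<in>set l. m j)"
      define G where "G = 2 ^ length l * A"
      have G: "G > 0" using A by (simp add: G_def)
      have KG: "K = M * fact (length w) * 2 ^ length w * G ^ length w" by (simp only: K_def G_def)
      have "\<bar>taylor_coeff u x0 l m (rep n)\<bar> \<le> M * fact (length (rep n)) * G ^ (length (rep n) + s)"
        unfolding G_def s_def
        by (rule taylor_coeff_bound[OF A est dl rep(1)]) (use R(1) in auto)
      also have "\<dots> \<le> M * (2 ^ (n + length w) * fact n * fact (length w)) * G ^ (n + length w + s)"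
        unfolding rep(2) by (intro mult_left_mono mult_right_mono fact_add_le) (use A G in auto)
      finally have tc: "\<bar>taylor_coeff u x0 l m (rep n)\<bar> \<le> M * (2 ^ (n + length w) * fact n * fact (length w)) * G ^ (n + length w + s)" .
      have "norm (F p) = \<bar>x i\<bar> ^ n / fact n * ((\<Prod>j\<in>set l. \<bar>x j\<bar> ^ m j) * \<bar>taylor_coeff u x0 l m (rep n)\<bar>)"
        by (simp add: p F_def abs_mult abs_prod power_abs)
      also have "\<dots> \<le> \<bar>x i\<bar> ^ n / fact n * ((\<Prod>j\<in>set l. \<bar>x j\<bar> ^ m j) * (M * (2 ^ (n + length w) * fact n * fact (length w)) * G ^ (n + length w + s)))"
        by (intro mult_left_mono tc) (auto intro!: prod_nonneg)
      also have "\<dots> = K * ((\<bar>x i\<bar> * (2 * G)) ^ n * ((\<Prod>j\<in>set l. \<bar>x j\<bar> ^ m j) * G ^ s))"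
        by (simp add: KG power_add power_mult_distrib mult_ac)
      also have "(\<Prod>j\<in>set l. \<bar>x j\<bar> ^ m j) * G ^ s = (\<Prod>j\<in>set l. (\<bar>x j\<bar> * G) ^ m j)"
        by (simp add: s_def power_sum prod.distrib power_mult_distrib)
      also have "K * ((\<bar>x i\<bar> * (2 * G)) ^ n * (\<Prod>j\<in>set l. (\<bar>x j\<bar> * G) ^ m j)) \<le> K * ((1/2) ^ n * (\<Prod>j\<in>set l. (1/2) ^ m j))"
      proof -
        have "length (i # l) \<le> length ks"
          using distinct_card[OF Cons.prems(1)] distinct_card[OF distinct_ks] card_mono[OF _ Cons.prems(2)] by simp
        then have "(2::real) ^ length (i # l) \<le> 2 ^ length ks" by (intro power_increasing) auto
        then have "2 * G \<le> 2 ^ length ks * A"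
          using mult_right_mono[of "2 ^ length (i # l)" "2 ^ length ks" A] A by (simp add: G_def)
        then have "\<bar>x j\<bar> * (2 * G) \<le> \<bar>x j\<bar> * (2 ^ length ks * A)" for j by (rule mult_left_mono) simp
        then have 2: "\<bar>x j\<bar> * (2 * G) \<le> 1/2" if "j \<in> set ks" for j using x(2)[OF that] order_trans by blast
        have 1: "\<bar>x j\<bar> * G \<le> 1/2" if "j \<in> set ks" for j
          using 2[OF that] G mult_nonneg_nonneg[of "\<bar>x j\<bar>" G] by simp
        show ?thesis
          by (intro mult_left_mono mult_mono power_mono prod_mono prod_nonneg conjI)
             (use 1 2 i(2) dl(2) A G in \<open>auto simp: K_def intro!: prod_nonneg\<close>)
      qed
      also have "(1/2) ^ n * (\<Prod>j\<in>set l. (1/2) ^ m j) = b ((\<lambda>(n, m). m(i := n)) p)"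
      proof -
        have "(\<Prod>j\<in>set l. (1/2) ^ (m(i := n)) j :: real) = (\<Prod>j\<in>set l. (1/2) ^ m j)"
          by (rule prod.cong) (use i(1) in auto)
        then show ?thesis using i(1) by (simp add: b_def p)
      qed
      finally show "norm (F p) \<le> K * b ((\<lambda>(n, m). m(i := n)) p)" .
    qed simp
    then show "F summable_on (UNIV \<times> multi_indices (set l))" by (rule abs_summable_summable)
  qed
  also have "F = (\<lambda>p. (\<lambda>m. (\<Prod>j\<in>set (i # l). x j ^ m j) * taylor_coeff u x0 (i # l) m w) ((\<lambda>(n, m). m(i := n)) p))"
  proof (intro ext, clarify)
    fix n m
    have "(\<Prod>j\<in>set l. x j ^ (m(i := n)) j) = (\<Prod>j\<in>set l. x j ^ m j)"
      by (rule prod.cong) (use i(1) in auto)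
    moreover have "taylor_coeff u x0 l (m(i := n)) (rep n) = taylor_coeff u x0 l m (rep n)"
      by (rule taylor_coeff_cong) (use i(1) in auto)
    ultimately show "F (n, m) = (\<Prod>j\<in>set (i # l). x j ^ (m(i := n)) j) * taylor_coeff u x0 (i # l) (m(i := n)) w"
      using i(1) by (simp add: F_def rep_def)
  qed
  finally have "((\<lambda>m. (\<Prod>j\<in>set (i # l). x j ^ m j) * taylor_coeff u x0 (i # l) m w) has_sum h 0 (x i)) (multi_indices (insert i (set l)))"
    using has_sum_reindex_bij_betw[OF bij_betw_multi_indices_insert[OF i(1)]] by blast
  then show ?case unfolding h_def y_upd rep_def by simp
qed

lemma harmonic_class_analytic:
  assumes u: "harmonic_class u" and R: "R > 0" "fits x0 R" and M: "\<And>z. z \<in> cube \<Longrightarrow> \<bar>u (shift x0 R z)\<bar> \<le> M"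
  obtains c \<rho> where "\<rho> > 0" "\<rho> \<le> R" "\<And>x. (\<forall>j\<in>set ks. \<bar>x j\<bar> < \<rho>) \<Longrightarrow>
     ((\<lambda>m. (\<Prod>j\<in>set ks. x j ^ m j) * c m) has_sum u (\<lambda>j. if j \<in> set ks then x0 j + x j else x0 j)) (multi_indices (set ks))"
proof -
  obtain A where A: "A > 0" "\<And>w x. set w \<subseteq> set ks \<Longrightarrow> (\<forall>j\<in>set ks. \<bar>x j - x0 j\<bar> \<le> R) \<Longrightarrow>
     \<bar>foldr pd w u x\<bar> \<le> M * A ^ length w * fact (length w)"
    using cauchy_estimates[OF u R M] by blast
  have M0: "M \<ge> 0" using M[OF zero_in_cube] by linarith
  have inD: "x \<in> D" if x: "\<forall>j\<in>set ks. \<bar>x j - x0 j\<bar> \<le> R" for x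
    by (rule fits_center[of x "R / 2"], rule fits_near[OF R(2,1)]) (use x R(1) in auto)
  define \<rho> where "\<rho> = min R (1 / (2 * (2 ^ length ks * A)))"
  show thesis
  proof (rule that[of \<rho> "\<lambda>m. taylor_coeff u x0 ks m []"])
    show "\<rho> > 0" "\<rho> \<le> R" using R(1) A(1) by (auto simp: \<rho>_def)
    fix x assume x: "\<forall>j\<in>set ks. \<bar>x j\<bar> < \<rho>"
    have "\<bar>x j\<bar> \<le> R" "\<bar>x j\<bar> * (2 ^ length ks * A) \<le> 1/2" if "j \<in> set ks" for j
    proof -
      have "\<bar>x j\<bar> \<le> R" "\<bar>x j\<bar> \<le> 1 / (2 * (2 ^ length ks * A))" using x that by (auto simp: \<rho>_def less_imp_le)
      moreover have "2 ^ length ks * A > 0" using A(1) by simp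
      ultimately show "\<bar>x j\<bar> \<le> R" "\<bar>x j\<bar> * (2 ^ length ks * A) \<le> 1/2" by (simp_all add: field_simps)
    qed
    then show "((\<lambda>m. (\<Prod>j\<in>set ks. x j ^ m j) * taylor_coeff u x0 ks m []) has_sum
        u (\<lambda>j. if j \<in> set ks then x0 j + x j else x0 j)) (multi_indices (set ks))"
      using taylor_has_sum[OF u R(1) inD A(1) M0 A(2) distinct_ks, where w = "[]" and x = x] by simp
  qed
qed

end

section \<open>Linear functionals on finite-dimensional normed spaces\<close>

text \<open>The type offers a finite spanning set but no inner product, so the comparison of norms
  is made in coordinates: on the compact set \<open>N x = 1\<close> of the box, the norm of the
  vector \<open>T x\<close> has a positive minimum by linear independence.\<close>

lemma bounded_linear_finite_dim:
  fixes l :: "'a::real_normed_vector \<Rightarrow> real" and B :: "'a set"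
  assumes "finite B" "span B = UNIV" "linear l"
  shows "bounded_linear l"
proof -
  obtain B' :: "'a set" where B': "B' \<subseteq> B" "independent B'" "B \<subseteq> span B'" using maximal_independent_subset by blast
  have fin: "finite B'" using B'(1) assms(1) finite_subset by blast
  have "span B \<subseteq> span B'" using B'(3) by (simp add: span_minimal)
  then have sp: "span B' = UNIV" using assms(2) by auto
  define T where "T x = (\<Sum>v\<in>B'. x v *\<^sub>R v)" for x :: "'a \<Rightarrow> real"
  define N where "N x = (\<Sum>v\<in>B'. \<bar>x v\<bar>)" for x :: "'a \<Rightarrow> real"
  \<comment> \<open>Coordinates are indexed by the whole type; pinning those outside
    \<open>B'\<close> to 0 keeps the product compact and the coordinate vector unique.\<close>
  define box where "box = PiE UNIV (\<lambda>v. if v \<in> B' then {-1..1} else {0::real})"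
  have coord: "continuous_on UNIV (\<lambda>x::'a \<Rightarrow> real. x v)" for v by simp
  have cN: "continuous_on UNIV N" unfolding N_def by (intro continuous_intros coord)
  have cT: "continuous_on UNIV (\<lambda>x. norm (T x))" unfolding T_def by (intro continuous_intros coord)
  have "compactin (product_topology (\<lambda>_. euclidean) UNIV) box"
    unfolding box_def compactin_PiE by auto
  then have "compact box" by (simp add: euclidean_product_topology)
  moreover have "closed {x. N x = 1}" by (intro closed_Collect_eq cN continuous_intros)
  ultimately have comp: "compact (box \<inter> {x. N x = 1})" by (rule compact_Int_closed)
  obtain m where m: "m > 0" "\<And>x. x \<in> box \<Longrightarrow> N x = 1 \<Longrightarrow> m \<le> norm (T x)"
  proof (cases "box \<inter> {x. N x = 1} = {}")
    case True
    then show ?thesis using that[of 1] by auto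
  next
    case False
    obtain x where x: "x \<in> box \<inter> {x. N x = 1}" "\<And>y. y \<in> box \<inter> {x. N x = 1} \<Longrightarrow> norm (T x) \<le> norm (T y)"
      using continuous_attains_inf[OF comp False continuous_on_subset[OF cT]] by blast
    have "T x \<noteq> 0"
    proof
      assume "T x = 0"
      then have "\<And>v. v \<in> B' \<Longrightarrow> x v = 0"
        unfolding T_def using independentD[OF B'(2) fin order_refl] by blast
      then have "N x = 0" by (simp add: N_def)
      then show False using x by simp
    qed
    then show ?thesis using that[of "norm (T x)"] x by auto
  qed
  define L where "L = (\<Sum>v\<in>B'. \<bar>l v\<bar>)"
  show ?thesis
  proof (rule bounded_linear_intro[of l "L / m"])
    show "l (x + y) = l x + l y" "l (r *\<^sub>R x) = r *\<^sub>R l x" for x y r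
      using assms(3) by (simp_all add: linear_add linear_scale)
    fix y
    define x where "x v = (if v \<in> B' then representation B' y v else 0)" for v
    have y: "y = T x"
      using sum_representation_eq[OF B'(2) _ fin order_refl, of y] sp by (simp add: T_def x_def)
    have le: "\<bar>x v\<bar> \<le> N x" if "v \<in> B'" for v
      unfolding N_def by (rule member_le_sum) (use that fin in auto)
    have "\<bar>l y\<bar> = \<bar>\<Sum>v\<in>B'. x v * l v\<bar>"
      unfolding y T_def using assms(3) by (simp add: linear_sum linear_scale)
    also have "\<dots> \<le> (\<Sum>v\<in>B'. \<bar>x v * l v\<bar>)" by (rule sum_abs)
    also have "\<dots> \<le> (\<Sum>v\<in>B'. N x * \<bar>l v\<bar>)"
      by (intro sum_mono) (auto simp: abs_mult intro!: mult_right_mono le)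
    also have "\<dots> = L * N x" by (simp add: L_def sum_distrib_left[symmetric] mult.commute)
    finally have lN: "\<bar>l y\<bar> \<le> L * N x" .
    have "m * N x \<le> norm y"
    proof (cases "N x = 0")
      case False
      have "N x \<ge> 0" by (simp add: N_def sum_nonneg)
      with False have N: "N x > 0" by simp
      define w where "w v = x v / N x" for v
      have "\<bar>w v\<bar> \<le> 1" if "v \<in> B'" for v using le[OF that] N by (simp add: w_def abs_divide)
      then have "w v \<in> (if v \<in> B' then {-1..1} else {0})" for v
        by (cases "v \<in> B'") (simp_all add: abs_le_iff, simp_all add: w_def x_def)
      then have "w \<in> box" by (simp only: box_def PiE_UNIV_domain Pi_iff) blast
      moreover have "N w = 1" using N by (simp add: w_def N_def sum_divide_distrib[symmetric])
      moreover have "T w = (1 / N x) *\<^sub>R y" by (simp add: y T_def w_def scaleR_sum_right)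
      ultimately have "m \<le> norm ((1 / N x) *\<^sub>R y)" using m(2) by metis
      then show ?thesis using N by (simp add: field_simps)
    qed simp
    then have "L * N x \<le> L * (norm y / m)"
      using m(1) by (intro mult_left_mono) (auto simp: L_def sum_nonneg field_simps)
    with lN show "norm (l y) \<le> norm y * (L / m)" by (simp add: mult.commute)
  qed
qed

lemma linear_representation:
  assumes "independent B" "span B = UNIV"
  shows "linear (\<lambda>x. representation B x v)"
  by (rule linearI) (simp_all add: assms(2) representation_add[OF assms(1)] representation_scale[OF assms(1)])

lemma has_sum_finite_sum:
  fixes F :: "'i \<Rightarrow> 'b \<Rightarrow> 'c::topological_comm_monoid_add"
  assumes "finite I" "\<And>i. i \<in> I \<Longrightarrow> (F i has_sum S i) A"
  shows "((\<lambda>x. \<Sum>i\<in>I. F i x) has_sum (\<Sum>i\<in>I. S i)) A"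
  using assms by (induction I rule: finite_induct) (auto intro: has_sum_add)

section \<open>Vector-valued solutions of the first-order system\<close>

text \<open>Even and odd variables are no longer distinguished: a block is a fibre of \<beta>, its
  base coordinate is a fixed point of \<beta>, and \<open>a\<close> holds the multipliers. The
  continuous map \<open>coord\<close> carries continuity from coordinate space back to
  \<open>V\<close>.\<close>

locale diff_system = coord_cube ks for ks :: "'k list" +
  fixes f :: "'v::real_normed_vector \<Rightarrow> 'a::{real_normed_vector,real_algebra_1}"
    and b :: "'k \<Rightarrow> 'v" and V :: "'v set" and \<beta> :: "'k \<Rightarrow> 'k" and a :: "'k \<Rightarrow> 'a"
    and coord :: "'v \<Rightarrow> 'k \<Rightarrow> real" and B :: "'a set"
  assumes B: "finite B" "independent B" "span B = UNIV"
    and V_room: "z \<in> V \<Longrightarrow> \<exists>r>0. \<forall>x. (\<forall>j\<in>set ks. \<bar>x j\<bar> \<le> r) \<longrightarrow> z + (\<Sum>j\<in>set ks. x j *\<^sub>R b j) \<in> V"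
    and coord: "continuous_on V coord" "z \<in> V \<Longrightarrow> (\<Sum>j\<in>set ks. coord z j *\<^sub>R b j) = z"
    and diff: "f differentiable_on V"
    and \<beta>: "j \<in> set ks \<Longrightarrow> \<beta> j \<in> set ks" "j \<in> set ks \<Longrightarrow> \<beta> j = j \<Longrightarrow> a j = 1"
    and system: "z \<in> V \<Longrightarrow> j \<in> set ks \<Longrightarrow> partial_deriv f (b j) z = a j * partial_deriv f (b (\<beta> j)) z"
    and squares: "j0 \<in> \<beta> ` set ks \<Longrightarrow> (\<Sum>j\<in>{j\<in>set ks. \<beta> j = j0}. a j * a j) = 0"
begin

section \<open>Pulling the system back to coordinate space\<close>

definition point :: "('k \<Rightarrow> real) \<Rightarrow> 'v" where
  "point x = (\<Sum>j\<in>set ks. x j *\<^sub>R b j)"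

lemma point_add: "point (\<lambda>j. x j + y j) = point x + point y"
  by (simp add: point_def scaleR_add_left sum.distrib)

lemma point_upd:
  assumes "j \<in> set ks"
  shows "point (x(j := t)) = point x + (t - x j) *\<^sub>R b j"
proof -
  have "(\<Sum>i\<in>set ks - {j}. (x(j := t)) i *\<^sub>R b i) = (\<Sum>i\<in>set ks - {j}. x i *\<^sub>R b i)"
    by (rule sum.cong) auto
  then show ?thesis
    unfolding point_def sum.remove[OF finite_set assms] by (simp add: algebra_simps)
qed

lemma continuous_on_point: "continuous_on S point"
  unfolding point_def by (intro continuous_intros continuous_on_coord)

sublocale coord_domain ks "{x. point x \<in> V}"
proof
  fix x assume "x \<in> {x. point x \<in> V}"
  then obtain r where r: "r > 0" "\<And>y. (\<forall>j\<in>set ks. \<bar>y j\<bar> \<le> r) \<Longrightarrow> point x + point y \<in> V"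
    using V_room unfolding point_def by blast
  have "shift x (r / 2) z \<in> {x. point x \<in> V}" if "z \<in> cube" for z
  proof -
    have "\<forall>j\<in>set ks. \<bar>r / 2 * z j\<bar> \<le> r"
    proof
      fix j assume "j \<in> set ks"
      then have "\<bar>z j\<bar> \<le> 2" using that by (auto simp: cube_def)
      then show "\<bar>r / 2 * z j\<bar> \<le> r" using r(1) by (simp add: abs_mult)
    qed
    from r(2)[OF this] show ?thesis by (simp add: shift_def point_add)
  qed
  then show "\<exists>r>0. \<forall>z\<in>cube. shift x r z \<in> {x. point x \<in> V}" using r(1) by (intro exI[of _ "r / 2"]) auto
qed

text \<open>A derivative within \<open>V\<close> need not be determined on vectors transverse to the
  coordinate directions, hence the choice. Its values on the directions \<open>b j\<close> are the
  partial derivatives.\<close>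

definition Df :: "'v \<Rightarrow> 'v \<Rightarrow> 'a" where
  "Df z = (SOME f'. (f has_derivative f') (at z within V))"

lemma has_derivative_Df: "z \<in> V \<Longrightarrow> (f has_derivative Df z) (at z within V)"
  unfolding Df_def using diff someI_ex[of "\<lambda>f'. (f has_derivative f') (at z within V)"]
  by (auto simp: differentiable_on_def differentiable_def)

lemma line_room:
  assumes "z \<in> V" "j \<in> set ks"
  obtains r where "r > 0" "\<And>t. \<bar>t\<bar> \<le> r \<Longrightarrow> z + t *\<^sub>R b j \<in> V"
proof -
  obtain r where r: "r > 0" "\<And>y. (\<forall>j\<in>set ks. \<bar>y j\<bar> \<le> r) \<Longrightarrow> z + point y \<in> V"
    using V_room[OF assms(1)] unfolding point_def by blast
  show thesis
  proof (rule that[OF r(1)])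
    fix t :: real assume "\<bar>t\<bar> \<le> r"
    then have "z + point ((\<lambda>_. 0)(j := t)) \<in> V" by (intro r(2)) (use r(1) in auto)
    then show "z + t *\<^sub>R b j \<in> V" unfolding point_upd[OF assms(2)] by (simp add: point_def)
  qed
qed

text \<open>Although \<open>V\<close> may have empty interior in the ambient space, a coordinate
  line meets it in a full interval around \<open>z\<close>, so the derivative within
  \<open>V\<close> becomes an ordinary one along the line.\<close>

lemma line_has_vector_derivative:
  assumes z: "z \<in> V" and j: "j \<in> set ks"
  shows "((\<lambda>t. f (z + t *\<^sub>R b j)) has_vector_derivative Df z (b j)) (at 0)"
proof -
  obtain r where r: "r > 0" "\<And>t. \<bar>t\<bar> \<le> r \<Longrightarrow> z + t *\<^sub>R b j \<in> V" using line_room[OF z j] by blast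
  have lin: "linear (Df z)" using has_derivative_Df[OF z] has_derivative_linear by blast
  have "((\<lambda>t. f (z + t *\<^sub>R b j)) has_derivative (\<lambda>t. Df (z + 0 *\<^sub>R b j) (t *\<^sub>R b j))) (at 0 within {-r<..<r})"
  proof (rule has_derivative_in_compose2[where t = V and g = f])
    show "((\<lambda>t. z + t *\<^sub>R b j) has_derivative (\<lambda>t. t *\<^sub>R b j)) (at 0 within {-r<..<r})"
      by (auto intro!: derivative_eq_intros)
    show "(\<lambda>t. z + t *\<^sub>R b j) ` {-r<..<r} \<subseteq> V" using r(2) by (auto simp: abs_le_iff)
    show "(f has_derivative Df z') (at z' within V)" if "z' \<in> V" for z' by (rule has_derivative_Df[OF that])
  qed (use r in auto)
  moreover have "at 0 within {-r<..<r} = at 0" by (rule at_within_open) (use r in auto)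
  ultimately show ?thesis using linear_scale[OF lin] by (simp add: has_vector_derivative_def)
qed

lemma partial_deriv_Df:
  assumes "z \<in> V" "j \<in> set ks"
  shows "partial_deriv f (b j) z = Df z (b j)"
  unfolding partial_deriv_def by (rule vector_derivative_at[OF line_has_vector_derivative[OF assms]])

lemma bounded_linear_functional_mult:
  fixes l :: "'a \<Rightarrow> real"
  assumes "linear l"
  shows "bounded_linear (\<lambda>y. l (c * y))"
  by (rule bounded_linear_finite_dim[OF B(1,3)], rule linearI)
     (use assms in \<open>simp_all add: distrib_left linear_add linear_scale\<close>)

lemma harmonic_class_functional:
  fixes l :: "'a \<Rightarrow> real"
  assumes l: "linear l"
  shows "harmonic_class (\<lambda>x. l (f (point x)))"
  unfolding harmonic_class_def
proof (intro conjI allI impI)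
  have bl: "bounded_linear l" by (rule bounded_linear_finite_dim[OF B(1,3) l])
  have cf: "continuous_on {x. point x \<in> V} (\<lambda>x. f (point x))"
    by (rule continuous_on_compose2[OF differentiable_imp_continuous_on[OF diff] continuous_on_point]) auto
  then show "continuous_on {x. point x \<in> V} (\<lambda>x. l (f (point x)))"
    by (rule bounded_linear.continuous_on[OF bl])
  fix x r r' assume r: "0 < r" "r < r'" "fits x r'"
  have fit: "fits x r" by (rule fits_mono[OF r(3)]) (use r in auto)
  then have inV: "point (shift x r z) \<in> V" if "z \<in> cube" for z using that by (auto simp: fits_def)
  define U where "U c z = l (c * f (point (shift x r z)))" for c z
  \<comment> \<open>The factor \<open>r\<close> is the chain rule for \<open>shift\<close>.\<close>
  define d where "d c j z = r * l (c * Df (point (shift x r z)) (b j))" for c j z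
  have "weakly_harmonic (U 1)"
  \<comment> \<open>The family is indexed by the left factor \<open>c\<close>. Associativity moves a
    multiplier of the system into this index, and two passes turn \<open>c\<close> into
    \<open>c * a j * a j\<close>, whose sum over a block vanishes.\<close>
  proof (rule weakly_harmonic_system[where d = d and A = "\<lambda>j c. c * a j" and \<beta> = \<beta>])
    show "\<beta> j \<in> set ks" if "j \<in> set ks" for j by (rule \<beta>(1)[OF that])
    show "c * a j = c" if "j \<in> set ks" "\<beta> j = j" for j c using \<beta>(2)[OF that] by simp
    show "continuous_on cube (U c)" for c
      unfolding U_def
      by (rule bounded_linear.continuous_on[OF bounded_linear_functional_mult[OF l] continuous_on_cube_shift[OF cf fit]])
    show "d c j z = d (c * a j) (\<beta> j) z" if "j \<in> set ks" "z \<in> cube" for c j z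
      using system[OF inV[OF that(2)] that(1)] partial_deriv_Df[OF inV[OF that(2)]] that(1) \<beta>(1)[OF that(1)]
      by (simp add: d_def mult.assoc)
    show "(\<Sum>j\<in>{j\<in>set ks. \<beta> j = j0}. U (c * a j * a j) z) = 0" if "j0 \<in> \<beta> ` set ks" for j0 c z
    proof -
      have "(\<Sum>j\<in>{j\<in>set ks. \<beta> j = j0}. U (c * a j * a j) z)
        = l (c * (\<Sum>j\<in>{j\<in>set ks. \<beta> j = j0}. a j * a j) * f (point (shift x r z)))"
        unfolding U_def by (simp add: linear_sum[OF l, symmetric] sum_distrib_left sum_distrib_right mult.assoc)
      then show ?thesis using squares[OF that] linear_0[OF l] by simp
    qed
    show "plane_deriv j i (U c) (d c j) (d c i)" if ji: "j \<in> set ks" "i \<in> set ks" "j \<noteq> i" for c j i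
      unfolding plane_deriv_def
    proof
      fix z assume z: "z \<in> cube"
      let ?S = "{-2..2} \<times> {-2..2} :: (real \<times> real) set"
      define w where "w = shift x r z"
      define g where "g p = point w + (x j + r * fst p - w j) *\<^sub>R b j + (x i + r * snd p - w i) *\<^sub>R b i" for p :: "real \<times> real"
      have g: "point (shift x r (z(j := fst p, i := snd p))) = g p" for p
        unfolding shift_upd_point point_upd[OF ji(2)] point_upd[OF ji(1)] w_def[symmetric] g_def using ji(3) by simp
      have g0: "g (z j, z i) = point (shift x r z)" unfolding g[symmetric] by simp
      have lin: "linear (Df (point (shift x r z)))" using has_derivative_Df[OF inV[OF z]] has_derivative_linear by blast
      have "((\<lambda>p. f (g p)) has_derivative (\<lambda>h. Df (g (z j, z i)) ((r * fst h) *\<^sub>R b j + (r * snd h) *\<^sub>R b i))) (at (z j, z i) within ?S)"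
      proof (rule has_derivative_in_compose2[where t = V and g = f])
        show "(f has_derivative Df z') (at z' within V)" if "z' \<in> V" for z' by (rule has_derivative_Df[OF that])
        show "g ` ?S \<subseteq> V"
        proof clarify
          fix s t :: real assume "s \<in> {-2..2}" "t \<in> {-2..2}"
          then show "g (s, t) \<in> V" unfolding g[symmetric] by (intro inV cube_upd z) auto
        qed
        show "(z j, z i) \<in> ?S" using z ji by (auto simp: cube_def)
        show "(g has_derivative (\<lambda>h. (r * fst h) *\<^sub>R b j + (r * snd h) *\<^sub>R b i)) (at (z j, z i) within ?S)"
          unfolding g_def[abs_def] by (auto intro!: derivative_eq_intros)
      qed
      from bounded_linear.has_derivative[OF bounded_linear_functional_mult[OF l, of c] this]
      have "((\<lambda>p. U c (z(j := fst p, i := snd p))) has_derivative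
          (\<lambda>h. l (c * Df (point (shift x r z)) ((r * fst h) *\<^sub>R b j + (r * snd h) *\<^sub>R b i)))) (at (z j, z i) within ?S)"
        unfolding U_def g g0 .
      moreover have "l (c * Df (point (shift x r z)) ((r * fst h) *\<^sub>R b j + (r * snd h) *\<^sub>R b i)) = fst h * d c j z + snd h * d c i z" for h
        by (simp add: d_def linear_add[OF lin] linear_scale[OF lin] distrib_left linear_add[OF l] linear_scale[OF l])
      ultimately show "((\<lambda>p. U c (z(j := fst p, i := snd p))) has_derivative (\<lambda>h. fst h * d c j z + snd h * d c i z)) (at (z j, z i) within ?S)"
        by (simp only:)
    qed
  qed
  moreover have "U 1 = (\<lambda>z. l (f (point (shift x r z))))" by (simp add: U_def fun_eq_iff)
  ultimately show "weakly_harmonic (\<lambda>z. l (f (point (shift x r z))))" by simp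
qed

text \<open>Stated for a general \<open>g\<close> so that it can be used first for \<open>f\<close>
  and then for its partial derivatives, whose components are again in the class.\<close>

lemma partial_deriv_components:
  assumes hc: "\<And>v. v \<in> B \<Longrightarrow> harmonic_class (w v)"
    and g: "\<And>x. point x \<in> V \<Longrightarrow> g (point x) = (\<Sum>v\<in>B. w v x *\<^sub>R v)"
    and j: "j \<in> set ks" and x: "point x \<in> V"
  shows "has_partial_deriv g (b j) (point x)" "partial_deriv g (b j) (point x) = (\<Sum>v\<in>B. pd j (w v) x *\<^sub>R v)"
proof -
  obtain r where r: "r > 0" "\<And>t. \<bar>t\<bar> \<le> r \<Longrightarrow> point x + t *\<^sub>R b j \<in> V" using line_room[OF x j] by blast
  have pt: "point (x(j := t + x j)) = point x + t *\<^sub>R b j" for t unfolding point_upd[OF j] by simp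
  have "((\<lambda>t. w v (x(j := t + x j))) has_vector_derivative pd j (w v) x) (at 0)" if "v \<in> B" for v
  proof -
    have "((\<lambda>t. w v (x(j := t))) has_real_derivative pd j (w v) (x(j := x j))) (at (x j))"
      by (rule has_real_derivative_pd[OF hc[OF that] j]) (use x in simp)
    then show ?thesis
      using DERIV_shift[of "\<lambda>t. w v (x(j := t))" "pd j (w v) x" 0 "x j"]
      by (simp only: fun_upd_triv add_0 has_real_derivative_iff_has_vector_derivative)
  qed
  then have "((\<lambda>t. \<Sum>v\<in>B. w v (x(j := t + x j)) *\<^sub>R v) has_vector_derivative (\<Sum>v\<in>B. pd j (w v) x *\<^sub>R v)) (at 0)"
    by (intro has_vector_derivative_sum bounded_linear.has_vector_derivative[OF bounded_linear_scaleR_left])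
  then have der: "((\<lambda>t. g (point x + t *\<^sub>R b j)) has_vector_derivative (\<Sum>v\<in>B. pd j (w v) x *\<^sub>R v)) (at 0)"
  proof (rule has_vector_derivative_transform_within_open[where S = "{-r<..<r}"])
    fix t assume "t \<in> {-r<..<r}"
    then have "point (x(j := t + x j)) \<in> V" unfolding pt by (intro r(2)) (auto simp: abs_le_iff)
    from g[OF this] show "(\<Sum>v\<in>B. w v (x(j := t + x j)) *\<^sub>R v) = g (point x + t *\<^sub>R b j)" unfolding pt by simp
  qed (use r in auto)
  show "has_partial_deriv g (b j) (point x)"
    unfolding has_partial_deriv_def by (rule differentiableI_vector[OF der])
  show "partial_deriv g (b j) (point x) = (\<Sum>v\<in>B. pd j (w v) x *\<^sub>R v)"
    unfolding partial_deriv_def by (rule vector_derivative_at[OF der])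
qed

section \<open>Harmonicity and analyticity from real components\<close>

definition comp :: "'a \<Rightarrow> ('k \<Rightarrow> real) \<Rightarrow> real" where
  "comp v x = representation B (f (point x)) v"

lemma harmonic_class_comp: "harmonic_class (comp v)"
  unfolding comp_def[abs_def] by (rule harmonic_class_functional[OF linear_representation[OF B(2,3)]])

lemma f_comp: "f (point x) = (\<Sum>v\<in>B. comp v x *\<^sub>R v)"
  using sum_representation_eq[OF B(2) _ B(1) order_refl, of "f (point x)"] B(3) by (simp add: comp_def)

lemma point_coord: "z \<in> V \<Longrightarrow> point (coord z) = z"
  using coord(2) by (simp add: point_def)

lemma continuous_on_components:
  assumes hc: "\<And>v. v \<in> B \<Longrightarrow> harmonic_class (w v)"
    and g: "\<And>x. point x \<in> V \<Longrightarrow> g (point x) = (\<Sum>v\<in>B. w v x *\<^sub>R v)"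
  shows "continuous_on V g"
proof -
  have "continuous_on V (\<lambda>z. \<Sum>v\<in>B. w v (coord z) *\<^sub>R v)"
    by (intro continuous_on_sum continuous_on_scaleR continuous_on_const
          continuous_on_compose2[OF harmonic_class_continuous[OF hc] coord(1)]) (auto simp: point_coord)
  moreover have "g z = (\<Sum>v\<in>B. w v (coord z) *\<^sub>R v)" if "z \<in> V" for z
    using g[of "coord z"] point_coord[OF that] that by simp
  ultimately show ?thesis by (simp cong: continuous_on_cong)
qed

lemma harmonic: "harmonic_on (set ks) b f V"
proof -
  have hc1: "harmonic_class (pd j (comp v))" if "j \<in> set ks" for j v
    by (rule harmonic_class_pd[OF harmonic_class_comp that])
  have hc2: "harmonic_class (pd i (pd j (comp v)))" if "j \<in> set ks" "i \<in> set ks" for j i v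
    by (rule harmonic_class_pd[OF hc1[OF that(1)] that(2)])
  note d1 = partial_deriv_components[where g = f and w = comp, OF harmonic_class_comp f_comp]
  note d2 = partial_deriv_components[where w = "\<lambda>v. pd j (comp v)" and g = "partial_deriv f (b j)" for j, OF hc1 d1(2)]
  have "has_partial_deriv f (b j) z" if "j \<in> set ks" "z \<in> V" for j z
    using d1(1)[OF that(1), of "coord z"] that(2) by (simp add: point_coord)
  moreover have "has_partial_deriv (partial_deriv f (b j)) (b i) z" if "j \<in> set ks" "i \<in> set ks" "z \<in> V" for j i z
    using d2(1)[OF that(1) that(1) _ that(2), of "coord z"] that(3) by (simp add: point_coord)
  moreover have "continuous_on V f" by (rule continuous_on_components[OF harmonic_class_comp f_comp])
  moreover have "continuous_on V (partial_deriv f (b j))" if "j \<in> set ks" for j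
    by (rule continuous_on_components[OF hc1[OF that] d1(2)[OF that]])
  moreover have "continuous_on V (partial_deriv (partial_deriv f (b j)) (b i))" if "j \<in> set ks" "i \<in> set ks" for j i
    by (rule continuous_on_components[OF hc2[OF that] d2(2)[OF that(1) that(1) _ that(2)]])
  moreover have "(\<Sum>j\<in>set ks. partial_deriv (partial_deriv f (b j)) (b j) z) = 0" if z: "z \<in> V" for z
  proof -
    have "(\<Sum>j\<in>set ks. partial_deriv (partial_deriv f (b j)) (b j) z)
       = (\<Sum>j\<in>set ks. \<Sum>v\<in>B. pd j (pd j (comp v)) (coord z) *\<^sub>R v)"
    proof (rule sum.cong[OF refl])
      fix j assume j: "j \<in> set ks"
      show "partial_deriv (partial_deriv f (b j)) (b j) z = (\<Sum>v\<in>B. pd j (pd j (comp v)) (coord z) *\<^sub>R v)"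
        using d2(2)[OF j j _ j, of "coord z"] z by (simp add: point_coord)
    qed
    also have "\<dots> = (\<Sum>v\<in>B. (\<Sum>j\<in>set ks. pd j (pd j (comp v)) (coord z)) *\<^sub>R v)"
      by (subst sum.swap) (simp add: scaleR_sum_left)
    also have "\<dots> = 0"
      using laplace_eq_0[OF harmonic_class_comp, of "coord z"] z by (simp add: point_coord)
    finally show ?thesis .
  qed
  ultimately show ?thesis unfolding harmonic_on_def C2_on_def by blast
qed

lemma real_analytic: "real_analytic_on (set ks) b f V"
  unfolding real_analytic_on_def
proof
  fix z assume z: "z \<in> V"
  let ?m = "\<lambda>x m. \<Prod>j\<in>set ks. (x j :: real) ^ m j" and ?I = "multi_indices (set ks)"
  let ?l = "\<lambda>v x. representation B (f (z + point x)) v"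
  define x0 where "x0 = coord z"
  have x0: "point x0 = z" using point_coord[OF z] by (simp add: x0_def)
  define Q where "Q v c \<rho> \<longleftrightarrow> \<rho> > 0 \<and> (\<forall>x. (\<forall>j\<in>set ks. \<bar>x j\<bar> < \<rho>) \<longrightarrow> z + point x \<in> V \<and>
      ((\<lambda>m. ?m x m * c m) has_sum ?l v x) ?I)"
    for v c and \<rho> :: real
  have "\<exists>c \<rho>. Q v c \<rho>" for v
  proof -
    obtain R0 where R0: "R0 > 0" "fits x0 R0" using room[of x0] z x0 by (auto simp: fits_def)
    have bl: "bounded_linear (\<lambda>y. representation B y v)"
      by (rule bounded_linear_finite_dim[OF B(1,3) linear_representation[OF B(2,3)]])
    have "continuous_on V (\<lambda>y. representation B (f y) v)"
      by (rule bounded_linear.continuous_on[OF bl differentiable_imp_continuous_on[OF diff]])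
    then obtain \<delta> where \<delta>: "\<delta> > 0" "\<And>y. y \<in> V \<Longrightarrow> dist y z < \<delta> \<Longrightarrow> dist (representation B (f y) v) (representation B (f z) v) < 1"
      using z unfolding continuous_on_iff by (metis zero_less_one)
    define N where "N = (\<Sum>j\<in>set ks. norm (b j))"
    have N0: "N \<ge> 0" by (simp add: N_def sum_nonneg)
    define P where "P = N + 1"
    have P: "P > 0" using N0 by (simp add: P_def)
    \<comment> \<open>A point of the cube is sent by \<open>point\<close> to a vector of norm at
      most \<open>2 * N\<close>, so scaling by \<open>R\<close> stays within half of \<delta>, where
      the component is bounded by continuity. The summand 1 in \<open>P\<close> avoids division by
      zero.\<close>
    define R where "R = min R0 (\<delta> / (4 * P))"
    have R: "R > 0" "R \<le> R0" using R0(1) \<delta>(1) P by (simp_all add: R_def)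
    have fit: "fits x0 R" by (rule fits_mono[OF R0(2) R])
    have M: "\<bar>comp v (shift x0 R y)\<bar> \<le> \<bar>representation B (f z) v\<bar> + 1" if y: "y \<in> cube" for y
    proof -
      have "norm (point y) \<le> (\<Sum>j\<in>set ks. 2 * norm (b j))"
        unfolding point_def
      proof (rule sum_norm_le)
        fix j assume "j \<in> set ks"
        then have "\<bar>y j\<bar> \<le> 2" using y by (auto simp: cube_def)
        then show "norm (y j *\<^sub>R b j) \<le> 2 * norm (b j)" by (simp add: mult_right_mono)
      qed
      then have nb: "norm (point y) \<le> 2 * N" by (simp add: N_def sum_distrib_left)
      have pt: "point (shift x0 R y) = z + R *\<^sub>R point y"
        by (simp add: shift_def point_add x0) (simp add: point_def scaleR_sum_right)
      have "dist (point (shift x0 R y)) z = R * norm (point y)" using R(1) by (simp add: pt dist_norm)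
      also have "\<dots> \<le> (\<delta> / (4 * P)) * (2 * P)"
        by (intro mult_mono) (use nb P \<delta>(1) in \<open>auto simp: R_def P_def\<close>)
      also have "\<dots> = \<delta> / 2" using P by simp
      also have "\<dots> < \<delta>" using \<delta>(1) by simp
      finally have "dist (point (shift x0 R y)) z < \<delta>" .
      then have "dist (representation B (f (point (shift x0 R y))) v) (representation B (f z) v) < 1"
        by (intro \<delta>(2)) (use fit y in \<open>auto simp: fits_def\<close>)
      then show ?thesis unfolding comp_def dist_real_def by linarith
    qed
    obtain c \<rho> where c: "\<rho> > 0" "\<rho> \<le> R" "\<And>x. (\<forall>j\<in>set ks. \<bar>x j\<bar> < \<rho>) \<Longrightarrow>
     ((\<lambda>m. ?m x m * c m) has_sum comp v (\<lambda>j. if j \<in> set ks then x0 j + x j else x0 j)) ?I"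
      using harmonic_class_analytic[OF harmonic_class_comp R(1) fit M] by blast
    have pt: "point (\<lambda>j. if j \<in> set ks then x0 j + x j else x0 j) = z + point x" for x
    proof -
      have "point (\<lambda>j. if j \<in> set ks then x0 j + x j else x0 j) = point (\<lambda>j. x0 j + x j)"
        unfolding point_def by (rule sum.cong) auto
      then show ?thesis by (simp add: point_add x0)
    qed
    have inV: "z + point x \<in> V" if "\<forall>j\<in>set ks. \<bar>x j\<bar> < \<rho>" for x
    proof -
      have "(\<lambda>j. x j / R) \<in> cube"
        unfolding cube_def
      proof (intro CollectI ballI)
        fix j assume "j \<in> set ks"
        then have "\<bar>x j\<bar> \<le> R" using that c(2) by force
        then have "\<bar>x j / R\<bar> \<le> 2" using R(1) by (simp add: abs_divide field_simps)
        then show "x j / R \<in> {-2..2}" unfolding abs_le_iff atLeastAtMost_iff by linarith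
      qed
      then have "shift x0 R (\<lambda>j. x j / R) \<in> {x. point x \<in> V}" using fit by (simp add: fits_def)
      then show ?thesis using R(1) by (simp add: shift_def point_add x0)
    qed
    have "Q v c \<rho>" unfolding Q_def using c(1) c(3)[unfolded comp_def pt] inV by simp
    then show ?thesis by blast
  qed
  then obtain c \<rho> where Q: "\<And>v. Q v (c v) (\<rho> v)" by metis
  have c: "\<rho> v > 0" "(\<forall>j\<in>set ks. \<bar>x j\<bar> < \<rho> v) \<Longrightarrow> z + point x \<in> V"
    "(\<forall>j\<in>set ks. \<bar>x j\<bar> < \<rho> v) \<Longrightarrow>
      ((\<lambda>m. ?m x m * c v m) has_sum ?l v x) ?I"
    for v x using Q[of v] by (simp_all add: Q_def)
  \<comment> \<open>Each component has its own radius. Including \<open>\<rho> 0\<close> makes the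
    set visibly nonempty and gives membership in \<open>V\<close> without choosing an element of
    \<open>B\<close>.\<close>
  define \<sigma> where "\<sigma> = Min (insert (\<rho> 0) (\<rho> ` B))"
  have \<sigma>: "\<sigma> > 0" "\<sigma> \<le> \<rho> 0" "\<And>v. v \<in> B \<Longrightarrow> \<sigma> \<le> \<rho> v" unfolding \<sigma>_def using B(1) c(1) by auto
  define C where "C m = (\<Sum>v\<in>B. c v m *\<^sub>R v)" for m
  show "\<exists>c. \<exists>\<rho>>0. \<forall>x. (\<forall>j\<in>set ks. \<bar>x j\<bar> < \<rho>) \<longrightarrow> z + (\<Sum>j\<in>set ks. x j *\<^sub>R b j) \<in> V \<and>
      ((\<lambda>m. ?m x m *\<^sub>R c m) has_sum f (z + (\<Sum>j\<in>set ks. x j *\<^sub>R b j))) {m. \<forall>j. j \<notin> set ks \<longrightarrow> m j = 0}"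
    unfolding point_def[symmetric] multi_indices_def[symmetric]
  proof (intro exI[of _ C] exI[of _ \<sigma>] conjI allI impI \<sigma>(1))
    fix x assume x: "\<forall>j\<in>set ks. \<bar>x j\<bar> < \<sigma>"
    show "z + point x \<in> V" by (rule c(2)[of x 0]) (use x \<sigma>(2) in force)
    have "((\<lambda>m. \<Sum>v\<in>B. (?m x m * c v m) *\<^sub>R v) has_sum (\<Sum>v\<in>B. ?l v x *\<^sub>R v)) ?I"
    proof (rule has_sum_finite_sum[OF B(1)])
      fix v assume v: "v \<in> B"
      have "((\<lambda>m. ?m x m * c v m) has_sum ?l v x) ?I"
        by (rule c(3)) (use x \<sigma>(3)[OF v] in force)
      then show "((\<lambda>m. (?m x m * c v m) *\<^sub>R v) has_sum ?l v x *\<^sub>R v) ?I"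
        by (rule has_sum_bounded_linear[OF bounded_linear_scaleR_left])
    qed
    moreover have "(\<Sum>v\<in>B. ?l v x *\<^sub>R v) = f (z + point x)"
      using sum_representation_eq[OF B(2) _ B(1) order_refl, of "f (z + point x)"] B(3) by simp
    moreover have "(\<Sum>v\<in>B. (?m x m * c v m) *\<^sub>R v) = ?m x m *\<^sub>R C m" for m
      by (simp add: C_def scaleR_sum_right)
    ultimately show "((\<lambda>m. ?m x m *\<^sub>R C m) has_sum f (z + point x)) ?I"
      by simp
  qed
qed

end

section \<open>Superalgebras satisfying the conditions A0 and A1\<close>

lemma indexed_basis_representation:
  assumes "indexed_basis I e W" "i \<in> I" "j \<in> I"
  shows "representation (e ` I) (e i) (e j) = (if i = j then 1 else 0)"
  using assms representation_basis[of "e ` I" "e i"] by (auto simp: indexed_basis_def inj_on_eq_iff)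

lemma indexed_basis_in:
  assumes "indexed_basis I e W" "i \<in> I"
  shows "e i \<in> W"
proof -
  have "e i \<in> span (e ` I)" by (rule span_base) (use assms(2) in simp)
  then show ?thesis using assms(1) by (simp add: indexed_basis_def)
qed

text \<open>Extending the basis of \<open>W\<close> to a basis of the whole space makes the
  coordinates linear on all of it, hence bounded in the given norm.\<close>

lemma indexed_basis_coordinates:
  fixes e :: "'k \<Rightarrow> 'a::real_normed_vector" and B :: "'a set"
  assumes e: "indexed_basis I e W" "finite I" and B: "finite B" "span B = UNIV"
  obtains l where "\<And>i. bounded_linear (l i :: 'a \<Rightarrow> real)" "\<And>y. y \<in> W \<Longrightarrow> (\<Sum>i\<in>I. l i y *\<^sub>R e i) = y"
proof -
  have ind: "independent (e ` I)" and inj: "inj_on e I" and sp: "span (e ` I) = W"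
    using e(1) by (auto simp: indexed_basis_def)
  obtain B' where B': "e ` I \<subseteq> B'" "independent B'" "UNIV \<subseteq> span B'"
    using maximal_independent_subset_extend[OF subset_UNIV ind] by metis
  have sp': "span B' = UNIV" using B'(3) by auto
  show thesis
  proof (rule that[of "\<lambda>i y. representation B' y (e i)"])
    show "bounded_linear (\<lambda>y. representation B' y (e i))" for i
      by (rule bounded_linear_finite_dim[OF B linear_representation[OF B'(2) sp']])
    fix y assume "y \<in> W"
    then have y: "y \<in> span (e ` I)" by (simp add: sp)
    have "(\<Sum>i\<in>I. representation B' y (e i) *\<^sub>R e i) = (\<Sum>v\<in>e ` I. representation (e ` I) y v *\<^sub>R v)"
      unfolding representation_extend[OF B'(2) y B'(1)] sum.reindex[OF inj] by simp
    also have "\<dots> = y" by (rule sum_representation_eq[OF ind y]) (use e(2) in auto)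
    finally show "(\<Sum>i\<in>I. representation B' y (e i) *\<^sub>R e i) = y" .
  qed
qed

text \<open>Climbing the increasing sequence \<open>s\<close> until it first passes \<open>t\<close>
  finds a block containing \<open>t\<close>, and monotonicity excludes a second one.\<close>

lemma blocks:
  fixes s :: "nat \<Rightarrow> nat"
  assumes "s 1 = 1" "s (r + 1) = q + 1" "\<forall>k\<in>{1..r}. s k < s (k + 1)"
  shows "t \<in> {1..q} \<Longrightarrow> \<exists>!k. k \<in> {1..r} \<and> s k \<le> t \<and> t < s (k + 1)"
    and "k \<in> {1..r} \<Longrightarrow> s k \<le> t \<Longrightarrow> t < s (k + 1) \<Longrightarrow> t \<in> {1..q}"
proof -
  have mono: "s i \<le> s j" if "1 \<le> i" "i \<le> j" "j \<le> r + 1" for i j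
    using that(2,3)
  proof (induction j rule: dec_induct)
    case (step j)
    then have "s j < s (j + 1)" using assms(3) that(1) by auto
    then show ?case using step by simp
  qed simp
  show "t \<in> {1..q}" if "k \<in> {1..r}" "s k \<le> t" "t < s (k + 1)"
    using mono[of 1 k] mono[of "k + 1" "r + 1"] that assms(1,2) by auto
  show "\<exists>!k. k \<in> {1..r} \<and> s k \<le> t \<and> t < s (k + 1)" if t: "t \<in> {1..q}"
  proof (rule ex_ex1I)
    have "\<exists>k\<in>{1..<j}. s k \<le> t \<and> t < s (k + 1)" if "1 \<le> j" "t < s j" for j
      using that
    proof (induction j rule: dec_induct)
      case base
      then show ?case using assms(1) t by auto
    next
      case (step j)
      show ?case
      proof (cases "t < s j")
        case True
        then show ?thesis using step.IH by force
      next
        case False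
        then show ?thesis using step by (intro bexI[of _ j]) auto
      qed
    qed
    from this[of "r + 1"] show "\<exists>k. k \<in> {1..r} \<and> s k \<le> t \<and> t < s (k + 1)"
      using assms(2) t by force
  next
    fix k k' assume k: "k \<in> {1..r} \<and> s k \<le> t \<and> t < s (k + 1)" and k': "k' \<in> {1..r} \<and> s k' \<le> t \<and> t < s (k' + 1)"
    show "k = k'"
    proof (rule linorder_cases[of k k'])
      assume "k < k'"
      then have "s (k + 1) \<le> s k'" by (intro mono) (use k k' in auto)
      then show ?thesis using k k' by auto
    next
      assume "k' < k"
      then have "s (k' + 1) \<le> s k" by (intro mono) (use k k' in auto)
      then show ?thesis using k k' by auto
    qed
  qed
qed

theorem proposition4p3:
  fixes \<Lambda> :: "nat \<Rightarrow> 'a::{real_normed_vector,real_algebra_1} set"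
    and e \<epsilon> a :: "nat \<Rightarrow> 'a"
    and p q r :: nat
    and s :: "nat \<Rightarrow> nat"
    and E :: "'i::finite set"
    and D :: "('a ^ 'i) set"
    and f :: "'a ^ 'i \<Rightarrow> 'a"
  assumes "\<exists>B :: 'a set. finite B \<and> span B = UNIV"
    and "comm_superalgebra \<Lambda>"
    and "condition_A0 \<Lambda> p e"
    and "condition_A1 \<Lambda> q \<epsilon> r s a"
    and "openin (top_of_set (superspace \<Lambda> E)) D"
    and "connected D"
    and "qS_differentiable_on \<Lambda> E p e q \<epsilon> r s a f D"
  shows "harmonic_on (coord_index E p q) (coord_dir E e \<epsilon>) f D \<and>
         real_analytic_on (coord_index E p q) (coord_dir E e \<epsilon>) f D"
proof -
  obtain B0 :: "'a set" where B0: "finite B0" "span B0 = UNIV" using assms(1) by blast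
  obtain B :: "'a set" where "B \<subseteq> B0" "independent B" "B0 \<subseteq> span B" using maximal_independent_subset by blast
  then have B: "finite B" "independent B" "span B = UNIV"
    using B0 finite_subset span_mono[of B0 "span B"] by (auto simp: span_span)
  have e: "indexed_basis {0..p} e (\<Lambda> 0)" "e 0 = 1" "(\<Sum>k=0..p. (e k)\<^sup>2) = 0"
    using assms(3) by (auto simp: condition_A0_def)
  have \<epsilon>: "indexed_basis {1..q} \<epsilon> (\<Lambda> 1)" and s: "s 1 = 1" "s (r + 1) = q + 1" "\<forall>k\<in>{1..r}. s k < s (k + 1)"
    and a1: "\<And>k. k \<in> {1..r} \<Longrightarrow> a (s k) = 1" and a0: "\<And>k. k \<in> {1..r} \<Longrightarrow> (\<Sum>j\<in>{s k..<s (k + 1)}. (a j)\<^sup>2) = 0"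
    using assms(4) by (auto simp: condition_A1_def)
  have sub: "subspace (\<Lambda> 0)" "subspace (\<Lambda> 1)" using assms(2) by (auto simp: comm_superalgebra_def)
  have DS: "D \<subseteq> superspace \<Lambda> E" using assms(5) openin_imp_subset by blast
  define b where "b = coord_dir E e \<epsilon>"
  define K where "K = coord_index E p q"
  have finK: "finite K" by (simp add: K_def coord_index_def)
  obtain ks where ks: "set ks = K" "distinct ks" using finite_distinct_list[OF finK] by blast
  define block where "block t = (THE k. k \<in> {1..r} \<and> s k \<le> t \<and> t < s (k + 1))" for t
  have block: "block t \<in> {1..r}" "s (block t) \<le> t" "t < s (block t + 1)" if "t \<in> {1..q}" for t
    using theI'[OF blocks(1)[OF s that]] unfolding block_def by auto
  have block_eq: "block t = k" if "k \<in> {1..r}" "s k \<le> t" "t < s (k + 1)" for t k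
    using blocks(1)[OF s blocks(2)[OF s that]] block[OF blocks(2)[OF s that]] that by blast
  \<comment> \<open>Each even variable forms a single block with base 0 and multipliers
    \<open>e\<close>, so the sum of squares in the first condition is just one more block sum; an
    odd variable splits into the blocks given by \<open>s\<close>, with multipliers
    \<open>a\<close>.\<close>
  define \<beta> where "\<beta> c = (fst c, if fst c \<in> E then 0 else s (block (snd c)))" for c :: "'i \<times> nat"
  define a' where "a' c = (if fst c \<in> E then e (snd c) else a (snd c))" for c :: "'i \<times> nat"
  have K_iff: "(i, k) \<in> K \<longleftrightarrow> (if i \<in> E then k \<in> {0..p} else k \<in> {1..q})" for i k
    by (auto simp: K_def coord_index_def)
  have b_nth: "b (i, k) $ i' = (if i' = i then if i \<in> E then e k else \<epsilon> k else 0)" for i k i'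
    by (simp add: b_def coord_dir_def axis_def)
  have e_in: "e k \<in> \<Lambda> 0" if "k \<in> {0..p}" for k
    by (rule indexed_basis_in[OF e(1) that])
  have \<epsilon>_in: "\<epsilon> k \<in> \<Lambda> 1" if "k \<in> {1..q}" for k
    by (rule indexed_basis_in[OF \<epsilon> that])
  have b_in: "b c \<in> superspace \<Lambda> E" if "c \<in> K" for c
    using that e_in \<epsilon>_in sub by (cases c) (auto simp: superspace_def b_nth K_iff subspace_0 split: if_splits)
  have subS: "subspace (superspace \<Lambda> E)"
    unfolding superspace_def subspace_def using sub by (auto simp: subspace_def)
  obtain l0 where l0: "\<And>k. bounded_linear (l0 k :: 'a \<Rightarrow> real)" "\<And>y. y \<in> \<Lambda> 0 \<Longrightarrow> (\<Sum>k\<in>{0..p}. l0 k y *\<^sub>R e k) = y"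
    using indexed_basis_coordinates[OF e(1) _ B0] by auto
  obtain l1 where l1: "\<And>k. bounded_linear (l1 k :: 'a \<Rightarrow> real)" "\<And>y. y \<in> \<Lambda> 1 \<Longrightarrow> (\<Sum>k\<in>{1..q}. l1 k y *\<^sub>R \<epsilon> k) = y"
    using indexed_basis_coordinates[OF \<epsilon> _ B0] by auto
  define crd where "crd z c = (if fst c \<in> E then l0 (snd c) (z $ fst c) else l1 (snd c) (z $ fst c))"
    for z :: "'a ^ 'i" and c :: "'i \<times> nat"
  have qS: "f differentiable_on D" "\<And>z h. z \<in> D \<Longrightarrow> h \<in> superspace \<Lambda> E \<Longrightarrow> d''_form E p e q \<epsilon> r s a f z h = 0"
    using assms(7) by (auto simp: qS_differentiable_on_def)

  interpret diff_system ks f b D \<beta> a' crd B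
  proof
    show "distinct ks" by (rule ks(2))
    show "finite B" "independent B" "span B = UNIV" by (fact B)+
    show "f differentiable_on D" by (fact qS(1))
    show "\<exists>\<delta>>0. \<forall>x. (\<forall>c\<in>set ks. \<bar>x c\<bar> \<le> \<delta>) \<longrightarrow> z + (\<Sum>c\<in>set ks. x c *\<^sub>R b c) \<in> D" if z: "z \<in> D" for z
    proof -
      obtain \<eta> where \<eta>: "\<eta> > 0" "ball z \<eta> \<inter> superspace \<Lambda> E \<subseteq> D"
        using assms(5)[unfolded openin_contains_ball] z by blast
      \<comment> \<open>The summand 1 keeps the radius well defined when all directions vanish or
        there are none.\<close>
      define N where "N = (\<Sum>c\<in>set ks. norm (b c)) + 1"
      have N: "N > 0" unfolding N_def by (intro add_nonneg_pos sum_nonneg) auto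
      show ?thesis
      proof (intro exI[of _ "\<eta> / (2 * N)"] conjI allI impI)
        show "\<eta> / (2 * N) > 0" using \<eta> N by simp
        fix x assume x: "\<forall>c\<in>set ks. \<bar>x c\<bar> \<le> \<eta> / (2 * N)"
        have "norm (\<Sum>c\<in>set ks. x c *\<^sub>R b c) \<le> (\<Sum>c\<in>set ks. \<eta> / (2 * N) * norm (b c))"
          by (rule sum_norm_le, unfold norm_scaleR, rule mult_right_mono) (use x in simp_all)
        also have "\<dots> = \<eta> / (2 * N) * (N - 1)" by (simp add: N_def sum_distrib_left)
        also have "\<dots> \<le> \<eta> / (2 * N) * N" by (intro mult_left_mono) (use \<eta>(1) N in auto)
        also have "\<dots> = \<eta> / 2" using N by simp
        also have "\<dots> < \<eta>" using \<eta>(1) by simp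
        finally have "z + (\<Sum>c\<in>set ks. x c *\<^sub>R b c) \<in> ball z \<eta>" by (simp add: dist_norm)
        moreover have "z + (\<Sum>c\<in>set ks. x c *\<^sub>R b c) \<in> superspace \<Lambda> E"
          using z DS b_in ks(1) by (intro subspace_add[OF subS] subspace_sum[OF subS] subspace_scale[OF subS]) auto
        ultimately show "z + (\<Sum>c\<in>set ks. x c *\<^sub>R b c) \<in> D" using \<eta>(2) by blast
      qed
    qed
    show "continuous_on D crd"
    proof (rule continuous_on_coordinatewise_then_product)
      fix c :: "'i \<times> nat"
      show "continuous_on D (\<lambda>z. crd z c)"
        unfolding crd_def
        by (cases "fst c \<in> E")
           (simp_all add: bounded_linear.continuous_on[OF l0(1) linear_continuous_on[OF bounded_linear_vec_nth]]
             bounded_linear.continuous_on[OF l1(1) linear_continuous_on[OF bounded_linear_vec_nth]])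
    qed
    show "(\<Sum>c\<in>set ks. crd z c *\<^sub>R b c) = z" if z: "z \<in> D" for z
    proof (rule vec_eq_iff[THEN iffD2], rule allI)
      fix i
      define Ki where "Ki = (if i \<in> E then {0..p} else {1..q})"
      have K: "K = Sigma UNIV (\<lambda>i. if i \<in> E then {0..p} else {1..q})"
        by (auto simp: K_iff split: if_splits)
      have "(\<Sum>c\<in>set ks. crd z c *\<^sub>R b c) $ i = (\<Sum>c\<in>K. crd z c *\<^sub>R b c $ i)" by (simp add: ks(1))
      also have "\<dots> = (\<Sum>i'\<in>UNIV. \<Sum>k\<in>(if i' \<in> E then {0..p} else {1..q}). crd z (i', k) *\<^sub>R b (i', k) $ i)"
        unfolding K by (subst sum.Sigma) auto
      also have "\<dots> = (\<Sum>i'\<in>UNIV. if i' = i then \<Sum>k\<in>Ki. crd z (i, k) *\<^sub>R b (i, k) $ i else 0)"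
        by (rule sum.cong) (auto simp: Ki_def b_nth)
      also have "\<dots> = (\<Sum>k\<in>Ki. crd z (i, k) *\<^sub>R b (i, k) $ i)" by simp
      also have "\<dots> = z $ i"
        using z DS l0(2)[of "z $ i"] l1(2)[of "z $ i"] by (auto simp: Ki_def crd_def b_nth superspace_def)
      finally show "(\<Sum>c\<in>set ks. crd z c *\<^sub>R b c) $ i = z $ i" .
    qed
    show \<beta>K: "\<beta> c \<in> set ks" if "c \<in> set ks" for c
    proof (cases c)
      case (Pair i k)
      then have "(i, k) \<in> K" using that ks by simp
      then have "(i, if i \<in> E then 0 else s (block k)) \<in> K"
        using block[of k] blocks(2)[OF s, of "block k" "s (block k)"] s(3) by (auto simp: K_iff split: if_splits)
      then show ?thesis by (simp only: \<beta>_def Pair ks(1) fst_conv snd_conv)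
    qed
    show "a' c = 1" if "c \<in> set ks" "\<beta> c = c" for c
    proof (cases c)
      case (Pair i k)
      have "(i, k) \<in> K" using that(1) ks Pair by simp
      moreover have "k = (if i \<in> E then 0 else s (block k))" using that(2) by (simp add: \<beta>_def Pair split: if_splits)
      ultimately show ?thesis using e(2) a1[of "block k"] block(1)[of k]
        by (auto simp: a'_def Pair K_iff split: if_splits)
    qed
    show "(\<Sum>c\<in>{c\<in>set ks. \<beta> c = c0}. a' c * a' c) = 0" if c0: "c0 \<in> \<beta> ` set ks" for c0
    proof -
      obtain i k where ik: "(i, k) \<in> K" "c0 = \<beta> (i, k)" using c0 ks(1) by auto
      show ?thesis
      proof (cases "i \<in> E")
        case True
        have "{c\<in>set ks. \<beta> c = c0} = Pair i ` {0..p}"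
          using True ik by (auto simp: ks(1) \<beta>_def K_iff split: if_splits)
        then have "(\<Sum>c\<in>{c\<in>set ks. \<beta> c = c0}. a' c * a' c) = (\<Sum>k\<in>{0..p}. e k * e k)"
          using True by (simp add: sum.reindex inj_on_def a'_def)
        then show ?thesis using e(3) by (simp add: power2_eq_square)
      next
        case False
        then have k: "k \<in> {1..q}" using ik(1) by (simp add: K_iff)
        define j where "j = block k"
        have j: "j \<in> {1..r}" using block(1)[OF k] by (simp add: j_def)
        have c0_eq: "c0 = (i, s j)" using ik(2) False by (simp add: \<beta>_def j_def)
        \<comment> \<open>Different blocks have different first elements, because the block
          containing \<open>s j\<close> is \<open>j\<close> itself. Hence the base coordinate
          determines the block.\<close>
        have same: "block t = j" if t: "t \<in> {1..q}" "s (block t) = s j" for t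
        proof -
          have "s (block t) < s (block t + 1)" "s j < s (j + 1)" using s(3) block(1)[OF t(1)] j by blast+
          note less = this
          have "block (s j) = block t"
            by (rule block_eq[OF block(1)[OF t(1)]]) (simp_all only: t(2)[symmetric] less order_refl)
          moreover have "block (s j) = j"
            by (rule block_eq[OF j order_refl less(2)])
          ultimately show ?thesis by (rule subst)
        qed
        have "{c\<in>set ks. \<beta> c = c0} = Pair i ` {s j..<s (j + 1)}"
        proof (intro equalityI subsetI)
          fix c assume "c \<in> {c\<in>set ks. \<beta> c = c0}"
          then have c: "c \<in> K" "\<beta> c = (i, s j)" using ks(1) c0_eq by simp_all
          have i: "fst c = i" using c(2) by (simp add: \<beta>_def)
          have sj: "s (block (snd c)) = s j" using c(2) i False by (simp add: \<beta>_def)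
          have pair: "c = (i, snd c)" using i by (simp add: prod_eq_iff)
          then have t: "snd c \<in> {1..q}" using c(1) K_iff[of i "snd c"] False by simp
          have "snd c \<in> {s j..<s (j + 1)}" using block(2,3)[OF t] same[OF t sj] by simp
          with pair show "c \<in> Pair i ` {s j..<s (j + 1)}" by (rule image_eqI)
        next
          fix c assume "c \<in> Pair i ` {s j..<s (j + 1)}"
          then obtain t where t: "c = (i, t)" "s j \<le> t" "t < s (j + 1)" by auto
          have "(i, t) \<in> K" using blocks(2)[OF s j t(2,3)] False by (simp add: K_iff)
          moreover have "\<beta> (i, t) = c0" using block_eq[OF j t(2,3)] False c0_eq by (simp add: \<beta>_def)
          ultimately show "c \<in> {c\<in>set ks. \<beta> c = c0}" using t(1) ks(1) by simp
        qed
        then have "(\<Sum>c\<in>{c\<in>set ks. \<beta> c = c0}. a' c * a' c) = (\<Sum>k\<in>{s j..<s (j + 1)}. a k * a k)"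
          using False by (simp add: sum.reindex inj_on_def a'_def)
        then show ?thesis using a0[OF j] by (simp add: power2_eq_square)
      qed
    qed
    show "partial_deriv f (b c) z = a' c * partial_deriv f (b (\<beta> c)) z" if z: "z \<in> D" and c: "c \<in> set ks" for z c
    proof -
      obtain i k where ik1: "c = (i, k)" by (rule prod.exhaust)
      then have ik: "c = (i, k)" "(i, k) \<in> K" using c ks(1) by simp_all
      let ?p = "\<lambda>c. partial_deriv f (b c) z"
      \<comment> \<open>Inserting a coordinate direction into the form kills every term except the
        one carrying this coordinate. For the base of a block no term survives, and there the
        equation is trivial because the multiplier is 1.\<close>
      have "(\<Sum>i'\<in>E. \<Sum>j=1..p. representation (e ` {0..p}) (b (i, k) $ i') (e j) *\<^sub>R
            (?p (i', j) - e j * ?p (i', 0))) +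
         (\<Sum>i'\<in>- E. \<Sum>k'=1..r. \<Sum>t\<in>{s k' + 1..<s (k' + 1)}.
            representation (\<epsilon> ` {1..q}) (b (i, k) $ i') (\<epsilon> t) *\<^sub>R
            (?p (i', t) - a t * ?p (i', s k'))) = 0"
        (is "?X + ?Y = 0")
        using qS(2)[OF z b_in[OF ik(2)]] by (simp only: d''_form_def b_def[symmetric])
      show ?thesis
      proof (cases "i \<in> E")
        case True
        then have k: "k \<in> {0..p}" using ik(2) by (simp add: K_iff)
        have Y: "?Y = 0" using True by (intro sum.neutral ballI) (auto simp: b_nth representation_zero)
        have "?X = (\<Sum>i'\<in>E. if i' = i then \<Sum>j=1..p. (if j = k then
            ?p (i, j) - e j * ?p (i, 0) else 0) else 0)"
        proof (intro sum.cong refl)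
          fix i' assume "i' \<in> E"
          show "(\<Sum>j=1..p. representation (e ` {0..p}) (b (i, k) $ i') (e j) *\<^sub>R
              (?p (i', j) - e j * ?p (i', 0)))
            = (if i' = i then \<Sum>j=1..p. (if j = k then
            ?p (i, j) - e j * ?p (i, 0) else 0) else 0)"
          proof (cases "i' = i")
            case True
            show ?thesis
              unfolding if_P[OF True]
            proof (rule sum.cong[OF refl])
              fix j assume "j \<in> {1..p}"
              then have "representation (e ` {0..p}) (e k) (e j) = (if j = k then 1 else 0)"
                using indexed_basis_representation[OF e(1) k, of j] by auto
              then show "representation (e ` {0..p}) (b (i, k) $ i') (e j) *\<^sub>R
                  (?p (i', j) - e j * ?p (i', 0))
                = (if j = k then ?p (i, j) - e j * ?p (i, 0) else 0)"
                using True \<open>i \<in> E\<close> by (simp add: b_nth)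
            qed
          qed (simp add: b_nth representation_zero)
        qed
        also have "\<dots> = (if k \<in> {1..p} then ?p (i, k) - e k * ?p (i, 0) else 0)"
          using True by (simp add: sum.delta)
        finally have "k \<in> {1..p} \<Longrightarrow> ?p (i, k) = e k * ?p (i, 0)"
          using Y \<open>?X + ?Y = 0\<close> by simp
        moreover have "k = 0 \<or> k \<in> {1..p}" using k by auto
        ultimately show ?thesis using True e(2) by (auto simp: ik(1) \<beta>_def a'_def)
      next
        case False
        then have k: "k \<in> {1..q}" using ik(2) by (simp add: K_iff)
        have X: "?X = 0" using False by (intro sum.neutral ballI) (auto simp: b_nth representation_zero)
        define G where "G k' t = ?p (i, t) - a t * ?p (i, s k')" for k' t
        have "?Y = (\<Sum>i'\<in>- E. if i' = i then \<Sum>k'=1..r. \<Sum>t\<in>{s k' + 1..<s (k' + 1)}. (if t = k then G k' t else 0) else 0)"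
        proof (intro sum.cong refl)
          fix i' assume "i' \<in> - E"
          show "(\<Sum>k'=1..r. \<Sum>t\<in>{s k' + 1..<s (k' + 1)}. representation (\<epsilon> ` {1..q}) (b (i, k) $ i') (\<epsilon> t) *\<^sub>R
              (?p (i', t) - a t * ?p (i', s k')))
            = (if i' = i then \<Sum>k'=1..r. \<Sum>t\<in>{s k' + 1..<s (k' + 1)}. (if t = k then G k' t else 0) else 0)"
          proof (cases "i' = i")
            case True
            show ?thesis
              unfolding if_P[OF True]
            proof (intro sum.cong refl)
              fix k' t assume k': "k' \<in> {1..r}" and t: "t \<in> {s k' + 1..<s (k' + 1)}"
              have "t \<in> {1..q}" by (rule blocks(2)[OF s k']) (use t in auto)
              then have "representation (\<epsilon> ` {1..q}) (\<epsilon> k) (\<epsilon> t) = (if t = k then 1 else 0)"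
                using indexed_basis_representation[OF \<epsilon> k, of t] by auto
              then show "representation (\<epsilon> ` {1..q}) (b (i, k) $ i') (\<epsilon> t) *\<^sub>R
                  (?p (i', t) - a t * ?p (i', s k')) = (if t = k then G k' t else 0)"
                using True False by (simp add: b_nth G_def)
            qed
          qed (simp add: b_nth representation_zero)
        qed
        also have "\<dots> = (\<Sum>k'=1..r. \<Sum>t\<in>{s k' + 1..<s (k' + 1)}. (if t = k then G k' t else 0))"
          using False by (simp add: sum.delta)
        \<comment> \<open>The inner range begins one after \<open>s k'\<close>, so a coordinate
          contributes through its own block only, and not at all if it is the base.\<close>
        also have "\<dots> = (\<Sum>k'=1..r. if k' = block k then (if s k' = k then 0 else G k' k) else 0)"
        proof (intro sum.cong refl)
          fix k' assume k': "k' \<in> {1..r}"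
          have "k \<in> {s k' + 1..<s (k' + 1)} \<longleftrightarrow> k' = block k \<and> s k' \<noteq> k"
            using block_eq[OF k', of k] block(2,3)[OF k] by auto
          then show "(\<Sum>t\<in>{s k' + 1..<s (k' + 1)}. (if t = k then G k' t else 0)) = (if k' = block k then (if s k' = k then 0 else G k' k) else 0)"
            by (simp add: sum.delta)
        qed
        also have "\<dots> = (if s (block k) = k then 0 else G (block k) k)" using block(1)[OF k] by (simp add: sum.delta)
        finally have "s (block k) \<noteq> k \<Longrightarrow> G (block k) k = 0" using X \<open>?X + ?Y = 0\<close> by simp
        then show ?thesis using False a1[OF block(1)[OF k]] by (cases "s (block k) = k") (auto simp: G_def ik(1) \<beta>_def a'_def)
      qed
    qed
  qed
  show ?thesis using harmonic real_analytic by (simp add: ks(1) K_def b_def)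
qed

end
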